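(* There is an absolute constant $c>0$, and for every $\alpha>0$ a constant $K_\alpha$, such that the following holds. Let $n\ge1$, let $q$ be a prime power, let $\boldsymbol{\mu}=(\mu_{ij})_{1\le i,j\le n}$ be a matrix of $\alpha$-balanced probability measures on $\mathbf{F}_q$, and let $M$ be a random $n\times n$ matrix over $\mathbf{F}_q$ with independent entries, $M_{ij}$ having law $\mu_{ij}$. Then $$\left|\mathbf{P}(M\text{ is nonsingular})-\prod_{i=1}^\infty\left(1-\frac1{q^i}\right)\right|\le K_\alpha e^{-c\alpha n}.$$
   Context: A probability measure $\mu$ on $\mathbf{F}_q$ is called $\alpha$-balanced if $\mu(x+H)\le 1-\alpha$ for every $x\in\mathbf{F}_q$ and every proper additive subgroup $H<\mathbf{F}_q$. *)

theory Defs
  imports "HOL-Probability.Probability" "HOL-Algebra.Algebra"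
begin

text \<open>
  The constants of the theorem must not depend on the finite field, so fields are quantified over
  as records with carriers in the fixed type \<^typ>\<open>nat\<close> rather than as types of a type class.
  Every finite field is isomorphic to one of these.
\<close>

lemma finite_field_iso_nat_field:
  fixes R :: "'a ring"
  assumes "field R" "finite (carrier R)"
  shows "\<exists>S :: nat ring. field S \<and> finite (carrier S) \<and> order S = order R \<and> R \<simeq> S"
proof -
  interpret field R by fact
  obtain f :: "'a \<Rightarrow> nat" where f: "inj_on f (carrier R)"
    using finite_imp_inj_to_nat_seg[OF assms(2)] by blast
  have "field (image_ring f R)"
    using inj_imp_image_ring_is_field[OF f] .
  moreover have "carrier (image_ring f R) = f ` carrier R"
    by (rule image_ring_carrier)
  moreover have "R \<simeq> image_ring f R"
    using inj_imp_image_ring_iso[OF f] unfolding is_ring_iso_def by blast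
  ultimately show ?thesis
    using assms(2) f by (intro exI[of _ "image_ring f R"]) (auto simp: order_def card_image)
qed

text \<open>
  Probability measures on a finite field are represented as probability mass functions supported
  in its carrier.
\<close>

definition balanced :: "(nat, 'm) ring_scheme \<Rightarrow> real \<Rightarrow> nat pmf \<Rightarrow> bool" where
  "balanced R \<alpha> \<mu> \<longleftrightarrow>
     (\<forall>x\<in>carrier R. \<forall>H. additive_subgroup H R \<and> H \<subset> carrier R \<longrightarrow>
        measure_pmf.prob \<mu> (x <+\<^bsub>R\<^esub> H) \<le> 1 - \<alpha>)"

text \<open>
  An \<open>n \<times> n\<close> matrix is a function of two indices; only the values at indices below \<open>n\<close> matter.
  A random matrix is represented by its law, a probability mass function on such functions.
\<close>

definition mat_mult ::
  "('a, 'm) ring_scheme \<Rightarrow> nat \<Rightarrow> (nat \<Rightarrow> nat \<Rightarrow> 'a) \<Rightarrow> (nat \<Rightarrow> nat \<Rightarrow> 'a) \<Rightarrow> nat \<Rightarrow> nat \<Rightarrow> 'a" where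
  "mat_mult R n A B i j = (\<Oplus>\<^bsub>R\<^esub>k\<in>{..<n}. A i k \<otimes>\<^bsub>R\<^esub> B k j)"

definition nonsingular :: "('a, 'm) ring_scheme \<Rightarrow> nat \<Rightarrow> (nat \<Rightarrow> nat \<Rightarrow> 'a) \<Rightarrow> bool" where
  "nonsingular R n A \<longleftrightarrow>
     (\<exists>B. (\<forall>i<n. \<forall>j<n. B i j \<in> carrier R) \<and>
          (\<forall>i<n. \<forall>j<n. mat_mult R n A B i j = (if i = j then \<one>\<^bsub>R\<^esub> else \<zero>\<^bsub>R\<^esub>)) \<and>
          (\<forall>i<n. \<forall>j<n. mat_mult R n B A i j = (if i = j then \<one>\<^bsub>R\<^esub> else \<zero>\<^bsub>R\<^esub>)))"

end

theory Submission
  imports Defs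
begin

text \<open>
  Expose the rows one at a time and let \<open>W\<close> be the annihilator of the first \<open>k\<close> rows. They stay
  independent precisely when the next row \<open>x\<close> is not orthogonal to \<open>W\<close>, so it suffices that
  \<open>P(x \<bottom> W)\<close> is close to \<open>1 / card W = q ^ (k - n)\<close> with exponentially small exceptional
  probability.

  For \<open>k\<close> up to \<open>3 n / 4\<close> this is Odlyzko's bound \<open>(1 - \<alpha>) ^ (n - k)\<close>. Beyond that, vectors of
  small support are unlikely to be orthogonal to all rows exposed so far. For a \<open>W\<close> without such
  vectors, Fourier analysis compares the row with a lazy version \<open>y\<close> of it:
  \<open>P(x \<bottom> W)\<close> differs from \<open>1 / card W\<close> by at most \<open>2 ^ (- 9) P(y \<bottom> W) + eps\<close> for an exponentially
  small \<open>eps\<close>. If \<open>P(y \<bottom> W)\<close> is much larger than \<open>1 / card W + eps\<close>, then trading half of the rows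
  for copies of \<open>y\<close>, as in Kahn, Komlos and Szemeredi, shows that such \<open>W\<close> are unlikely. Otherwise
  \<open>P(x \<bottom> W)\<close> is at most \<open>2 (1 / card W + eps)\<close>, which is small enough as long as
  \<open>1 / card W\<close> is at most \<open>eps\<close>.

  For the last rows \<open>W\<close> has at most \<open>1 / eps\<^sup>2\<close> elements, so one can treat the vectors \<open>w \<in> W\<close>
  one by one. Those with a large \<open>P(y \<bottom> w)\<close> are excluded by trading rows again, and the remaining
  ones that are biased, in the sense that \<open>P(x \<bottom> w)\<close> is not close to \<open>1 / q\<close>, are so few by a high
  moment bound for the Fourier transform that a union bound excludes them.
\<close>

section \<open>Growth of sublevel sets\<close>

text \<open>The obstacle is uniformity: the constants may depend neither on \<open>q\<close> nor on
  how \<open>q\<close> compares with \<open>n\<close>, and no two entries need share a law. The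
  comparison with lazy rows therefore rests on a mere doubling property. One minus the squared
  modulus of a Fourier transform is a quasinorm, and balancedness drives some multiple of every
  nonzero frequency to a high level, so sublevel sets must grow. Each doubling costs a factor
  \<open>22\<close> in laziness; nine are bought. Per traded row \<open>2 ^ (- 8)\<close> is gained,
  about \<open>2 ^ (- 4 * n)\<close> for \<open>n / 2\<close> rows, which pays for at most
  \<open>2 ^ n\<close> choices of the rows that are kept and for \<open>1 / eps ^ 2\<close>
  candidates. The last rows differ because a bound of order \<open>1 / card W + eps\<close> no
  longer gives closeness to \<open>1 / card W\<close> once the latter exceeds \<open>eps\<close>.
  There \<open>q < 1 / eps\<close>, since for larger fields no row falls in that range. The union
  bound over biased vectors gains only \<open>4 / q\<close> per row and so needs large
  \<open>q\<close>; for \<open>q \<le> 32\<close> a crude bound shows that vectors of large support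
  are never biased.\<close>

lemma sum_exp_le_if_card_sublevel_le:
  fixes a :: "'b \<Rightarrow> real" and b :: "'c \<Rightarrow> real"
  assumes fin: "finite B" "finite C"
    and le: "\<And>y. M * card {t\<in>B. a t \<le> y} \<le> card {t\<in>C. b t \<le> y}"
  shows "real M * (\<Sum>t\<in>B. exp (- a t)) \<le> (\<Sum>t\<in>C. exp (- b t))"
proof -
  \<comment> \<open>Layer cake: \<open>exp (- c)\<close> is the integral of \<open>exp (- y)\<close>
    over \<open>y \<ge> c\<close>. Both sums are thus integrals of their counting functions against
    \<open>exp (- y)\<close>, and the counting inequality can be integrated.\<close>
  have I: "((\<lambda>y. if y \<in> {c..} then exp (- y) else 0) has_integral exp (- c)) UNIV" for c :: real
    using has_integral_exp_minus_to_infinity[of 1 c]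
    by (subst has_integral_restrict_UNIV) simp
  have B: "((\<lambda>y. real M * (\<Sum>t\<in>B. if y \<in> {a t..} then exp (- y) else 0)) has_integral
        real M * (\<Sum>t\<in>B. exp (- a t))) UNIV"
    by (intro has_integral_mult_right has_integral_sum fin I)
  have C: "((\<lambda>y. \<Sum>t\<in>C. if y \<in> {b t..} then exp (- y) else 0) has_integral (\<Sum>t\<in>C. exp (- b t))) UNIV"
    by (intro has_integral_sum fin I)
  have eq: "(\<Sum>t\<in>D. if y \<in> {f t..} then exp (- y) else 0) = real (card {t\<in>D. f t \<le> y}) * exp (- y)"
    if "finite D" for f :: "'d \<Rightarrow> real" and D y
    using that by (simp add: sum.If_cases Collect_conj_eq)
  show ?thesis
  proof (rule has_integral_le[OF B C])
    fix y :: real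
    have "real M * real (card {t\<in>B. a t \<le> y}) \<le> real (card {t\<in>C. b t \<le> y})"
      using le[of y] by (metis of_nat_le_iff of_nat_mult)
    then show "real M * (\<Sum>t\<in>B. if y \<in> {a t..} then exp (- y) else 0)
        \<le> (\<Sum>t\<in>C. if y \<in> {b t..} then exp (- y) else 0)"
      by (simp only: eq fin) (simp add: mult_right_mono flip: mult.assoc)
  qed
qed

text \<open>
  The condition \<open>escape\<close> says that no nontrivial cyclic subgroup stays below the level \<open>A\<close>. The
  constant \<open>22 = 2 * (10 + 1)\<close> below arises from two applications of the quasi-triangle inequality.
\<close>

locale quasinormed_group =
  fixes S :: "'b set" and add :: "'b \<Rightarrow> 'b \<Rightarrow> 'b" and z :: 'b and u :: "'b \<Rightarrow> real" and A :: real
  assumes fin: "finite S" and z: "z \<in> S" and A: "A > 0"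
    and closed: "\<And>a b. a \<in> S \<Longrightarrow> b \<in> S \<Longrightarrow> add a b \<in> S"
    and inj: "\<And>a. a \<in> S \<Longrightarrow> inj_on (add a) S"
    and u_z: "u z = 0"
    and u_add: "\<And>a b. a \<in> S \<Longrightarrow> b \<in> S \<Longrightarrow> u (add a b) \<le> 2 * (u a + u b)"
    and u_diff: "\<And>a b. a \<in> S \<Longrightarrow> b \<in> S \<Longrightarrow> u a \<le> 2 * (u (add a b) + u b)"
    and escape: "\<And>t. t \<in> S \<Longrightarrow> t \<noteq> z \<Longrightarrow> \<exists>j. u ((add t ^^ j) z) \<ge> A"
begin

text \<open>The neutral element is left out since its term is split off from every sum over the
  group.\<close>

definition sublevel :: "real \<Rightarrow> 'b set" where
  "sublevel x = {t\<in>S. t \<noteq> z \<and> u t \<le> x}"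

lemma finite_sublevel: "finite (sublevel x)"
  using fin by (simp add: sublevel_def)

lemma iterate_closed: "t \<in> S \<Longrightarrow> (add t ^^ j) z \<in> S"
  by (induction j) (auto simp: z closed)

text \<open>
  The first multiple \<open>t1\<close> of a nonzero \<open>t0\<close> to leave the level \<open>4 * x\<close> translates the sublevel set
  off itself without moving it far.
\<close>

lemma card_sublevel_double:
  assumes x: "x \<ge> 0" "4 * x < A"
  shows "2 * card (sublevel x) \<le> card (sublevel (22 * x))"
proof (cases "sublevel x = {}")
  case False
  then obtain t0 where t0: "t0 \<in> S" "t0 \<noteq> z" "u t0 \<le> x"
    by (auto simp: sublevel_def)
  define j where "j = (LEAST j. u ((add t0 ^^ j) z) > 4 * x)"
  obtain j0 where "u ((add t0 ^^ j0) z) \<ge> A"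
    using escape t0 by blast
  then have ex: "u ((add t0 ^^ j0) z) > 4 * x"
    using x by linarith
  have j: "u ((add t0 ^^ j) z) > 4 * x"
    unfolding j_def by (rule LeastI[of _ j0]) (rule ex)
  have "j \<noteq> 0"
    using j u_z x by (auto intro: ccontr)
  then obtain i where i: "j = Suc i"
    by (cases j) auto
  have "\<not> u ((add t0 ^^ i) z) > 4 * x"
    using not_less_Least[of i "\<lambda>j. u ((add t0 ^^ j) z) > 4 * x"] i j_def by simp
  define t1 where "t1 = (add t0 ^^ j) z"
  have t1: "t1 \<in> S" "u t1 > 4 * x"
    using j iterate_closed t0 by (auto simp: t1_def)
  \<comment> \<open>The predecessor of \<open>t1\<close> is still at level at most
    \<open>4 * x\<close>, so adding \<open>t0\<close> once more leads to at most
    \<open>2 * (x + 4 * x)\<close>.\<close>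
  have "u t1 \<le> 2 * (u t0 + u ((add t0 ^^ i) z))"
    unfolding t1_def i using u_add[OF t0(1) iterate_closed[OF t0(1)], of i] by simp
  with \<open>\<not> u ((add t0 ^^ i) z) > 4 * x\<close> t0(3) have t1': "u t1 \<le> 10 * x"
    by argo
  \<comment> \<open>With \<open>z\<close> put back, two disjoint copies of \<open>?T\<close> give
    \<open>2 * (N + 1) \<le> N' + 1\<close> for the two counts, slightly more than doubling.\<close>
  let ?T = "insert z (sublevel x)"
  have T: "?T \<subseteq> S" "\<And>t. t \<in> ?T \<Longrightarrow> u t \<le> x" "finite ?T" "z \<notin> sublevel x"
    using x u_z z finite_sublevel[of x] by (auto simp: sublevel_def)
  have disj: "?T \<inter> add t1 ` ?T = {}"
  proof (rule ccontr)
    assume "?T \<inter> add t1 ` ?T \<noteq> {}"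
    then obtain a b where ab: "a \<in> ?T" "b \<in> ?T" "add t1 b = a"
      by auto
    then have "u t1 \<le> 2 * (u a + u b)"
      using u_diff[OF t1(1), of b] T(1) by auto
    moreover have "u a \<le> x" "u b \<le> x"
      using T(2) ab by blast+
    ultimately show False
      using t1(2) by argo
  qed
  have sub: "?T \<union> add t1 ` ?T \<subseteq> insert z (sublevel (22 * x))"
  proof -
    have "add t1 b \<in> S \<and> u (add t1 b) \<le> 22 * x" if "b \<in> ?T" for b
      using u_add[OF t1(1), of b] T(1) T(2)[of b] that t1' closed[OF t1(1), of b] by (smt (verit) subsetD)
    moreover have "sublevel x \<subseteq> sublevel (22 * x)"
      using x by (auto simp: sublevel_def)
    ultimately show ?thesis
      unfolding sublevel_def by blast
  qed
  have "card (?T \<union> add t1 ` ?T) = card ?T + card ?T"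
    using card_Un_disjoint[OF T(3) finite_imageI[OF T(3)] disj]
      card_image[OF inj_on_subset[OF inj[OF t1(1)] T(1)]] by simp
  moreover have "card (?T \<union> add t1 ` ?T) \<le> card (insert z (sublevel (22 * x)))"
    by (rule card_mono[OF _ sub]) (simp add: finite_sublevel)
  moreover have "card (insert z (sublevel (22 * x))) = Suc (card (sublevel (22 * x)))"
    by (subst card_insert_disjoint) (auto simp: finite_sublevel, simp add: sublevel_def)
  moreover have "card ?T = Suc (card (sublevel x))"
    by (subst card_insert_disjoint) (auto simp: finite_sublevel T(4))
  ultimately show ?thesis
    by linarith
qed simp

text \<open>Doubling applies at each level \<open>22 ^ i * x\<close> with \<open>i < k\<close>: even
  \<open>22\<close> times this level is at most \<open>A\<close>, so \<open>4\<close> times it is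
  below \<open>A\<close>.\<close>

lemma card_sublevel_double_pow:
  assumes "x \<ge> 0" "22 ^ k * x \<le> A"
  shows "2 ^ k * card (sublevel x) \<le> card (sublevel (22 ^ k * x))"
  using assms
proof (induction k)
  case (Suc k)
  have p: "22 ^ k * x \<ge> 0"
    using Suc.prems by simp
  have le: "22 * (22 ^ k * x) \<le> A"
    using Suc.prems by (simp add: mult.assoc)
  have "2 ^ Suc k * card (sublevel x) \<le> 2 * card (sublevel (22 ^ k * x))"
    using Suc.IH p le Suc.prems by simp
  also have "\<dots> \<le> card (sublevel (22 * (22 ^ k * x)))"
    by (rule card_sublevel_double[OF p]) (use le p A in linarith)
  finally show ?case
    by (simp add: mult.assoc)
qed simp

text \<open>Below the level \<open>A / 22 ^ k\<close>, rescaling by \<open>22 ^ k\<close> multiplies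
  the number of elements by at least \<open>2 ^ k\<close>, and integrating this bounds their sum.
  Each element above that level contributes at most the last exponential.\<close>

lemma sum_exp_quasinorm_le:
  "(\<Sum>t\<in>S - {z}. exp (- u t / 2))
     \<le> (1/2) ^ k * (\<Sum>t\<in>S - {z}. exp (- u t / (2 * 22 ^ k))) + card S * exp (- A / (2 * 22 ^ k))"
proof -
  let ?X = "A / 22 ^ k"
  let ?B = "sublevel ?X"
  have "2 ^ k * card {t\<in>?B. u t / 2 \<le> y} \<le> card {t\<in>S - {z}. u t / (2 * 22 ^ k) \<le> y}" for y
  proof -
    \<comment> \<open>Elements of \<open>?B\<close> never exceed \<open>?X\<close>, so a count at a
      higher level equals the count at \<open>?X\<close>; the minimum keeps the doubling within its
      range.\<close>
    define x where "x = min (2 * y) ?X"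
    have 1: "{t\<in>?B. u t / 2 \<le> y} = sublevel x"
      by (auto simp: sublevel_def x_def)
    have le: "2 ^ k * card (sublevel x) \<le> card (sublevel (22 ^ k * x))" if "x \<ge> 0"
      using that A by (intro card_sublevel_double_pow) (auto simp: x_def min_def field_simps)
    have neg: "sublevel x = {}" if "\<not> x \<ge> 0"
    proof -
      have "u t \<ge> 0" if "t \<in> S" for t
        using u_add[OF that z] u_diff[OF that z] u_z by argo
      then show ?thesis
        using that by (force simp: sublevel_def)
    qed
    have "card (sublevel (22 ^ k * x)) \<le> card {t\<in>S - {z}. u t / (2 * 22 ^ k) \<le> y}"
    proof (rule card_mono)
      have "22 ^ k * x \<le> 22 ^ k * (2 * y)"
        by (intro mult_left_mono) (auto simp: x_def)
      then have "u t \<le> 22 ^ k * (2 * y)" if "u t \<le> 22 ^ k * x" for t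
        using that by (rule order_trans[rotated])
      then show "sublevel (22 ^ k * x) \<subseteq> {t\<in>S - {z}. u t / (2 * 22 ^ k) \<le> y}"
        by (fastforce simp: sublevel_def divide_le_eq mult_ac)
    qed (use fin in auto)
    then show ?thesis
      unfolding 1 using le neg by (cases "x \<ge> 0") auto
  qed
  then have "real (2 ^ k) * (\<Sum>t\<in>?B. exp (- (u t / 2))) \<le> (\<Sum>t\<in>S - {z}. exp (- (u t / (2 * 22 ^ k))))"
    by (intro sum_exp_le_if_card_sublevel_le) (use fin finite_sublevel in auto)
  then have 1: "(\<Sum>t\<in>?B. exp (- u t / 2)) \<le> (1/2) ^ k * (\<Sum>t\<in>S - {z}. exp (- u t / (2 * 22 ^ k)))"
    by (simp add: field_simps)
  have "(\<Sum>t\<in>(S - {z}) - ?B. exp (- u t / 2)) \<le> (\<Sum>t\<in>(S - {z}) - ?B. exp (- A / (2 * 22 ^ k)))"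
    by (intro sum_mono) (auto simp: sublevel_def field_simps)
  also have "\<dots> \<le> card S * exp (- A / (2 * 22 ^ k))"
    using fin by (auto intro!: mult_right_mono card_mono)
  finally have 2: "(\<Sum>t\<in>(S - {z}) - ?B. exp (- u t / 2)) \<le> card S * exp (- A / (2 * 22 ^ k))" .
  have "(\<Sum>t\<in>S - {z}. exp (- u t / 2)) = (\<Sum>t\<in>(S - {z}) - ?B. exp (- u t / 2)) + (\<Sum>t\<in>?B. exp (- u t / 2))"
    by (rule sum.subset_diff) (use fin in \<open>auto simp: sublevel_def\<close>)
  with 1 2 show ?thesis
    by linarith
qed

end

section \<open>Product distributions\<close>

lemma prob_bind_pmf:
  "measure_pmf.prob (bind_pmf M N) A = measure_pmf.expectation M (\<lambda>x. measure_pmf.prob (N x) A)"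
  unfolding measure_pmf_bind
  by (rule measure_pmf.measure_bind[where N = "count_space UNIV"])
     (auto simp: space_subprob_algebra measure_pmf.subprob_space_axioms)

text \<open>Conditioning on all coordinates but \<open>i\<close>, as needed to expose one more row
  of the matrix or one more entry of a row.\<close>

lemma prob_Pi_pmf_insert:
  assumes "finite A" "i \<notin> A"
  shows "measure_pmf.prob (Pi_pmf (insert i A) d p) {f. Q f} =
    measure_pmf.expectation (Pi_pmf A d p) (\<lambda>f. measure_pmf.prob (p i) {x. Q (f(i := x))})"
proof -
  have "measure_pmf.prob (Pi_pmf (insert i A) d p) {f. Q f} =
     measure_pmf.prob (bind_pmf (Pi_pmf A d p) (\<lambda>f. map_pmf (\<lambda>x. f(i := x)) (p i))) {f. Q f}"
    by (subst Pi_pmf_insert'[OF assms], subst bind_commute_pmf) (simp add: map_pmf_def)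
  also have "\<dots> = measure_pmf.expectation (Pi_pmf A d p)
     (\<lambda>f. measure_pmf.prob (map_pmf (\<lambda>x. f(i := x)) (p i)) {f. Q f})"
    by (rule prob_bind_pmf)
  finally show ?thesis
    by (simp add: vimage_def)
qed

lemma prob_Pi_pmf_mono_set:
  assumes "finite B" "A \<subseteq> B" "\<And>f g. (\<And>i. i \<in> A \<Longrightarrow> f i = g i) \<Longrightarrow> Q f = Q g"
  shows "measure_pmf.prob (Pi_pmf B d p) {f. Q f} = measure_pmf.prob (Pi_pmf A d p) {f. Q f}"
proof -
  have "Q (\<lambda>x. if x \<in> A then f x else d) = Q f" for f
    by (rule assms(3)) simp
  then show ?thesis
    by (subst Pi_pmf_subset[OF assms(1,2)]) (simp add: vimage_def)
qed

lemma prob_pair_pmf_Times: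
  "measure_pmf.prob (pair_pmf M N) (A \<times> B) = measure_pmf.prob M A * measure_pmf.prob N B"
proof -
  have "measure_pmf.prob (pair_pmf M N) (A \<times> B) = measure_pmf.prob (pair_pmf M N) ((A \<times> B) \<inter> set_pmf (pair_pmf M N))"
    by (simp only: measure_Int_set_pmf)
  also have "(A \<times> B) \<inter> set_pmf (pair_pmf M N) = (A \<inter> set_pmf M) \<times> (B \<inter> set_pmf N)"
    by auto
  also have "measure_pmf.prob (pair_pmf M N) \<dots> =
      measure_pmf.prob M (A \<inter> set_pmf M) * measure_pmf.prob N (B \<inter> set_pmf N)"
    by (rule measure_pmf_prob_product) (auto intro: countable_Int2 countable_set_pmf)
  finally show ?thesis
    by (simp only: measure_Int_set_pmf)
qed

lemma prob_Pi_pmf_indep: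
  assumes "finite C" "A \<subseteq> C" "B \<subseteq> C" "A \<inter> B = {}"
    and Q: "\<And>f g :: 'a \<Rightarrow> 'b. (\<And>i. i \<in> A \<Longrightarrow> f i = g i) \<Longrightarrow> Q f = Q g"
    and R: "\<And>f g. (\<And>i. i \<in> B \<Longrightarrow> f i = g i) \<Longrightarrow> R f = R g"
  shows "measure_pmf.prob (Pi_pmf C d p) {f. Q f \<and> R f} =
    measure_pmf.prob (Pi_pmf C d p) {f. Q f} * measure_pmf.prob (Pi_pmf C d p) {f. R f}"
proof -
  have fin: "finite A" "finite B"
    using assms(1-3) finite_subset by auto
  let ?h = "\<lambda>(f :: 'a \<Rightarrow> 'b, g) x. if x \<in> A then f x else g x"
  have "measure_pmf.prob (Pi_pmf C d p) {f. Q f \<and> R f} =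
      measure_pmf.prob (Pi_pmf (A \<union> B) d p) {f. Q f \<and> R f}"
  proof (rule prob_Pi_pmf_mono_set)
    fix f g :: "'a \<Rightarrow> 'b" assume "\<And>i. i \<in> A \<union> B \<Longrightarrow> f i = g i"
    then have "Q f = Q g" "R f = R g"
      using Q[of f g] R[of f g] by blast+
    then show "(Q f \<and> R f) = (Q g \<and> R g)"
      by simp
  qed (use assms in auto)
  also have "\<dots> = measure_pmf.prob (pair_pmf (Pi_pmf A d p) (Pi_pmf B d p)) {fg. Q (?h fg) \<and> R (?h fg)}"
    using assms(4) by (subst Pi_pmf_union[OF fin]) (auto simp: vimage_def case_prod_unfold)
  also have "{fg. Q (?h fg) \<and> R (?h fg)} = {f. Q f} \<times> {f. R f}"
  proof -
    have "Q (\<lambda>x. if x \<in> A then f x else g x) = Q f" "R (\<lambda>x. if x \<in> A then f x else g x) = R g" for f g :: "'a \<Rightarrow> 'b"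
      by (rule Q, simp) (rule R, use assms(4) in auto)
    then show ?thesis
      by (auto simp: case_prod_unfold)
  qed
  also have "measure_pmf.prob (pair_pmf (Pi_pmf A d p) (Pi_pmf B d p)) \<dots> =
      measure_pmf.prob (Pi_pmf A d p) {f. Q f} * measure_pmf.prob (Pi_pmf B d p) {f. R f}"
    by (rule prob_pair_pmf_Times)
  also have "measure_pmf.prob (Pi_pmf A d p) {f. Q f} = measure_pmf.prob (Pi_pmf C d p) {f. Q f}"
    by (rule prob_Pi_pmf_mono_set[OF assms(1,2), symmetric]) (rule Q)
  also have "measure_pmf.prob (Pi_pmf B d p) {f. R f} = measure_pmf.prob (Pi_pmf C d p) {f. R f}"
    by (rule prob_Pi_pmf_mono_set[OF assms(1,3), symmetric]) (rule R)
  finally show ?thesis .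
qed

section \<open>Subspaces and annihilators over a finite field\<close>

locale finite_field_vectors = field F for F :: "('a, 'm) ring_scheme" (structure) +
  fixes n :: nat
  assumes finite_carrier [simp]: "finite (carrier F)"
begin

abbreviation "q \<equiv> card (carrier F)"

text \<open>
  Vectors are padded with zeros outside \<open>{..<n}\<close>, so that they are closed under the pointwise
  operations.
\<close>

definition "vecs = PiE_dflt {..<n} \<zero> (\<lambda>_. carrier F)"
definition dot :: "(nat \<Rightarrow> 'a) \<Rightarrow> (nat \<Rightarrow> 'a) \<Rightarrow> 'a" where
  "dot w x = (\<Oplus>j\<in>{..<n}. w j \<otimes> x j)"
definition vadd :: "(nat \<Rightarrow> 'a) \<Rightarrow> (nat \<Rightarrow> 'a) \<Rightarrow> nat \<Rightarrow> 'a" where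
  "vadd v w = (\<lambda>j. v j \<oplus> w j)"
definition smul :: "'a \<Rightarrow> (nat \<Rightarrow> 'a) \<Rightarrow> nat \<Rightarrow> 'a" where
  "smul t w = (\<lambda>j. t \<otimes> w j)"
definition zvec :: "nat \<Rightarrow> 'a" where
  "zvec = (\<lambda>_. \<zero>)"
definition subsp :: "(nat \<Rightarrow> 'a) set \<Rightarrow> bool" where
  "subsp W \<longleftrightarrow> W \<subseteq> vecs \<and> zvec \<in> W \<and> (\<forall>v\<in>W. \<forall>w\<in>W. vadd v w \<in> W) \<and>
     (\<forall>t\<in>carrier F. \<forall>w\<in>W. smul t w \<in> W)"
definition ann :: "'i set \<Rightarrow> ('i \<Rightarrow> nat \<Rightarrow> 'a) \<Rightarrow> (nat \<Rightarrow> 'a) set" where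
  "ann I x = {w\<in>vecs. \<forall>i\<in>I. dot w (x i) = \<zero>}"

lemma q_ge_2: "q \<ge> 2"
proof -
  have "card {\<zero>, \<one>} \<le> q"
    by (rule card_mono) auto
  then show ?thesis
    by simp
qed

lemma q_pos [simp]: "q > 0"
  using q_ge_2 by linarith

lemma vecs_iff: "w \<in> vecs \<longleftrightarrow> (\<forall>j<n. w j \<in> carrier F) \<and> (\<forall>j\<ge>n. w j = \<zero>)"
  by (auto simp: vecs_def PiE_dflt_def not_less)

lemma vecs_nth [simp]: "w \<in> vecs \<Longrightarrow> w j \<in> carrier F"
  by (cases "j < n") (auto simp: vecs_iff)

lemma finite_vecs [simp]: "finite vecs"
  unfolding vecs_def by (rule finite_PiE_dflt) auto

lemma card_vecs: "card vecs = q ^ n"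
  unfolding vecs_def by (subst card_PiE_dflt) auto

lemma zvec_vecs [simp]: "zvec \<in> vecs"
  by (simp add: vecs_iff zvec_def)

lemma vadd_vecs [simp]: "v \<in> vecs \<Longrightarrow> w \<in> vecs \<Longrightarrow> vadd v w \<in> vecs"
  by (simp add: vecs_iff vadd_def)

lemma smul_vecs [simp]: "t \<in> carrier F \<Longrightarrow> w \<in> vecs \<Longrightarrow> smul t w \<in> vecs"
  by (simp add: vecs_iff smul_def)

lemma dot_closed [simp]: "w \<in> vecs \<Longrightarrow> x \<in> vecs \<Longrightarrow> dot w x \<in> carrier F"
  unfolding dot_def by (rule finsum_closed) auto

lemma dot_vadd: "v \<in> vecs \<Longrightarrow> w \<in> vecs \<Longrightarrow> x \<in> vecs \<Longrightarrow> dot (vadd v w) x = dot v x \<oplus> dot w x"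
  unfolding dot_def vadd_def
  by (subst finsum_addf[symmetric]) (auto intro!: finsum_cong' simp: l_distr)

lemma dot_smul: "t \<in> carrier F \<Longrightarrow> w \<in> vecs \<Longrightarrow> x \<in> vecs \<Longrightarrow> dot (smul t w) x = t \<otimes> dot w x"
  unfolding dot_def smul_def
  by (subst finsum_rdistr) (auto intro!: finsum_cong' simp: m_assoc)

lemma dot_commute: "w \<in> vecs \<Longrightarrow> x \<in> vecs \<Longrightarrow> dot w x = dot x w"
  unfolding dot_def by (auto intro!: finsum_cong' simp: m_comm)

lemma dot_zvec [simp]: "x \<in> vecs \<Longrightarrow> dot zvec x = \<zero>"
  unfolding dot_def zvec_def by (simp cong: finsum_cong)

lemma subspD:
  assumes "subsp W"
  shows "W \<subseteq> vecs" "zvec \<in> W" "\<And>v w. v \<in> W \<Longrightarrow> w \<in> W \<Longrightarrow> vadd v w \<in> W"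
    "\<And>t w. t \<in> carrier F \<Longrightarrow> w \<in> W \<Longrightarrow> smul t w \<in> W" "finite W" "W \<noteq> {}" "card W > 0"
  using assms finite_subset[OF _ finite_vecs] by (auto simp: subsp_def card_gt_0_iff)

lemma subsp_vecs [simp]: "subsp vecs"
  by (auto simp: subsp_def)

lemma vadd_neg_cancel:
  assumes "v \<in> vecs" "w \<in> vecs"
  shows "vadd v (vadd (smul (\<ominus> \<one>) v) w) = w" "vadd (smul (\<ominus> \<one>) v) (vadd v w) = w"
  using assms by (auto simp: fun_eq_iff vadd_def smul_def l_minus r_neg1 r_neg2)

lemma inj_vadd: "v \<in> vecs \<Longrightarrow> inj_on (vadd v) vecs"
  by (rule inj_on_inverseI[where g = "vadd (smul (\<ominus> \<one>) v)"]) (simp add: vadd_neg_cancel)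

text \<open>Rank and nullity for a single functional: \<open>W\<close> splits into the multiples of
  a vector \<open>w1\<close> of value \<open>1\<close> and the kernel. The functional is arbitrary
  because both products with a fixed vector and single coordinates occur later.\<close>

lemma card_kernel:
  assumes W: "subsp W" and cl: "\<And>w. w \<in> W \<Longrightarrow> \<phi> w \<in> carrier F"
    and add: "\<And>v w. v \<in> W \<Longrightarrow> w \<in> W \<Longrightarrow> \<phi> (vadd v w) = \<phi> v \<oplus> \<phi> w"
    and smul: "\<And>t w. t \<in> carrier F \<Longrightarrow> w \<in> W \<Longrightarrow> \<phi> (smul t w) = t \<otimes> \<phi> w"
    and w0: "w0 \<in> W" "\<phi> w0 \<noteq> \<zero>"
  shows "card W = q * card {w\<in>W. \<phi> w = \<zero>}"
proof -
  let ?N = "{w\<in>W. \<phi> w = \<zero>}"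
  have w0u: "\<phi> w0 \<in> Units F"
    using w0 cl field_Units by auto
  define w1 where "w1 = smul (inv (\<phi> w0)) w0"
  have w1: "w1 \<in> W" "\<phi> w1 = \<one>" "w1 \<in> vecs"
    using w0 w0u subspD[OF W] by (auto simp: w1_def smul)
  have "bij_betw (\<lambda>(c, w). vadd (smul c w1) w) (carrier F \<times> ?N) W"
  proof (rule bij_betw_byWitness[where f' = "\<lambda>w. (\<phi> w, vadd (smul (\<ominus> \<phi> w) w1) w)"])
    have "\<phi> (vadd (smul c w1) w) = c" "vadd (smul (\<ominus> c) w1) (vadd (smul c w1) w) = w"
      if "c \<in> carrier F" "w \<in> W" "\<phi> w = \<zero>" for c w
    proof -
      show "\<phi> (vadd (smul c w1) w) = c"
        using that w1 subspD[OF W] by (simp add: add smul)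
      show "vadd (smul (\<ominus> c) w1) (vadd (smul c w1) w) = w"
        using that w1 subspD(1)[OF W] by (auto simp: fun_eq_iff vadd_def smul_def l_minus r_neg1 subset_iff)
    qed
    then show "\<forall>a\<in>carrier F \<times> ?N.
        (\<lambda>w. (\<phi> w, vadd (smul (\<ominus> \<phi> w) w1) w)) ((\<lambda>(c, w). vadd (smul c w1) w) a) = a"
      by simp
    show "\<forall>w\<in>W. (\<lambda>(c, w). vadd (smul c w1) w) (\<phi> w, vadd (smul (\<ominus> \<phi> w) w1) w) = w"
      using w1 cl subspD(1)[OF W] by (auto simp: fun_eq_iff vadd_def smul_def l_minus r_neg2 subset_iff)
    show "(\<lambda>(c, w). vadd (smul c w1) w) ` (carrier F \<times> ?N) \<subseteq> W"
      using w1 subspD[OF W] by auto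
    show "(\<lambda>w. (\<phi> w, vadd (smul (\<ominus> \<phi> w) w1) w)) ` W \<subseteq> carrier F \<times> ?N"
      using w1 cl subspD[OF W] by (auto simp: add smul l_neg)
  qed
  then show ?thesis
    using bij_betw_same_card by (fastforce simp: card_cartesian_product)
qed

lemma card_dot_kernel:
  assumes "subsp W" "x \<in> vecs" "w0 \<in> W" "dot w0 x \<noteq> \<zero>"
  shows "card W = q * card {w\<in>W. dot w x = \<zero>}"
  by (rule card_kernel[where \<phi> = "\<lambda>w. dot w x", OF assms(1) _ _ _ assms(3,4)])
     (use assms subspD(1)[OF assms(1)] in \<open>auto simp: dot_vadd dot_smul subset_iff\<close>)

lemma card_dot_kernel_le:
  assumes "subsp W" "x \<in> vecs"
  shows "card W \<le> q * card {w\<in>W. dot w x = \<zero>}"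
proof (cases "\<exists>w\<in>W. dot w x \<noteq> \<zero>")
  case False
  then have "{w\<in>W. dot w x = \<zero>} = W"
    by auto
  then show ?thesis
    using q_ge_2 by simp
qed (use card_dot_kernel[OF assms] in auto)

lemma ann_empty [simp]: "ann {} x = vecs"
  by (simp add: ann_def)

lemma ann_insert: "W \<inter> ann (insert i I) x = {w\<in>W \<inter> ann I x. dot w (x i) = \<zero>}"
  by (auto simp: ann_def)

lemma ann_Un: "ann (I \<union> J) x = ann I x \<inter> ann J x"
  by (auto simp: ann_def)

lemma ann_subset_vecs: "ann I x \<subseteq> vecs"
  by (auto simp: ann_def)

lemma ann_antimono: "I \<subseteq> J \<Longrightarrow> ann J x \<subseteq> ann I x"
  by (auto simp: ann_def)

lemma ann_cong: "(\<And>i. i \<in> I \<Longrightarrow> x i = y i) \<Longrightarrow> ann I x = ann I y"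
  by (auto simp: ann_def)

lemma subsp_ann:
  assumes "subsp W" "\<And>i. i \<in> I \<Longrightarrow> x i \<in> vecs"
  shows "subsp (W \<inter> ann I x)"
  using assms unfolding subsp_def ann_def by (auto simp: dot_vadd dot_smul subset_iff)

lemma subsp_ann': "(\<And>i. i \<in> I \<Longrightarrow> x i \<in> vecs) \<Longrightarrow> subsp (ann I x)"
  using subsp_ann[OF subsp_vecs, of I x] ann_subset_vecs[of I x] by (simp add: Int_absorb1)

text \<open>Rows are collected greedily, and one is kept only if it cuts down the annihilator inside
  \<open>W\<close>; each kept row divides the cardinality by exactly \<open>q\<close>. Working
  inside \<open>W\<close> covers both rows restricted to a support and rows modulo the span of other
  rows.\<close>

lemma exists_basis:
  assumes "subsp W" "finite J" "\<And>i. i \<in> J \<Longrightarrow> x i \<in> vecs"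
  shows "\<exists>I\<subseteq>J. W \<inter> ann I x = W \<inter> ann J x \<and> card (W \<inter> ann I x) * q ^ card I = card W"
  using assms(2,3)
proof (induction J rule: finite_induct)
  case empty
  then show ?case
    using subspD(1)[OF assms(1)] by (simp add: Int_absorb2)
next
  case (insert j J)
  then obtain I where I: "I \<subseteq> J" "W \<inter> ann I x = W \<inter> ann J x" "card (W \<inter> ann I x) * q ^ card I = card W"
    by auto
  have sub: "subsp (W \<inter> ann I x)"
    by (rule subsp_ann[OF assms(1)]) (use I insert.prems in auto)
  show ?case
  proof (cases "\<exists>w\<in>W \<inter> ann I x. dot w (x j) \<noteq> \<zero>")
    case True
    then have "card (W \<inter> ann I x) = q * card (W \<inter> ann (insert j I) x)"
      using card_dot_kernel[OF sub] insert.prems by (auto simp: ann_insert)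
    moreover have "finite I" "j \<notin> I"
      using I(1) insert.hyps finite_subset by auto
    ultimately have "card (W \<inter> ann (insert j I) x) * q ^ card (insert j I) = card W"
      using I(3) by (simp add: mult_ac)
    moreover have "W \<inter> ann (insert j I) x = W \<inter> ann (insert j J) x"
      using I(2) by (simp add: ann_insert)
    ultimately show ?thesis
      using I(1) by (intro exI[of _ "insert j I"]) auto
  next
    case False
    then have "W \<inter> ann (insert j J) x = W \<inter> ann I x"
      using I(2) by (auto simp: ann_insert)
    then show ?thesis
      using I by (intro exI[of _ I]) auto
  qed
qed

lemma card_ann_le:
  assumes "subsp W" "finite J" "I \<subseteq> J" "\<And>i. i \<in> J \<Longrightarrow> x i \<in> vecs"
  shows "card (W \<inter> ann I x) \<le> q ^ card (J - I) * card (W \<inter> ann J x)"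
proof -
  have "card (W \<inter> ann I x) \<le> q ^ card D * card (W \<inter> ann (I \<union> D) x)" if "finite D" "D \<subseteq> J" for D
    using that
  proof (induction D rule: finite_induct)
    case (insert j D)
    have "subsp (W \<inter> ann (I \<union> D) x)"
      by (rule subsp_ann[OF assms(1)]) (use assms insert.prems in auto)
    then have "card (W \<inter> ann (I \<union> D) x) \<le> q * card (W \<inter> ann (insert j (I \<union> D)) x)"
      using card_dot_kernel_le[of "W \<inter> ann (I \<union> D) x" "x j"] assms(4)[of j] insert.prems
      by (auto simp: ann_insert)
    then have "q ^ card D * card (W \<inter> ann (I \<union> D) x) \<le> q ^ card D * (q * card (W \<inter> ann (insert j (I \<union> D)) x))"
      by (rule mult_left_mono) simp
    moreover have "card (W \<inter> ann I x) \<le> q ^ card D * card (W \<inter> ann (I \<union> D) x)"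
      using insert by blast
    ultimately have "card (W \<inter> ann I x) \<le> q ^ card D * (q * card (W \<inter> ann (insert j (I \<union> D)) x))"
      by (rule order_trans[rotated])
    with insert.hyps show ?case
      by (simp add: mult_ac)
  qed simp
  from this[of "J - I"] show ?thesis
    using assms by (simp add: Un_absorb1)
qed

text \<open>
  Subspaces are only ever compared through their cardinalities; linear independence is expressed by
  the size of the annihilator.
\<close>

definition indep :: "'i set \<Rightarrow> ('i \<Rightarrow> nat \<Rightarrow> 'a) \<Rightarrow> bool" where
  "indep I x \<longleftrightarrow> card (ann I x) * q ^ card I = q ^ n"

lemma indep_cong: "(\<And>i. i \<in> I \<Longrightarrow> x i = y i) \<Longrightarrow> indep I x = indep I y"
  unfolding indep_def using ann_cong[of I x y] by simp

lemma indep_empty [simp]: "indep {} x"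
  by (simp add: indep_def card_vecs)

lemma card_ann_ge:
  assumes "finite I" "\<And>i. i \<in> I \<Longrightarrow> x i \<in> vecs"
  shows "q ^ n \<le> card (ann I x) * q ^ card I"
  using card_ann_le[OF subsp_vecs assms(1) _ assms(2), of "{}" "\<lambda>i. i"] ann_subset_vecs[of I x]
  by (simp add: card_vecs Int_absorb1 mult.commute)

text \<open>Dropping the rows in \<open>J - I\<close> enlarges the annihilator by at most one factor
  \<open>q\<close> per row, so the annihilator of \<open>I\<close> is no larger than independence
  predicts; it is never smaller.\<close>

lemma indep_subset:
  assumes "indep J x" "I \<subseteq> J" "finite J" "\<And>i. i \<in> J \<Longrightarrow> x i \<in> vecs"
  shows "indep I x"
proof -
  have fin: "finite I"
    using assms finite_subset by auto
  have "card (ann I x) * q ^ card I \<le> q ^ card (J - I) * card (ann J x) * q ^ card I"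
    using card_ann_le[OF subsp_vecs assms(3,2,4), of "\<lambda>i. i"] ann_subset_vecs[of I x] ann_subset_vecs[of J x]
    by (simp add: Int_absorb1)
  also have "\<dots> = card (ann J x) * q ^ card J"
    using card_Diff_subset[OF fin assms(2)] card_mono[OF assms(3,2)]
    by (simp add: mult_ac flip: power_add)
  also have "\<dots> = q ^ n"
    using assms(1) by (simp add: indep_def)
  finally show ?thesis
    using card_ann_ge[OF fin, of x] assms(2,4) by (auto simp: indep_def subset_iff)
qed

lemma indep_card_ann:
  assumes "indep I x" 
  shows "card I \<le> n" "card (ann I x) = q ^ (n - card I)"
proof -
  have e: "card (ann I x) * q ^ card I = q ^ n"
    using assms by (simp add: indep_def)
  then have "card (ann I x) \<noteq> 0"
    using q_pos by (metis mult_is_0 power_eq_0_iff less_numeral_extra(3))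
  then have "q ^ card I \<le> q ^ n"
    unfolding e[symmetric] by simp
  then show le: "card I \<le> n"
    using q_ge_2 by (simp add: power_increasing_iff)
  have "card (ann I x) * q ^ card I = q ^ (n - card I) * q ^ card I"
    using e le by (simp flip: power_add)
  then show "card (ann I x) = q ^ (n - card I)"
    using q_pos by (metis mult_right_cancel power_eq_0_iff less_numeral_extra(3))
qed

lemma indep_insert_iff:
  assumes "finite I" "i \<notin> I" "indep I x" "\<And>j. j \<in> insert i I \<Longrightarrow> x j \<in> vecs"
  shows "indep (insert i I) x \<longleftrightarrow> (\<exists>w\<in>ann I x. dot w (x i) \<noteq> \<zero>)"
proof -
  have sub: "subsp (ann I x)"
    using assms by (intro subsp_ann') auto
  have i: "ann (insert i I) x = {w\<in>ann I x. dot w (x i) = \<zero>}"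
    by (auto simp: ann_def)
  show ?thesis
  proof
    assume "\<exists>w\<in>ann I x. dot w (x i) \<noteq> \<zero>"
    then have "card (ann I x) = q * card (ann (insert i I) x)"
      using card_dot_kernel[OF sub] assms i by auto
    then show "indep (insert i I) x"
      using assms by (simp add: indep_def mult_ac)
  next
    assume *: "indep (insert i I) x"
    show "\<exists>w\<in>ann I x. dot w (x i) \<noteq> \<zero>"
    proof (rule ccontr)
      assume "\<not> ?thesis"
      then have "ann (insert i I) x = ann I x"
        using i by auto
      then have "card (ann I x) * q ^ card I * q = card (ann I x) * q ^ card I"
        using * assms by (simp add: indep_def mult_ac)
      moreover have "card (ann I x) * q ^ card I > 0"
        using assms by (simp add: indep_def)
      ultimately show False
        using q_ge_2 by simp
    qed
  qed
qed

end

section \<open>Additive characters and Fourier transforms\<close>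

text \<open>A maximal proper subgroup \<open>H\<close> has a cyclic quotient, generated by any
  \<open>g\<close> outside \<open>H\<close>. The character sends \<open>H\<close> to
  \<open>1\<close> and \<open>g\<close> to a primitive root of unity whose order \<open>N\<close> is
  the order of \<open>g\<close> modulo \<open>H\<close>.\<close>

lemma (in comm_group) exists_nontrivial_character:
  assumes fin: "finite (carrier G)" and nontriv: "carrier G \<noteq> {\<one>}"
  shows "\<exists>\<psi> :: 'a \<Rightarrow> complex. (\<forall>x\<in>carrier G. \<forall>y\<in>carrier G. \<psi> (x \<otimes> y) = \<psi> x * \<psi> y) \<and>
           \<psi> \<one> = 1 \<and> (\<exists>x\<in>carrier G. \<psi> x \<noteq> 1)"
proof -
  define Subs where "Subs = {H. subgroup H G \<and> H \<noteq> carrier G}"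
  have "Subs \<subseteq> Pow (carrier G)"
    by (auto simp: Subs_def dest: subgroup.subset)
  then have "finite Subs"
    using fin finite_subset by blast
  moreover have "{\<one>} \<in> Subs"
    using nontriv triv_subgroup by (auto simp: Subs_def)
  ultimately obtain H where H: "subgroup H G" "H \<noteq> carrier G"
    and max: "\<And>H'. H' \<in> Subs \<Longrightarrow> card H' \<le> card H"
  proof -
    have "Max (card ` Subs) \<in> card ` Subs"
      using \<open>finite Subs\<close> \<open>{\<one>} \<in> Subs\<close> by (intro Max_in) auto
    then obtain H where "H \<in> Subs" "card H = Max (card ` Subs)"
      by auto
    moreover have "card H' \<le> Max (card ` Subs)" if "H' \<in> Subs" for H'
      using that \<open>finite Subs\<close> by (intro Max_ge) auto
    ultimately show thesis
      by (intro that[of H]) (auto simp: Subs_def)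
  qed
  interpret H: subgroup H G by (rule H)
  obtain g where g: "g \<in> carrier G" "g \<notin> H"
    using H H.subset by blast
  define N where "N = (LEAST N. N > 0 \<and> g [^] (N::nat) \<in> H)"
  have "g [^] order G \<in> H" "order G > 0"
    using g fin pow_order_eq_1 by (auto simp: order_gt_0_iff_finite)
  then have "N > 0 \<and> g [^] N \<in> H"
    unfolding N_def by (intro LeastI[of "\<lambda>N. N > 0 \<and> g [^] (N::nat) \<in> H" "order G"]) blast
  then have N: "N > 0" "g [^] N \<in> H"
    by auto
  \<comment> \<open>Division with remainder: the remainder \<open>r\<close> satisfies
    \<open>g [^] r \<in> H\<close> and is below the least positive such exponent, hence
    zero.\<close>
  have N_dvd: "int N dvd i" if i: "g [^] (i::int) \<in> H" for i
  proof -
    define r where "r = nat (i mod int N)"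
    have r: "int r = i + int N * (- (i div int N))" "r < N"
      using N(1) by (auto simp: r_def minus_mult_div_eq_mod nat_less_iff)
    have "g [^] r = g [^] (i + int N * (- (i div int N)))"
      by (simp only: int_pow_int[symmetric] r(1))
    also have "\<dots> = g [^] i \<otimes> (g [^] int N) [^] (- (i div int N))"
      by (simp only: int_pow_mult[OF g(1)] int_pow_pow[OF g(1)])
    also have "\<dots> \<in> H"
      by (rule H.m_closed[OF i subgroup_int_pow_closed[OF H(1)]]) (simp add: int_pow_int N(2))
    finally have "\<not> r > 0"
      using r(2) not_less_Least[of r "\<lambda>N. N > 0 \<and> g [^] (N::nat) \<in> H"] by (auto simp: N_def)
    then show ?thesis
      using N(1) pos_mod_sign[of "int N" i] by (auto simp: r_def intro!: mod_0_imp_dvd)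
  qed
  \<comment> \<open>\<open>P x j\<close> says that \<open>x\<close> lies in the coset of
    \<open>g [^] j\<close> modulo \<open>H\<close>.\<close>
  define P where "P = (\<lambda>x (j::int). \<exists>h\<in>H. x = h \<otimes> g [^] j)"
  let ?K = "{x. \<exists>j. P x j}"
  have "subgroup ?K G"
  proof (rule subgroupI)
    show "?K \<subseteq> carrier G"
      using g by (auto simp: P_def)
    show "?K \<noteq> {}"
    proof -
      have "P (\<one> \<otimes> g [^] (0::int)) 0"
        unfolding P_def by (rule bexI[OF refl H.one_closed])
      then show ?thesis
        by blast
    qed
  next
    fix a assume "a \<in> ?K"
    then obtain h j where "h \<in> H" "a = h \<otimes> g [^] (j::int)"
      by (auto simp: P_def)
    then have "inv a = inv h \<otimes> g [^] (- j)"
      using g by (simp add: inv_mult int_pow_neg)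
    then show "inv a \<in> ?K"
      using \<open>h \<in> H\<close> by (auto simp: P_def)
  next
    fix a b assume "a \<in> ?K" "b \<in> ?K"
    then obtain h j h' j' where "h \<in> H" "h' \<in> H" "a = h \<otimes> g [^] (j::int)" "b = h' \<otimes> g [^] (j'::int)"
      by (auto simp: P_def)
    then have "a \<otimes> b = (h \<otimes> h') \<otimes> g [^] (j + j')"
      using g by (simp add: int_pow_mult m_ac)
    then show "a \<otimes> b \<in> ?K"
      using \<open>h \<in> H\<close> \<open>h' \<in> H\<close> unfolding P_def by blast
  qed
  moreover have "insert g H \<subseteq> ?K"
  proof -
    have "P h 0" if "h \<in> H" for h
      using that by (auto simp: P_def intro!: bexI[of _ h])
    moreover have "P g 1"
      using g by (auto simp: P_def intro!: bexI[of _ \<one>])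
    ultimately show ?thesis
      by blast
  qed
  moreover have "finite ?K"
    using \<open>subgroup ?K G\<close> fin subgroup.subset finite_subset by blast
  ultimately have "card H < card ?K"
    using g(2) by (intro psubset_card_mono) auto
  then have K: "?K = carrier G"
    using max[of ?K] \<open>subgroup ?K G\<close> by (auto simp: Subs_def)
  define \<omega> where "\<omega> = (\<lambda>j::int. cis (2 * pi * real_of_int j / real N))"
  have \<omega>_add: "\<omega> (i + j) = \<omega> i * \<omega> j" for i j
    by (simp add: \<omega>_def cis_mult add_divide_distrib distrib_left)
  have \<omega>_1: "\<omega> (int N * k) = 1" for k
    using N(1) cis_multiple_2pi[of "real_of_int k"] by (simp add: \<omega>_def mult.assoc)
  \<comment> \<open>Any admissible exponent may be chosen, since two of them differ by a multiple of
    \<open>N\<close>.\<close>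
  define \<psi> where "\<psi> = (\<lambda>x. \<omega> (SOME j. P x j))"
  have \<psi>: "\<psi> x = \<omega> j" if "P x j" for x j
  proof -
    define i where "i = (SOME j. P x j)"
    have "P x i"
      unfolding i_def using that by (rule someI)
    then obtain h' where h': "h' \<in> H" "x = h' \<otimes> g [^] i"
      by (auto simp: P_def)
    from that obtain h where "h \<in> H" "x = h \<otimes> g [^] j"
      by (auto simp: P_def)
    note h = this h'
    have "g [^] i = inv h' \<otimes> (h \<otimes> g [^] j)"
      using h g by (subst inv_solve_left) auto
    then have "g [^] (i - j) = inv h' \<otimes> h"
      using h g by (simp add: int_pow_diff m_assoc)
    also have "\<dots> \<in> H"
      using h by simp
    finally obtain k where "i - j = int N * k"
      using N_dvd by auto
    then have "\<omega> i = \<omega> (int N * k + j)"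
      by (simp add: algebra_simps)
    then show ?thesis
      by (simp only: \<omega>_add \<omega>_1 \<psi>_def flip: i_def) simp
  qed
  have "\<psi> (x \<otimes> y) = \<psi> x * \<psi> y" if "x \<in> carrier G" "y \<in> carrier G" for x y
  proof -
    have "x \<in> ?K" "y \<in> ?K"
      using that unfolding K by auto
    then obtain i j where ij: "P x i" "P y j"
      unfolding mem_Collect_eq by (elim exE)
    then have "P (x \<otimes> y) (i + j)"
    proof -
      obtain h h' where "h \<in> H" "h' \<in> H" "x = h \<otimes> g [^] i" "y = h' \<otimes> g [^] j"
        using ij by (auto simp: P_def)
      then have "x \<otimes> y = (h \<otimes> h') \<otimes> g [^] (i + j)"
        using g by (simp add: int_pow_mult m_ac)
      then show ?thesis
        using \<open>h \<in> H\<close> \<open>h' \<in> H\<close> unfolding P_def by blast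
    qed
    then show ?thesis
      by (simp add: \<psi>[OF ij(1)] \<psi>[OF ij(2)] \<psi>[of "x \<otimes> y" "i + j"] \<omega>_add)
  qed
  moreover have "\<psi> \<one> = 1"
    using \<psi>[of \<one> 0] by (auto simp: P_def \<omega>_def)
  moreover have "\<psi> g \<noteq> 1"
  proof
    assume "\<psi> g = 1"
    moreover have "P g 1"
      using g by (auto simp: P_def intro!: bexI[of _ \<one>])
    ultimately have "cis (2 * pi / real N) = 1"
      by (simp add: \<psi> \<omega>_def)
    then have "cos (2 * pi / real N) = 1"
      by (simp add: complex_eq_iff)
    then obtain k :: int where "2 * pi / real N = real_of_int k * 2 * pi"
      using cos_one_2pi_int by auto
    then have "real_of_int (k * int N) = 1"
      using N(1) by (simp add: field_simps)
    then have "k * int N = 1"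
      by linarith
    then have "int N dvd 1"
      by (metis dvd_triv_right)
    then have "N = 1"
      by simp
    then show False
      using N g by simp
  qed
  ultimately show ?thesis
    using g(1) by blast
qed

lemma prod_sum_PiE_dflt:
  fixes f :: "'a \<Rightarrow> 'b \<Rightarrow> 'c :: comm_semiring_1"
  assumes "finite A" "\<And>x. x \<in> A \<Longrightarrow> finite (B x)"
  shows "(\<Prod>x\<in>A. \<Sum>y\<in>B x. f x y) = (\<Sum>g\<in>PiE_dflt A d B. \<Prod>x\<in>A. f x (g x))"
proof -
  have "(\<Prod>x\<in>A. \<Sum>y\<in>B x. f x y) = (\<Sum>g\<in>PiE A B. \<Prod>x\<in>A. f x (g x))"
    by (rule prod_sum_PiE) (use assms in auto)
  also have "PiE A B = (\<lambda>h. restrict h A) ` PiE_dflt A d B"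
    by (rule restrict_PiE_dflt[symmetric])
  also have "(\<Sum>g\<in>\<dots>. \<Prod>x\<in>A. f x (g x)) = (\<Sum>g\<in>PiE_dflt A d B. \<Prod>x\<in>A. f x (g x))"
    by (subst sum.reindex) (force simp: inj_on_def restrict_def fun_eq_iff PiE_dflt_def)+
  finally show ?thesis .
qed

lemma expectation_Pi_pmf_prod:
  fixes f :: "'a \<Rightarrow> 'b \<Rightarrow> 'c :: {banach, second_countable_topology, real_normed_field}"
  assumes A: "finite A" and B: "finite B" "\<And>x. x \<in> A \<Longrightarrow> set_pmf (p x) \<subseteq> B"
  shows "measure_pmf.expectation (Pi_pmf A d p) (\<lambda>g. \<Prod>x\<in>A. f x (g x)) =
    (\<Prod>x\<in>A. measure_pmf.expectation (p x) (f x))"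
proof -
  have "measure_pmf.expectation (Pi_pmf A d p) (\<lambda>g. \<Prod>x\<in>A. f x (g x)) =
      (\<Sum>g\<in>PiE_dflt A d (\<lambda>_. B). pmf (Pi_pmf A d p) g *\<^sub>R (\<Prod>x\<in>A. f x (g x)))"
  proof (rule integral_measure_pmf)
    show "finite (PiE_dflt A d (\<lambda>_. B))"
      by (rule finite_PiE_dflt) (use A B in auto)
    show "g \<in> PiE_dflt A d (\<lambda>_. B)" if "g \<in> set_pmf (Pi_pmf A d p)" for g
      using that B by (auto simp: set_Pi_pmf[OF A] PiE_dflt_def subset_iff)
  qed
  also have "\<dots> = (\<Sum>g\<in>PiE_dflt A d (\<lambda>_. B). \<Prod>x\<in>A. pmf (p x) (g x) *\<^sub>R f x (g x))"
    by (intro sum.cong) (auto simp: pmf_Pi'[OF A] PiE_dflt_def scaleR_conv_of_real prod.distrib)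
  also have "\<dots> = (\<Prod>x\<in>A. \<Sum>y\<in>B. pmf (p x) y *\<^sub>R f x y)"
    by (rule prod_sum_PiE_dflt[symmetric]) (use assms in auto)
  also have "\<dots> = (\<Prod>x\<in>A. measure_pmf.expectation (p x) (f x))"
    by (intro prod.cong refl integral_measure_pmf[symmetric]) (use B in auto)
  finally show ?thesis .
qed

lemma sum_powers_root_of_unity:
  fixes c :: complex
  assumes "c ^ m = 1" "c \<noteq> 1"
  shows "(\<Sum>j<m. c ^ j) = 0"
  using assms by (simp add: sum_gp_strict)

text \<open>On the unit circle \<open>1 - Re e\<close> is half the squared distance of
  \<open>e\<close> from \<open>1\<close>. The triangle inequality, squared, loses a factor
  \<open>2\<close>; this is the constant of the quasi-triangle inequality for defects.\<close>

lemma one_minus_Re_mult_le: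
  assumes "cmod c = 1" "cmod d = 1"
  shows "1 - Re (c * d) \<le> 2 * ((1 - Re c) + (1 - Re d))"
proof -
  have half: "1 - Re e = (cmod (1 - e))\<^sup>2 / 2" if "cmod e = 1" for e
  proof -
    have "(Re e)\<^sup>2 + (Im e)\<^sup>2 = 1"
      using that by (simp flip: cmod_power2)
    moreover have "(cmod (1 - e))\<^sup>2 = (1 - Re e)\<^sup>2 + (Im e)\<^sup>2"
      by (simp add: cmod_power2)
    ultimately show ?thesis
      by (simp add: power2_eq_square algebra_simps)
  qed
  have "1 - c * d = (1 - c) + c * (1 - d)"
    by (simp add: algebra_simps)
  then have "cmod (1 - c * d) \<le> cmod (1 - c) + cmod (c * (1 - d))"
    by (simp only: norm_triangle_ineq)
  then have "cmod (1 - c * d) \<le> cmod (1 - c) + cmod (1 - d)"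
    using assms by (simp add: norm_mult)
  then have "(cmod (1 - c * d))\<^sup>2 \<le> (cmod (1 - c) + cmod (1 - d))\<^sup>2"
    by (intro power_mono) auto
  also have "\<dots> \<le> 2 * ((cmod (1 - c))\<^sup>2 + (cmod (1 - d))\<^sup>2)"
    using zero_le_power2[of "cmod (1 - c) - cmod (1 - d)"]
    by (simp add: power2_sum power2_diff algebra_simps)
  finally show ?thesis
    using half[of c] half[of d] half[of "c * d"] assms by (simp add: norm_mult del: times_complex.sel)
qed

definition lazy :: "real \<Rightarrow> 'a pmf \<Rightarrow> 'a \<Rightarrow> 'a pmf" where
  "lazy b \<mu> z = bind_pmf (bernoulli_pmf b) (\<lambda>c. if c then \<mu> else return_pmf z)"

lemma expectation_lazy:
  fixes f :: "'a \<Rightarrow> 'b :: {banach, second_countable_topology}"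
  assumes "0 \<le> b" "b \<le> 1" "finite (set_pmf \<mu>)"
  shows "measure_pmf.expectation (lazy b \<mu> z) f = b *\<^sub>R measure_pmf.expectation \<mu> f + (1 - b) *\<^sub>R f z"
proof -
  have "measure_pmf.expectation (lazy b \<mu> z) f =
     (\<Sum>c\<in>UNIV. pmf (bernoulli_pmf b) c *\<^sub>R measure_pmf.expectation (if c then \<mu> else return_pmf z) f)"
    unfolding lazy_def by (rule pmf_expectation_bind) (use assms in auto)
  also have "\<dots> = b *\<^sub>R measure_pmf.expectation \<mu> f + (1 - b) *\<^sub>R f z"
    using assms by (simp add: UNIV_bool add.commute)
  finally show ?thesis .
qed

text \<open>
  The lazy version of a law \<open>\<mu>\<close> will be \<open>lazy b (sym_diff \<mu>) \<zero>\<close>: its Fourier transform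
  \<open>1 - b * (1 - \<bar>\<mu>^\<bar>\<^sup>2)\<close> is positive and decays much more slowly than that of \<open>\<mu>\<close>.
\<close>

definition (in ring) sym_diff :: "'a pmf \<Rightarrow> 'a pmf" where
  "sym_diff \<mu> = map_pmf (\<lambda>(x, y). x \<ominus> y) (pair_pmf \<mu> \<mu>)"

locale finite_field_character = finite_field_vectors F n for F :: "('a, 'm) ring_scheme" (structure) and n +
  fixes \<psi> :: "'a \<Rightarrow> complex"
  assumes psi_add: "\<And>a b. a \<in> carrier F \<Longrightarrow> b \<in> carrier F \<Longrightarrow> \<psi> (a \<oplus> b) = \<psi> a * \<psi> b"
    and psi_zero [simp]: "\<psi> \<zero> = 1"
    and psi_nontrivial: "\<exists>a\<in>carrier F. \<psi> a \<noteq> 1"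
begin


abbreviation "E \<equiv> measure_pmf.expectation"

section \<open>The defect of a law and its behaviour under multiples\<close>

lemma psi_pow: "a \<in> carrier F \<Longrightarrow> \<psi> (((\<oplus>) a ^^ j) \<zero>) = \<psi> a ^ j \<and> ((\<oplus>) a ^^ j) \<zero> \<in> carrier F"
  by (induction j) (auto simp: psi_add)

lemma iterate_mult:
  "a \<in> carrier F \<Longrightarrow> b \<in> carrier F \<Longrightarrow> ((\<oplus>) a ^^ j) \<zero> \<otimes> b = ((\<oplus>) (a \<otimes> b) ^^ j) \<zero>"
  using psi_pow by (induction j) (auto simp: l_distr)

lemma iterate_eq_add_pow: "a \<in> carrier F \<Longrightarrow> ((\<oplus>) a ^^ j) \<zero> = [j] \<cdot> a"
proof (induction j)
  case (Suc j)
  then have "((\<oplus>) a ^^ Suc j) \<zero> = a \<oplus> [j] \<cdot> a"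
    by simp
  also have "\<dots> = [Suc j] \<cdot> a"
    using Suc.prems by (simp add: a_comm)
  finally show ?case .
qed simp

lemma iterate_q: "a \<in> carrier F \<Longrightarrow> ((\<oplus>) a ^^ q) \<zero> = \<zero>"
  using add.pow_order_eq_1[of a] by (simp add: iterate_eq_add_pow order_def)

lemma psi_pow_q: "a \<in> carrier F \<Longrightarrow> \<psi> a ^ q = 1"
  using psi_pow[of a q] iterate_q[of a] by simp

lemma cmod_psi [simp]: "a \<in> carrier F \<Longrightarrow> cmod (\<psi> a) = 1"
  using power_eq_1_iff[OF psi_pow_q[of a]] q_pos by auto

lemma psi_neg: "a \<in> carrier F \<Longrightarrow> \<psi> (\<ominus> a) = cnj (\<psi> a)"
proof -
  assume a: "a \<in> carrier F"
  then have "\<psi> a * \<psi> (\<ominus> a) = 1"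
    using psi_add[of a "\<ominus> a"] by (simp add: r_neg)
  moreover have "\<psi> a * cnj (\<psi> a) = 1"
    using a by (simp flip: complex_norm_square)
  ultimately show ?thesis
    by (metis mult_cancel_left mult_zero_left zero_neq_one)
qed

definition fourier :: "'a pmf \<Rightarrow> 'a \<Rightarrow> complex" where
  "fourier \<mu> a = E \<mu> (\<lambda>x. \<psi> (a \<otimes> x))"

text \<open>One minus the squared modulus of the Fourier transform. Written as a sum over the values
  of two independent copies, it inherits the quasi-triangle inequality from the character term by
  term.\<close>

definition defect :: "'a pmf \<Rightarrow> 'a \<Rightarrow> real" where
  "defect \<mu> a = (\<Sum>x\<in>carrier F. \<Sum>y\<in>carrier F. pmf \<mu> x * pmf \<mu> y * (1 - Re (\<psi> (a \<otimes> (x \<ominus> y)))))"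

lemma expectation_carrier:
  fixes f :: "'a \<Rightarrow> 'b :: {banach, second_countable_topology}"
  assumes "set_pmf \<mu> \<subseteq> carrier F"
  shows "E \<mu> f = (\<Sum>x\<in>carrier F. pmf \<mu> x *\<^sub>R f x)"
  by (rule integral_measure_pmf) (use assms in auto)

lemma sum_pmf_carrier: "set_pmf \<mu> \<subseteq> carrier F \<Longrightarrow> (\<Sum>x\<in>carrier F. pmf \<mu> x) = 1"
  by (rule sum_pmf_eq_1) auto

lemma defect_eq_fourier:
  assumes "set_pmf \<mu> \<subseteq> carrier F" "a \<in> carrier F"
  shows "defect \<mu> a = 1 - (cmod (fourier \<mu> a))\<^sup>2"
proof -
  have "(cmod (fourier \<mu> a))\<^sup>2 = Re (fourier \<mu> a * cnj (fourier \<mu> a))"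
    by (simp flip: complex_norm_square)
  also have "fourier \<mu> a * cnj (fourier \<mu> a) =
      (\<Sum>x\<in>carrier F. \<Sum>y\<in>carrier F. (pmf \<mu> x * pmf \<mu> y) *\<^sub>R \<psi> (a \<otimes> (x \<ominus> y)))"
    using assms
    by (simp add: fourier_def expectation_carrier sum_product psi_add psi_neg minus_eq r_distr r_minus
        scaleR_conv_of_real mult_ac)
  finally have "(cmod (fourier \<mu> a))\<^sup>2 = (\<Sum>x\<in>carrier F. \<Sum>y\<in>carrier F. pmf \<mu> x * pmf \<mu> y * Re (\<psi> (a \<otimes> (x \<ominus> y))))"
    by simp
  moreover have "(\<Sum>x\<in>carrier F. \<Sum>y\<in>carrier F. pmf \<mu> x * pmf \<mu> y) = 1"
    using sum_pmf_carrier[OF assms(1)] by (simp flip: sum_product)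
  ultimately show ?thesis
    by (simp add: defect_def right_diff_distrib sum_subtractf)
qed

lemma one_minus_Re_psi_nonneg: "a \<in> carrier F \<Longrightarrow> 0 \<le> 1 - Re (\<psi> a)"
  using complex_Re_le_cmod[of "\<psi> a"] by simp

lemma defect_nonneg: "a \<in> carrier F \<Longrightarrow> defect \<mu> a \<ge> 0"
  unfolding defect_def by (intro sum_nonneg mult_nonneg_nonneg one_minus_Re_psi_nonneg) auto

lemma defect_le_1: "set_pmf \<mu> \<subseteq> carrier F \<Longrightarrow> a \<in> carrier F \<Longrightarrow> defect \<mu> a \<le> 1"
  by (simp add: defect_eq_fourier)

lemma defect_zero [simp]: "defect \<mu> \<zero> = 0"
  by (simp add: defect_def)

lemma defect_add:
  assumes "a \<in> carrier F" "b \<in> carrier F"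
  shows "defect \<mu> (a \<oplus> b) \<le> 2 * (defect \<mu> a + defect \<mu> b)"
proof -
  have "defect \<mu> (a \<oplus> b) \<le> (\<Sum>x\<in>carrier F. \<Sum>y\<in>carrier F. pmf \<mu> x * pmf \<mu> y *
      (2 * ((1 - Re (\<psi> (a \<otimes> (x \<ominus> y)))) + (1 - Re (\<psi> (b \<otimes> (x \<ominus> y)))))))"
    unfolding defect_def
  proof (intro sum_mono mult_left_mono)
    fix x y assume "x \<in> carrier F" "y \<in> carrier F"
    then show "1 - Re (\<psi> ((a \<oplus> b) \<otimes> (x \<ominus> y))) \<le>
        2 * ((1 - Re (\<psi> (a \<otimes> (x \<ominus> y)))) + (1 - Re (\<psi> (b \<otimes> (x \<ominus> y)))))"
      using assms one_minus_Re_mult_le[of "\<psi> (a \<otimes> (x \<ominus> y))" "\<psi> (b \<otimes> (x \<ominus> y))"]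
      by (simp add: l_distr psi_add del: times_complex.sel)
  qed auto
  also have "\<dots> = 2 * (defect \<mu> a + defect \<mu> b)"
    by (simp add: defect_def sum_distrib_left algebra_simps flip: sum.distrib)
  finally show ?thesis .
qed

lemma defect_neg: "a \<in> carrier F \<Longrightarrow> defect \<mu> (\<ominus> a) = defect \<mu> a"
  by (simp add: defect_def l_minus psi_neg)

lemma defect_diff:
  assumes "a \<in> carrier F" "b \<in> carrier F"
  shows "defect \<mu> a \<le> 2 * (defect \<mu> (a \<oplus> b) + defect \<mu> b)"
  using defect_add[of "a \<oplus> b" "\<ominus> b" \<mu>] assms by (simp add: defect_neg a_assoc r_neg)

definition balanced_on :: "real \<Rightarrow> 'a pmf \<Rightarrow> bool" where
  "balanced_on \<alpha> \<mu> \<longleftrightarrow> set_pmf \<mu> \<subseteq> carrier F \<and>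
     (\<forall>x\<in>carrier F. \<forall>H. additive_subgroup H F \<and> H \<subset> carrier F \<longrightarrow> measure_pmf.prob \<mu> (x <+ H) \<le> 1 - \<alpha>)"

lemma sum_one_minus_Re_psi_iterate:
  assumes "a \<in> carrier F"
  shows "(\<Sum>j<q. 1 - Re (\<psi> (((\<oplus>) a ^^ j) \<zero>))) = real q * of_bool (\<psi> a \<noteq> 1)"
proof -
  have "(\<Sum>j<q. 1 - Re (\<psi> (((\<oplus>) a ^^ j) \<zero>))) = real q - Re (\<Sum>j<q. \<psi> a ^ j)"
    using assms by (simp add: psi_pow sum_subtractf)
  then show ?thesis
    using sum_powers_root_of_unity[OF psi_pow_q[OF assms]] by (cases "\<psi> a = 1") auto
qed

text \<open>For a field element \<open>b\<close>, average \<open>1 - Re (\<psi> b')\<close> over the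
  multiples \<open>b'\<close> of \<open>b\<close>. The result is \<open>1\<close> if
  \<open>\<psi> b \<noteq> 1\<close> and \<open>0\<close> otherwise, because \<open>\<psi> b\<close>
  is a root of unity of order dividing \<open>q\<close>. The average defect over the multiples of
  \<open>a\<close> is therefore the probability that two independent copies differ by an element
  outside the kernel of the character attached to \<open>a\<close>, and that kernel is a proper
  subgroup.\<close>

lemma sum_defect_iterate_ge:
  assumes "balanced_on \<alpha> \<mu>" "a \<in> carrier F" "a \<noteq> \<zero>"
  shows "real q * \<alpha> \<le> (\<Sum>j<q. defect \<mu> (((\<oplus>) a ^^ j) \<zero>))"
proof -
  have supp: "set_pmf \<mu> \<subseteq> carrier F"
    using assms by (simp add: balanced_on_def)
  \<comment> \<open>The kernel in question. A point where \<open>\<psi>\<close> is nontrivial,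
    divided by \<open>a\<close>, lies outside it.\<close>
  define H where "H = {c \<in> carrier F. \<psi> (a \<otimes> c) = 1}"
  have "additive_subgroup H F"
    by unfold_locales (auto simp: H_def r_distr psi_add r_minus psi_neg assms simp flip: a_inv_def)
  moreover have "H \<subset> carrier F"
  proof -
    obtain c where "c \<in> carrier F" "\<psi> c \<noteq> 1"
      using psi_nontrivial by blast
    then have "inv a \<otimes> c \<in> carrier F - H"
      using assms field_Units by (auto simp: H_def simp flip: m_assoc)
    then show ?thesis
      by (auto simp: H_def)
  qed
  ultimately have bal: "measure_pmf.prob \<mu> (y <+ H) \<le> 1 - \<alpha>" if "y \<in> carrier F" for y
    using assms that by (auto simp: balanced_on_def)
  \<comment> \<open>For a fixed value \<open>y\<close> of the second copy,
    \<open>x \<ominus> y \<in> H\<close> confines the first copy to the single coset of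
    \<open>y\<close>.\<close>
  have inner: "(\<Sum>x\<in>carrier F. pmf \<mu> x * of_bool (\<psi> (a \<otimes> (x \<ominus> y)) \<noteq> 1)) \<ge> \<alpha>" if y: "y \<in> carrier F" for y
  proof -
    have "(\<Sum>x\<in>carrier F. pmf \<mu> x * of_bool (\<psi> (a \<otimes> (x \<ominus> y)) \<noteq> 1)) =
        1 - (\<Sum>x\<in>carrier F. pmf \<mu> x * of_bool (\<psi> (a \<otimes> (x \<ominus> y)) = 1))"
      unfolding sum_pmf_carrier[OF supp, symmetric] sum_subtractf[symmetric]
      by (intro sum.cong) auto
    also have "(\<Sum>x\<in>carrier F. pmf \<mu> x * of_bool (\<psi> (a \<otimes> (x \<ominus> y)) = 1)) =
        (\<Sum>x\<in>{x\<in>carrier F. \<psi> (a \<otimes> (x \<ominus> y)) = 1}. pmf \<mu> x)"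
      by (rule sum.mono_neutral_cong_right) auto
    also have "\<dots> = measure_pmf.prob \<mu> {x\<in>carrier F. \<psi> (a \<otimes> (x \<ominus> y)) = 1}"
      by (simp add: measure_measure_pmf_finite)
    finally have eq: "(\<Sum>x\<in>carrier F. pmf \<mu> x * of_bool (\<psi> (a \<otimes> (x \<ominus> y)) \<noteq> 1)) =
        1 - measure_pmf.prob \<mu> {x\<in>carrier F. \<psi> (a \<otimes> (x \<ominus> y)) = 1}" .
    have "{x\<in>carrier F. \<psi> (a \<otimes> (x \<ominus> y)) = 1} \<subseteq> y <+ H"
    proof
      fix x assume "x \<in> {x\<in>carrier F. \<psi> (a \<otimes> (x \<ominus> y)) = 1}"
      then have "x \<ominus> y \<in> H" "x = y \<oplus> (x \<ominus> y)"
        using y by (auto simp: H_def minus_eq a_ac r_neg1 r_neg2 r_neg)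
      then show "x \<in> y <+ H"
        by (auto simp: a_l_coset_def')
    qed
    then have "measure_pmf.prob \<mu> {x\<in>carrier F. \<psi> (a \<otimes> (x \<ominus> y)) = 1} \<le> measure_pmf.prob \<mu> (y <+ H)"
      by (intro measure_pmf.finite_measure_mono) auto
    then show ?thesis
      using bal[OF y] eq by simp
  qed
  have "(\<Sum>j<q. defect \<mu> (((\<oplus>) a ^^ j) \<zero>)) = (\<Sum>x\<in>carrier F. \<Sum>y\<in>carrier F. pmf \<mu> x * pmf \<mu> y *
      (\<Sum>j<q. 1 - Re (\<psi> (((\<oplus>) (a \<otimes> (x \<ominus> y)) ^^ j) \<zero>))))"
  proof -
    let ?T = "\<lambda>j x y. pmf \<mu> x * pmf \<mu> y * (1 - Re (\<psi> (((\<oplus>) (a \<otimes> (x \<ominus> y)) ^^ j) \<zero>)))"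
    have "(\<Sum>j<q. defect \<mu> (((\<oplus>) a ^^ j) \<zero>)) = (\<Sum>j<q. \<Sum>x\<in>carrier F. \<Sum>y\<in>carrier F. ?T j x y)"
      using assms(2) unfolding defect_def by (intro sum.cong) (auto simp: iterate_mult)
    also have "\<dots> = (\<Sum>x\<in>carrier F. \<Sum>j<q. \<Sum>y\<in>carrier F. ?T j x y)"
      by (rule sum.swap)
    also have "\<dots> = (\<Sum>x\<in>carrier F. \<Sum>y\<in>carrier F. \<Sum>j<q. ?T j x y)"
      by (intro sum.cong refl sum.swap)
    finally show ?thesis
      by (simp add: sum_distrib_left)
  qed
  also have "\<dots> = real q * (\<Sum>x\<in>carrier F. \<Sum>y\<in>carrier F. pmf \<mu> y * (pmf \<mu> x * of_bool (\<psi> (a \<otimes> (x \<ominus> y)) \<noteq> 1)))"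
    using assms(2) by (simp add: sum_one_minus_Re_psi_iterate sum_distrib_left mult_ac)
  also have "(\<Sum>x\<in>carrier F. \<Sum>y\<in>carrier F. pmf \<mu> y * (pmf \<mu> x * of_bool (\<psi> (a \<otimes> (x \<ominus> y)) \<noteq> 1))) =
      (\<Sum>y\<in>carrier F. pmf \<mu> y * (\<Sum>x\<in>carrier F. pmf \<mu> x * of_bool (\<psi> (a \<otimes> (x \<ominus> y)) \<noteq> 1)))"
    by (subst sum.swap) (simp only: sum_distrib_left)
  also have "real q * \<dots> \<ge> real q * (\<Sum>y\<in>carrier F. pmf \<mu> y * \<alpha>)"
    by (intro mult_left_mono sum_mono inner) auto
  finally show ?thesis
    using sum_pmf_carrier[OF supp] by (simp flip: sum_distrib_right)
qed

end

section \<open>Orthogonality probabilities as character sums\<close>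

context finite_field_character begin

definition supp :: "(nat \<Rightarrow> 'a) \<Rightarrow> nat set" where
  "supp w = {j. j < n \<and> w j \<noteq> \<zero>}"
definition vec_defect :: "(nat \<Rightarrow> 'a pmf) \<Rightarrow> (nat \<Rightarrow> 'a) \<Rightarrow> real" where
  "vec_defect \<mu> w = (\<Sum>j<n. defect (\<mu> j) (w j))"
definition perp :: "(nat \<Rightarrow> 'a) pmf \<Rightarrow> (nat \<Rightarrow> 'a) set \<Rightarrow> real" where
  "perp \<xi> W = measure_pmf.prob \<xi> {x. \<forall>w\<in>W. dot w x = \<zero>}"
definition row :: "(nat \<Rightarrow> 'a pmf) \<Rightarrow> (nat \<Rightarrow> 'a) pmf" where
  "row \<mu> = Pi_pmf {..<n} \<zero> \<mu>"
definition lazy_row :: "real \<Rightarrow> (nat \<Rightarrow> 'a pmf) \<Rightarrow> (nat \<Rightarrow> 'a) pmf" where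
  "lazy_row b \<mu> = row (\<lambda>j. lazy b (sym_diff (\<mu> j)) \<zero>)"

lemma set_row:
  assumes "\<And>j. j < n \<Longrightarrow> set_pmf (\<mu> j) \<subseteq> carrier F"
  shows "set_pmf (row \<mu>) \<subseteq> vecs"
proof
  fix x assume "x \<in> set_pmf (row \<mu>)"
  then have x: "x \<in> PiE_dflt {..<n} \<zero> (set_pmf \<circ> \<mu>)"
    by (simp add: row_def set_Pi_pmf)
  have "x j \<in> carrier F" if "j < n" for j
    using x that subsetD[OF assms[OF that], of "x j"] by (simp add: PiE_dflt_def)
  moreover have "x j = \<zero>" if "j \<ge> n" for j
    using x that by (simp add: PiE_dflt_def)
  ultimately show "x \<in> vecs"
    by (simp add: vecs_iff)
qed

lemma perp_nonneg [simp]: "perp \<xi> W \<ge> 0" and perp_le_1 [simp]: "perp \<xi> W \<le> 1"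
  by (simp_all add: perp_def)

lemma supp_eq_empty_iff: "w \<in> vecs \<Longrightarrow> supp w = {} \<longleftrightarrow> w = zvec"
proof -
  assume w: "w \<in> vecs"
  then have "w j = \<zero>" if "j \<notin> supp w" for j
    using that by (cases "j < n") (auto simp: supp_def vecs_iff)
  then show ?thesis
    by (auto simp: zvec_def fun_eq_iff) (simp add: supp_def)
qed

lemma psi_finsum:
  assumes "finite A" "\<And>j. j \<in> A \<Longrightarrow> f j \<in> carrier F"
  shows "\<psi> (\<Oplus>j\<in>A. f j) = (\<Prod>j\<in>A. \<psi> (f j))"
  using assms by (induction A rule: finite_induct) (auto simp: psi_add Pi_def)

lemma psi_dot: "w \<in> vecs \<Longrightarrow> x \<in> vecs \<Longrightarrow> \<psi> (dot w x) = (\<Prod>j<n. \<psi> (w j \<otimes> x j))"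
  unfolding dot_def by (rule psi_finsum) auto

text \<open>If some \<open>w0 \<in> W\<close> has a nonzero product with \<open>x\<close>, a
  multiple \<open>w1\<close> of it has a product \<open>c\<close> with
  \<open>\<psi> c \<noteq> 1\<close>. Translating \<open>W\<close> by \<open>w1\<close> multiplies
  the sum by \<open>\<psi> c\<close>, so it vanishes.\<close>

lemma sum_psi_dot:
  assumes W: "subsp W" and x: "x \<in> vecs"
  shows "(\<Sum>w\<in>W. \<psi> (dot w x)) = of_nat (card W) * of_bool (\<forall>w\<in>W. dot w x = \<zero>)"
proof (cases "\<forall>w\<in>W. dot w x = \<zero>")
  case False
  then obtain w0 where w0: "w0 \<in> W" "dot w0 x \<noteq> \<zero>"
    by blast
  have v: "w \<in> vecs" if "w \<in> W" for w
    using that subspD(1)[OF W] by auto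
  obtain c where c: "c \<in> carrier F" "\<psi> c \<noteq> 1"
    using psi_nontrivial by blast
  have unit: "dot w0 x \<in> Units F"
    using w0 x v field_Units by auto
  define w1 where "w1 = smul (c \<otimes> inv (dot w0 x)) w0"
  have w1: "w1 \<in> W" "dot w1 x = c"
    using w0 c x v unit subspD(4)[OF W] by (auto simp: w1_def dot_smul m_assoc)
  have "bij_betw (vadd w1) W W"
    unfolding bij_betw_def
  proof
    show "inj_on (vadd w1) W"
      using inj_vadd[OF v[OF w1(1)]] subspD(1)[OF W] inj_on_subset by blast
    then show "vadd w1 ` W = W"
      using subspD[OF W] w1 by (intro endo_inj_surj) auto
  qed
  then have "(\<Sum>w\<in>W. \<psi> (dot w x)) = (\<Sum>w\<in>W. \<psi> (dot (vadd w1 w) x))"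
    by (rule sum.reindex_bij_betw[symmetric])
  also have "\<dots> = \<psi> c * (\<Sum>w\<in>W. \<psi> (dot w x))"
    using w1 x c v by (simp add: dot_vadd psi_add sum_distrib_left)
  finally have "(\<Sum>w\<in>W. \<psi> (dot w x)) = 0"
    using c(2) by auto
  then show ?thesis
    using False by auto
qed simp

text \<open>Averaging \<open>\<psi> (dot w x)\<close> over \<open>w \<in> W\<close> yields the
  indicator of \<open>x\<close> being orthogonal to \<open>W\<close>; taking expectations brings in
  the Fourier transform of the law.\<close>

lemma perp_eq_sum:
  assumes W: "subsp W" and \<xi>: "set_pmf \<xi> \<subseteq> vecs"
  shows "complex_of_real (perp \<xi> W) * of_nat (card W) = (\<Sum>w\<in>W. E \<xi> (\<lambda>x. \<psi> (dot w x)))"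
proof -
  have fin: "finite (set_pmf \<xi>)"
    by (rule finite_subset[OF \<xi> finite_vecs])
  have "(\<Sum>w\<in>W. E \<xi> (\<lambda>x. \<psi> (dot w x))) = E \<xi> (\<lambda>x. \<Sum>w\<in>W. \<psi> (dot w x))"
    by (rule Bochner_Integration.integral_sum[symmetric]) (use fin in \<open>auto intro: integrable_measure_pmf_finite\<close>)
  also have "\<dots> = E \<xi> (\<lambda>x. complex_of_real (real (card W) * indicator {x. \<forall>w\<in>W. dot w x = \<zero>} x))"
    using \<xi> sum_psi_dot[OF W]
    by (intro Bochner_Integration.integral_cong_AE) (auto simp: AE_measure_pmf_iff indicator_def subset_iff)
  also have "\<dots> = of_real (real (card W) * perp \<xi> W)"
    unfolding perp_def by (subst integral_complex_of_real) (simp)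
  finally show ?thesis
    by (simp add: mult.commute)
qed

lemma expectation_psi_dot:
  assumes "\<And>j. j < n \<Longrightarrow> set_pmf (\<mu> j) \<subseteq> carrier F" "w \<in> vecs"
  shows "E (row \<mu>) (\<lambda>x. \<psi> (dot w x)) = (\<Prod>j<n. fourier (\<mu> j) (w j))"
proof -
  have "E (row \<mu>) (\<lambda>x. \<psi> (dot w x)) = E (row \<mu>) (\<lambda>x. \<Prod>j<n. \<psi> (w j \<otimes> x j))"
    using set_row[OF assms(1)] assms(2)
    by (intro Bochner_Integration.integral_cong_AE) (auto simp: AE_measure_pmf_iff psi_dot subset_iff)
  also have "\<dots> = (\<Prod>j<n. fourier (\<mu> j) (w j))"
    unfolding row_def fourier_def
    by (rule expectation_Pi_pmf_prod[where B = "carrier F"]) (use assms in auto)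
  finally show ?thesis .
qed

lemma fourier_zero: "set_pmf \<mu> \<subseteq> carrier F \<Longrightarrow> fourier \<mu> \<zero> = 1"
proof -
  assume "set_pmf \<mu> \<subseteq> carrier F"
  then have "fourier \<mu> \<zero> = E \<mu> (\<lambda>_. 1)"
    unfolding fourier_def by (intro Bochner_Integration.integral_cong_AE) (auto simp: AE_measure_pmf_iff subset_iff)
  then show ?thesis
    by simp
qed

lemma cmod_fourier_le:
  assumes "set_pmf \<mu> \<subseteq> carrier F" "a \<in> carrier F"
  shows "cmod (fourier \<mu> a) \<le> exp (- defect \<mu> a / 2)"
proof (rule power2_le_imp_le)
  have "(cmod (fourier \<mu> a))\<^sup>2 = 1 + (- defect \<mu> a)"
    using defect_eq_fourier[OF assms] by simp
  also have "\<dots> \<le> exp (- defect \<mu> a)"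
    by (rule exp_ge_add_one_self)
  also have "\<dots> = (exp (- defect \<mu> a / 2))\<^sup>2"
    by (simp flip: exp_double)
  finally show "(cmod (fourier \<mu> a))\<^sup>2 \<le> (exp (- defect \<mu> a / 2))\<^sup>2" .
qed simp

lemma cmod_prod_fourier_le:
  assumes "\<And>j. j < n \<Longrightarrow> set_pmf (\<mu> j) \<subseteq> carrier F" "w \<in> vecs"
  shows "cmod (\<Prod>j<n. fourier (\<mu> j) (w j)) \<le> exp (- vec_defect \<mu> w / 2)"
proof -
  have "cmod (\<Prod>j<n. fourier (\<mu> j) (w j)) \<le> (\<Prod>j<n. exp (- defect (\<mu> j) (w j) / 2))"
    unfolding prod_norm[symmetric]
    by (intro prod_mono conjI norm_ge_zero cmod_fourier_le) (use assms in auto)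
  also have "\<dots> = exp (- vec_defect \<mu> w / 2)"
    by (simp add: vec_defect_def exp_sum sum_negf sum_divide_distrib flip: exp_sum)
  finally show ?thesis .
qed

lemma fourier_sym_diff:
  assumes "set_pmf \<mu> \<subseteq> carrier F" "a \<in> carrier F"
  shows "fourier (sym_diff \<mu>) a = of_real (1 - defect \<mu> a)"
proof -
  have "fourier (sym_diff \<mu>) a = E (pair_pmf \<mu> \<mu>) (\<lambda>z. \<psi> (a \<otimes> (fst z \<ominus> snd z)))"
    by (simp add: fourier_def sym_diff_def case_prod_unfold)
  also have "\<dots> = (\<Sum>z\<in>carrier F \<times> carrier F. pmf (pair_pmf \<mu> \<mu>) z *\<^sub>R \<psi> (a \<otimes> (fst z \<ominus> snd z)))"
    by (rule integral_measure_pmf) (use assms in auto)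
  also have "\<dots> = (\<Sum>x\<in>carrier F. \<Sum>y\<in>carrier F. (pmf \<mu> x * pmf \<mu> y) *\<^sub>R \<psi> (a \<otimes> (x \<ominus> y)))"
    by (simp add: sum.cartesian_product case_prod_unfold pmf_pair flip: pmf_pair)
  also have "\<dots> = fourier \<mu> a * cnj (fourier \<mu> a)"
    using assms
    by (simp add: fourier_def expectation_carrier sum_product psi_add psi_neg minus_eq r_distr r_minus
        scaleR_conv_of_real mult_ac)
  also have "\<dots> = of_real ((cmod (fourier \<mu> a))\<^sup>2)"
    by (simp only: complex_norm_square)
  finally show ?thesis
    using defect_eq_fourier[OF assms] by simp
qed

lemma set_sym_diff: "set_pmf \<mu> \<subseteq> carrier F \<Longrightarrow> set_pmf (sym_diff \<mu>) \<subseteq> carrier F"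
  by (auto simp: sym_diff_def)

lemma set_lazy: "set_pmf \<mu> \<subseteq> carrier F \<Longrightarrow> set_pmf (lazy b (sym_diff \<mu>) \<zero>) \<subseteq> carrier F"
  using set_sym_diff[of \<mu>] by (auto simp: lazy_def split: if_splits)

lemma set_lazy_row: "(\<And>j. j < n \<Longrightarrow> set_pmf (\<mu> j) \<subseteq> carrier F) \<Longrightarrow> set_pmf (lazy_row b \<mu>) \<subseteq> vecs"
  unfolding lazy_row_def by (intro set_row set_lazy)

lemma fourier_lazy:
  assumes "set_pmf \<mu> \<subseteq> carrier F" "a \<in> carrier F" "0 \<le> b" "b \<le> 1"
  shows "fourier (lazy b (sym_diff \<mu>) \<zero>) a = of_real (1 - b * defect \<mu> a)"
proof -
  have "finite (set_pmf (sym_diff \<mu>))"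
    by (rule finite_subset[OF set_sym_diff[OF assms(1)] finite_carrier])
  then have "fourier (lazy b (sym_diff \<mu>) \<zero>) a = b *\<^sub>R fourier (sym_diff \<mu>) a + (1 - b) *\<^sub>R \<psi> (a \<otimes> \<zero>)"
    unfolding fourier_def using assms by (intro expectation_lazy) auto
  then show ?thesis
    using assms by (simp add: fourier_sym_diff scaleR_conv_of_real algebra_simps)
qed

lemma iterate_vadd: "((vadd w ^^ j) zvec) i = ((\<oplus>) (w i) ^^ j) \<zero>"
  by (induction j) (auto simp: vadd_def zvec_def)

lemma vec_defect_zvec [simp]: "vec_defect \<mu> zvec = 0"
  by (simp add: vec_defect_def zvec_def)

lemma vec_defect_add: "v \<in> vecs \<Longrightarrow> w \<in> vecs \<Longrightarrow> vec_defect \<mu> (vadd v w) \<le> 2 * (vec_defect \<mu> v + vec_defect \<mu> w)"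
  using sum_mono[of "{..<n}" "\<lambda>j. defect (\<mu> j) (v j \<oplus> w j)" "\<lambda>j. 2 * (defect (\<mu> j) (v j) + defect (\<mu> j) (w j))"] defect_add
  by (simp add: vec_defect_def vadd_def sum.distrib flip: sum_distrib_left)

lemma vec_defect_diff: "v \<in> vecs \<Longrightarrow> w \<in> vecs \<Longrightarrow> vec_defect \<mu> v \<le> 2 * (vec_defect \<mu> (vadd v w) + vec_defect \<mu> w)"
  using sum_mono[of "{..<n}" "\<lambda>j. defect (\<mu> j) (v j)" "\<lambda>j. 2 * (defect (\<mu> j) (v j \<oplus> w j) + defect (\<mu> j) (w j))"] defect_diff
  by (simp add: vec_defect_def vadd_def sum.distrib flip: sum_distrib_left)

text \<open>In each coordinate of the support the defect averages to at least \<alpha> over the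
  multiples. Summing over the coordinates before choosing a multiple yields one that serves all of
  them together; this is the escape condition for vectors.\<close>

lemma vec_defect_iterate_ge:
  assumes bal: "\<And>j. j < n \<Longrightarrow> balanced_on \<alpha> (\<mu> j)" and w: "w \<in> vecs"
  shows "\<exists>j<q. vec_defect \<mu> ((vadd w ^^ j) zvec) \<ge> \<alpha> * real (card (supp w))"
proof (rule ccontr)
  assume "\<not> ?thesis"
  then have "(\<Sum>j<q. vec_defect \<mu> ((vadd w ^^ j) zvec)) < (\<Sum>j<q. \<alpha> * real (card (supp w)))"
    by (intro sum_strict_mono) (auto simp: not_le lessThan_empty_iff)
  also have "\<dots> = (\<Sum>i\<in>supp w. real q * \<alpha>)"
    by simp
  also have "\<dots> \<le> (\<Sum>i\<in>supp w. \<Sum>j<q. defect (\<mu> i) (((\<oplus>) (w i) ^^ j) \<zero>))"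
    by (intro sum_mono sum_defect_iterate_ge bal) (use w in \<open>auto simp: supp_def\<close>)
  also have "\<dots> \<le> (\<Sum>i<n. \<Sum>j<q. defect (\<mu> i) (((\<oplus>) (w i) ^^ j) \<zero>))"
    by (intro sum_mono2 sum_nonneg defect_nonneg) (use psi_pow w in \<open>auto simp: supp_def\<close>)
  also have "\<dots> = (\<Sum>j<q. vec_defect \<mu> ((vadd w ^^ j) zvec))"
    unfolding vec_defect_def by (subst sum.swap) (simp add: iterate_vadd)
  finally show False
    by simp
qed

text \<open>Converts the exponentials left by the growth argument into Fourier transforms of lazy
  entries, which have the form \<open>1 - b * defect\<close>.\<close>

lemma exp_minus_double_le:
  fixes y :: real
  assumes "0 \<le> y" "y \<le> 1/2"
  shows "exp (- (2 * y)) \<le> 1 - y"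
proof -
  have "2 * y\<^sup>2 \<le> y"
    using mult_left_mono[OF assms(2,1)] by (simp add: power2_eq_square)
  then have "- (2 * y) \<le> ln (1 - y)"
    using ln_one_minus_pos_lower_bound[OF assms] by linarith
  then show ?thesis
    using assms by (simp add: ln_ge_iff)
qed

text \<open>In the character expansion the zero vector contributes exactly \<open>1\<close>, hence
  the main term \<open>1 / card W\<close>; all other terms are bounded through their
  defects.\<close>

lemma perp_row_close_sum:
  assumes W: "subsp W" and set: "\<And>j. j < n \<Longrightarrow> set_pmf (\<mu> j) \<subseteq> carrier F"
  shows "\<bar>perp (row \<mu>) W - 1 / card W\<bar> \<le> (\<Sum>w\<in>W - {zvec}. exp (- vec_defect \<mu> w / 2)) / card W"
proof -
  have v: "w \<in> vecs" if "w \<in> W" for w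
    using that subspD(1)[OF W] by auto
  have c: "real (card W) > 0" "finite W" "zvec \<in> W"
    using subspD[OF W] by auto
  let ?f = "\<lambda>w. \<Prod>j<n. fourier (\<mu> j) (w j)"
  have f0: "?f zvec = 1"
    using set by (simp add: fourier_zero zvec_def)
  have "complex_of_real (perp (row \<mu>) W) * of_nat (card W) = (\<Sum>w\<in>W. ?f w)"
    using perp_eq_sum[OF W set_row[of \<mu>, OF set]] v by (simp add: expectation_psi_dot[of \<mu>, OF set])
  also have "\<dots> = 1 + (\<Sum>w\<in>W - {zvec}. ?f w)"
    using c f0 by (subst sum.remove) auto
  finally have "complex_of_real (perp (row \<mu>) W * card W - 1) = (\<Sum>w\<in>W - {zvec}. ?f w)"
    by simp
  then have "\<bar>perp (row \<mu>) W * card W - 1\<bar> = cmod (\<Sum>w\<in>W - {zvec}. ?f w)"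
    by (metis norm_of_real)
  also have "\<dots> \<le> (\<Sum>w\<in>W - {zvec}. exp (- vec_defect \<mu> w / 2))"
    by (rule order_trans[OF norm_sum], intro sum_mono cmod_prod_fourier_le[of \<mu>, OF set] v) auto
  finally have "\<bar>perp (row \<mu>) W * card W - 1\<bar> / card W \<le> (\<Sum>w\<in>W - {zvec}. exp (- vec_defect \<mu> w / 2)) / card W"
    by (rule divide_right_mono) simp
  moreover have "\<bar>perp (row \<mu>) W * card W - 1\<bar> / card W = \<bar>perp (row \<mu>) W - 1 / card W\<bar>"
  proof -
    have "perp (row \<mu>) W - 1 / card W = (perp (row \<mu>) W * card W - 1) / card W"
      using c(1) by (simp add: field_simps)
    then show ?thesis
      using c(1) by simp
  qed
  ultimately show ?thesis
    by simp
qed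

text \<open>
  With \<open>u = vec_defect \<mu>\<close>, the Fourier transform is at most \<open>exp (- u / 2)\<close> for the row and at least
  \<open>exp (- u / (2 * 22 ^ k))\<close> for its lazy version. Since the sublevel sets of \<open>u\<close> in \<open>W\<close> grow,
  the sum of the former is at most \<open>2 ^ (- k)\<close> times the sum of the latter, up to the tail.
\<close>

lemma perp_row_close:
  assumes W: "subsp W" and bal: "\<And>j. j < n \<Longrightarrow> balanced_on \<alpha> (\<mu> j)" and \<alpha>: "\<alpha> > 0" and s: "s > 0"
    and supp: "\<And>w. w \<in> W \<Longrightarrow> w \<noteq> zvec \<Longrightarrow> real (card (supp w)) \<ge> s"
  shows "\<bar>perp (row \<mu>) W - 1 / card W\<bar> \<le>
    (1/2) ^ k * perp (lazy_row (1 / (4 * 22 ^ k)) \<mu>) W + exp (- (\<alpha> * s) / (2 * 22 ^ k))"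
proof -
  \<comment> \<open>Chosen so that \<open>2 * ?b\<close> is \<open>1 / (2 * 22 ^ k)\<close>, the
    rescaling of the exponent produced by \<open>k\<close> doublings.\<close>
  let ?b = "1 / (4 * 22 ^ k) :: real"
  have b: "0 \<le> ?b" "?b \<le> 1/2"
  proof -
    have "(1::real) \<le> 22 ^ k"
      by simp
    then have "(2::real) \<le> 4 * 22 ^ k"
      by linarith
    then show "?b \<le> 1/2"
      by (intro frac_le) auto
  qed simp
  have set: "set_pmf (\<mu> j) \<subseteq> carrier F" if "j < n" for j
    using bal that by (auto simp: balanced_on_def)
  have v: "w \<in> vecs" if "w \<in> W" for w
    using that subspD(1)[OF W] by auto
  have c: "real (card W) > 0" "finite W" "zvec \<in> W"
    using subspD[OF W] by auto
  interpret Q: quasinormed_group W vadd zvec "vec_defect \<mu>" "\<alpha> * s"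
  proof
    show "inj_on (vadd a) W" if "a \<in> W" for a
      using inj_vadd[OF v[OF that]] subspD(1)[OF W] inj_on_subset by blast
    show "\<exists>j. \<alpha> * s \<le> vec_defect \<mu> ((vadd t ^^ j) zvec)" if t: "t \<in> W" "t \<noteq> zvec" for t
    proof -
      obtain j where "vec_defect \<mu> ((vadd t ^^ j) zvec) \<ge> \<alpha> * real (card (supp t))"
        using vec_defect_iterate_ge[where \<alpha> = \<alpha> and \<mu> = \<mu>, OF bal v[OF t(1)]] by blast
      moreover have "\<alpha> * s \<le> \<alpha> * real (card (supp t))"
        using supp[OF t] \<alpha> by simp
      ultimately show ?thesis
        by (auto intro: order_trans)
    qed
    show "\<alpha> * s > 0"
      using \<alpha> s by simp
    show "vec_defect \<mu> (vadd a b) \<le> 2 * (vec_defect \<mu> a + vec_defect \<mu> b)" if "a \<in> W" "b \<in> W" for a b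
      by (rule vec_defect_add[OF v[OF that(1)] v[OF that(2)]])
    show "vec_defect \<mu> a \<le> 2 * (vec_defect \<mu> (vadd a b) + vec_defect \<mu> b)" if "a \<in> W" "b \<in> W" for a b
      by (rule vec_defect_diff[OF v[OF that(1)] v[OF that(2)]])
  qed (simp_all add: subspD[OF W])
  let ?S = "\<Sum>w\<in>W - {zvec}. exp (- vec_defect \<mu> w / (2 * 22 ^ k))"
  have "(\<Sum>w\<in>W - {zvec}. exp (- vec_defect \<mu> w / 2)) \<le> (1/2) ^ k * ?S + card W * exp (- (\<alpha> * s) / (2 * 22 ^ k))"
    by (rule Q.sum_exp_quasinorm_le)
  also have "?S \<le> perp (lazy_row ?b \<mu>) W * card W"
  proof -
    let ?g = "\<lambda>w. \<Prod>j<n. 1 - ?b * defect (\<mu> j) (w j)"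
    \<comment> \<open>With \<open>zvec\<close> included the sum runs over the whole subspace, where
      the character expansion of the lazy row applies.\<close>
    have "?S \<le> (\<Sum>w\<in>W. exp (- vec_defect \<mu> w / (2 * 22 ^ k)))"
      using c by (intro sum_mono2) auto
    also have "\<dots> \<le> (\<Sum>w\<in>W. ?g w)"
    proof (rule sum_mono)
      fix w assume w: "w \<in> W"
      have "exp (- vec_defect \<mu> w / (2 * 22 ^ k)) = (\<Prod>j<n. exp (- (2 * ?b * defect (\<mu> j) (w j))))"
      proof -
        have "- vec_defect \<mu> w / (2 * 22 ^ k) = (\<Sum>j<n. - (2 * ?b * defect (\<mu> j) (w j)))"
          by (simp add: vec_defect_def sum_negf sum_divide_distrib)
        then show ?thesis
          by (simp only: exp_sum[OF finite_lessThan])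
      qed
      also have "\<dots> \<le> ?g w"
      proof (rule prod_mono, safe)
        fix j assume j: "j < n"
        let ?y = "?b * defect (\<mu> j) (w j)"
        have "0 \<le> ?y" "?y \<le> 1/2"
          using mult_mono[OF b(2) defect_le_1[OF set[OF j] vecs_nth[OF v[OF w]]] _ defect_nonneg[OF vecs_nth[OF v[OF w]]]]
            mult_nonneg_nonneg[OF b(1) defect_nonneg[OF vecs_nth[OF v[OF w]]]]
          by simp_all
        then have "exp (- (2 * ?y)) \<le> 1 - ?y"
          by (rule exp_minus_double_le)
        then show "exp (- (2 * ?b * defect (\<mu> j) (w j))) \<le> 1 - ?b * defect (\<mu> j) (w j)"
          by (simp add: mult.assoc)
      qed simp
      finally show "exp (- vec_defect \<mu> w / (2 * 22 ^ k)) \<le> ?g w" .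
    qed
    also have "(\<Sum>w\<in>W. ?g w) = perp (lazy_row ?b \<mu>) W * card W"
    proof -
      have "complex_of_real (perp (lazy_row ?b \<mu>) W) * of_nat (card W) = (\<Sum>w\<in>W. of_real (?g w))"
        using perp_eq_sum[OF W set_lazy_row[of \<mu>, OF set]] v b unfolding lazy_row_def
        by (simp add: expectation_psi_dot[of "\<lambda>j. lazy ?b (sym_diff (\<mu> j)) \<zero>", OF set_lazy[OF set]] fourier_lazy[OF set])
      then have "complex_of_real (perp (lazy_row ?b \<mu>) W * card W) = of_real (\<Sum>w\<in>W. ?g w)"
        by simp
      then show ?thesis
        by (simp only: of_real_eq_iff)
    qed
    finally show ?thesis .
  qed
  finally have "(\<Sum>w\<in>W - {zvec}. exp (- vec_defect \<mu> w / 2)) \<le>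
      (1/2) ^ k * (perp (lazy_row ?b \<mu>) W * card W) + card W * exp (- (\<alpha> * s) / (2 * 22 ^ k))"
    by simp
  then have "(\<Sum>w\<in>W - {zvec}. exp (- vec_defect \<mu> w / 2)) / card W \<le>
      ((1/2) ^ k * (perp (lazy_row ?b \<mu>) W * card W) + card W * exp (- (\<alpha> * s) / (2 * 22 ^ k))) / card W"
    by (rule divide_right_mono) simp
  also have "\<dots> = (1/2) ^ k * perp (lazy_row ?b \<mu>) W + exp (- (\<alpha> * s) / (2 * 22 ^ k))"
    using c(1) by (simp add: add_divide_distrib)
  finally show ?thesis
    using perp_row_close_sum[OF W, of \<mu>] set by (meson order_trans)
qed

end

section \<open>Orthogonality probabilities\<close>

lemma prob_Pi_pmf_insert_le:
  assumes "finite A" "i \<notin> A" "c \<ge> 0"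
    and QR: "\<And>f x. f \<in> set_pmf (Pi_pmf A d p) \<Longrightarrow> x \<in> set_pmf (p i) \<Longrightarrow> Q (f(i := x)) \<Longrightarrow> R f"
    and c: "\<And>f. f \<in> set_pmf (Pi_pmf A d p) \<Longrightarrow> R f \<Longrightarrow> measure_pmf.prob (p i) {x. Q (f(i := x))} \<le> c"
  shows "measure_pmf.prob (Pi_pmf (insert i A) d p) {f. Q f} \<le> c * measure_pmf.prob (Pi_pmf A d p) {f. R f}"
proof -
  have "measure_pmf.expectation (Pi_pmf A d p) (\<lambda>f. measure_pmf.prob (p i) {x. Q (f(i := x))}) \<le>
      measure_pmf.expectation (Pi_pmf A d p) (\<lambda>f. c * indicator {f. R f} f)"
  proof (rule integral_mono_AE)
    show "integrable (measure_pmf (Pi_pmf A d p)) (\<lambda>f. measure_pmf.prob (p i) {x. Q (f(i := x))})"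
      by (rule measure_pmf.integrable_const_bound[where B = 1]) auto
    show "integrable (measure_pmf (Pi_pmf A d p)) (\<lambda>f. c * indicator {f. R f} f)"
      by (rule measure_pmf.integrable_const_bound[where B = c]) (use assms(3) in \<open>auto simp: indicator_def\<close>)
    show "AE f in measure_pmf (Pi_pmf A d p). measure_pmf.prob (p i) {x. Q (f(i := x))} \<le> c * indicator {f. R f} f"
    proof (rule AE_pmfI)
      fix f assume f: "f \<in> set_pmf (Pi_pmf A d p)"
      show "measure_pmf.prob (p i) {x. Q (f(i := x))} \<le> c * indicator {f. R f} f"
      proof (cases "R f")
        case False
        then have "measure_pmf.prob (p i) {x. Q (f(i := x))} = 0"
          using QR[OF f] by (auto simp: measure_pmf_zero_iff)
        then show ?thesis
          using assms(3) by simp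
      qed (use c[OF f] in simp)
    qed
  qed
  then show ?thesis
    by (simp add: prob_Pi_pmf_insert[OF assms(1,2)])
qed

lemma prob_Pi_pmf_insert_eq:
  assumes "finite A" "i \<notin> A"
    and QR: "\<And>f x. f \<in> set_pmf (Pi_pmf A d p) \<Longrightarrow> x \<in> set_pmf (p i) \<Longrightarrow> Q (f(i := x)) = R f"
  shows "measure_pmf.prob (Pi_pmf (insert i A) d p) {f. Q f} = measure_pmf.prob (Pi_pmf A d p) {f. R f}"
proof -
  have "measure_pmf.expectation (Pi_pmf A d p) (\<lambda>f. measure_pmf.prob (p i) {x. Q (f(i := x))}) =
      measure_pmf.expectation (Pi_pmf A d p) (indicator {f. R f})"
  proof (rule Bochner_Integration.integral_cong_AE)
    show "AE f in measure_pmf (Pi_pmf A d p). measure_pmf.prob (p i) {x. Q (f(i := x))} = indicator {f. R f} f"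
    proof (rule AE_pmfI)
      fix f assume f: "f \<in> set_pmf (Pi_pmf A d p)"
      have "measure_pmf.prob (p i) {x. Q (f(i := x))} = measure_pmf.prob (p i) {x. R f}"
      proof (rule measure_prob_cong_0)
        show "pmf (p i) x = 0" if "x \<in> {x. Q (f(i := x))} - {x. R f}" for x
          by (rule ccontr) (use QR[OF f, of x] that in \<open>simp add: set_pmf_eq split: if_splits\<close>)
        show "pmf (p i) x = 0" if "x \<in> {x. R f} - {x. Q (f(i := x))}" for x
          by (rule ccontr) (use QR[OF f, of x] that in \<open>simp add: set_pmf_eq split: if_splits\<close>)
      qed
      then show "measure_pmf.prob (p i) {x. Q (f(i := x))} = indicator {f. R f} f"
        by (auto simp: indicator_def)
    qed
  qed auto
  then show ?thesis
    by (simp add: prob_Pi_pmf_insert[OF assms(1,2)])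
qed

lemma prob_le_if_unique:
  assumes "\<And>x y. x \<in> set_pmf \<mu> \<Longrightarrow> y \<in> set_pmf \<mu> \<Longrightarrow> Q x \<Longrightarrow> Q y \<Longrightarrow> x = y"
    and "\<And>x. pmf \<mu> x \<le> p" "0 \<le> p"
  shows "measure_pmf.prob \<mu> {x. Q x} \<le> p"
proof (cases "\<exists>x\<in>set_pmf \<mu>. Q x")
  case True
  then obtain x where x: "x \<in> set_pmf \<mu>" "Q x"
    by blast
  have "measure_pmf.prob \<mu> {x. Q x} = measure_pmf.prob \<mu> {x}"
  proof (rule measure_prob_cong_0)
    show "pmf \<mu> y = 0" if "y \<in> {x. Q x} - {x}" for y
      by (rule ccontr) (use that assms(1)[OF x(1) _ x(2), of y] in \<open>simp add: set_pmf_eq\<close>)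
  qed (use x in auto)
  then show ?thesis
    using assms(2)[of x] by (simp add: measure_pmf_single)
next
  case False
  then have "measure_pmf.prob \<mu> {x. Q x} = 0"
    by (auto simp: measure_pmf_zero_iff)
  then show ?thesis
    using assms(3) by simp
qed

lemma pmf_lazy_le:
  assumes "0 \<le> b" "b \<le> 1" "\<And>x. pmf \<mu> x \<le> 1 - a"
  shows "pmf (lazy b \<mu> z) x \<le> 1 - b * a"
proof -
  have "pmf (lazy b \<mu> z) x = b * pmf \<mu> x + (1 - b) * pmf (return_pmf z) x"
    unfolding lazy_def pmf_bind using assms
    by (subst integral_bernoulli_pmf) auto
  also have "\<dots> \<le> b * (1 - a) + (1 - b) * 1"
    using assms by (intro add_mono mult_left_mono) (auto simp: pmf_le_1)
  finally show ?thesis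
    by (simp add: algebra_simps)
qed

context finite_field_character begin

lemma carrier_nonempty [simp]: "carrier F \<noteq> {}"
  using zero_closed by blast

lemma dot_upd:
  assumes "w \<in> vecs" "f \<in> vecs" "f k = \<zero>" "k < n" "a \<in> carrier F"
  shows "dot w (f(k := a)) = w k \<otimes> a \<oplus> dot w f"
proof -
  have k: "{..<n} = insert k ({..<n} - {k})"
    using assms by auto
  have 1: "dot w g = w k \<otimes> g k \<oplus> (\<Oplus>j\<in>{..<n} - {k}. w j \<otimes> g j)" if "g \<in> vecs" for g
    unfolding dot_def by (subst k, subst finsum_insert) (use assms that in auto)
  have 2: "f(k := a) \<in> vecs"
    using assms by (auto simp: vecs_iff)
  have 3: "(\<Oplus>j\<in>{..<n} - {k}. w j \<otimes> (f(k := a)) j) = (\<Oplus>j\<in>{..<n} - {k}. w j \<otimes> f j)"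
    by (rule finsum_cong') (use assms in auto)
  have "(\<Oplus>j\<in>{..<n} - {k}. w j \<otimes> f j) \<in> carrier F"
    by (rule finsum_closed) (use assms in auto)
  moreover have "dot w (f(k := a)) = w k \<otimes> a \<oplus> (\<Oplus>j\<in>{..<n} - {k}. w j \<otimes> f j)"
    using 1[OF 2] unfolding 3 by simp
  ultimately show ?thesis
    using assms by (simp add: 1[OF assms(2)])
qed

text \<open>Entry \<open>k\<close> is revealed last. The vector \<open>w0\<close> leaves at most one
  value for it, whereas the vectors vanishing at \<open>k\<close> constrain only the other entries;
  hence \<open>p\<close> is gained on top of the probability for those vectors.\<close>

lemma perp_row_truncate:
  assumes V: "subsp V" and k: "k < n" and w0: "w0 \<in> V" "w0 k \<noteq> \<zero>"
    and set: "\<And>j. j < n \<Longrightarrow> set_pmf (\<mu> j) \<subseteq> carrier F"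
    and p: "\<And>x. pmf (\<mu> k) x \<le> p" "0 \<le> p"
  shows "perp (row \<mu>) V \<le> p * perp (row \<mu>) {w\<in>V. w k = \<zero>}"
proof -
  let ?A = "{..<n} - {k}"
  have ins: "{..<n} = insert k ?A"
    using k by auto
  have v: "w \<in> vecs" if "w \<in> V" for w
    using that subspD(1)[OF V] by auto
  have f: "f \<in> vecs" "f k = \<zero>" if "f \<in> set_pmf (Pi_pmf ?A \<zero> \<mu>)" for f
  proof -
    have *: "f \<in> PiE_dflt ?A \<zero> (set_pmf \<circ> \<mu>)"
      using that by (simp add: set_Pi_pmf)
    then show "f k = \<zero>"
      by (simp add: PiE_dflt_def)
    have "f j \<in> carrier F" if "j < n" for j
      using * \<open>f k = \<zero>\<close> subsetD[OF set[OF that], of "f j"] that by (cases "j = k") (auto simp: PiE_dflt_def)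
    then show "f \<in> vecs"
      using * by (auto simp: vecs_iff PiE_dflt_def)
  qed
  have x: "x \<in> carrier F" if "x \<in> set_pmf (\<mu> k)" for x
    using set[OF k] that by auto
  have "perp (row \<mu>) V \<le> p * measure_pmf.prob (Pi_pmf ?A \<zero> \<mu>) {f. \<forall>w\<in>{w\<in>V. w k = \<zero>}. dot w f = \<zero>}"
    unfolding perp_def row_def
  proof (subst ins, rule prob_Pi_pmf_insert_le[OF _ _ p(2)])
    fix f a assume fa: "f \<in> set_pmf (Pi_pmf ?A \<zero> \<mu>)" "a \<in> set_pmf (\<mu> k)" "\<forall>w\<in>V. dot w (f(k := a)) = \<zero>"
    show "\<forall>w\<in>{w\<in>V. w k = \<zero>}. dot w f = \<zero>"
    proof
      fix w assume w: "w \<in> {w\<in>V. w k = \<zero>}"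
      then have "dot w (f(k := a)) = w k \<otimes> a \<oplus> dot w f"
        using f[OF fa(1)] x[OF fa(2)] v k by (intro dot_upd) auto
      then show "dot w f = \<zero>"
        using fa(3) w f[OF fa(1)] x[OF fa(2)] v by auto
    qed
  next
    fix f assume fs: "f \<in> set_pmf (Pi_pmf ?A \<zero> \<mu>)"
    show "measure_pmf.prob (\<mu> k) {x. \<forall>w\<in>V. dot w (f(k := x)) = \<zero>} \<le> p"
    proof (rule prob_le_if_unique[OF _ p])
      fix a b assume ab: "a \<in> set_pmf (\<mu> k)" "b \<in> set_pmf (\<mu> k)"
        "\<forall>w\<in>V. dot w (f(k := a)) = \<zero>" "\<forall>w\<in>V. dot w (f(k := b)) = \<zero>"
      have "w0 k \<otimes> c \<oplus> dot w0 f = \<zero>" if "c = a \<or> c = b" for c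
        using dot_upd[of w0 f k c] f[OF fs] x ab v[OF w0(1)] w0 k that by metis
      then have "w0 k \<otimes> a \<oplus> dot w0 f = w0 k \<otimes> b \<oplus> dot w0 f"
        by metis
      then show "a = b"
        using f[OF fs] x[OF ab(1)] x[OF ab(2)] v[OF w0(1)] w0 m_lcancel by simp
    qed
  qed auto
  also have "measure_pmf.prob (Pi_pmf ?A \<zero> \<mu>) {f. \<forall>w\<in>{w\<in>V. w k = \<zero>}. dot w f = \<zero>} =
      perp (row \<mu>) {w\<in>V. w k = \<zero>}"
    unfolding perp_def row_def
  proof (subst ins, rule prob_Pi_pmf_insert_eq[symmetric])
    fix f a assume fa: "f \<in> set_pmf (Pi_pmf ?A \<zero> \<mu>)" "a \<in> set_pmf (\<mu> k)"
    have "dot w (f(k := a)) = dot w f" if "w \<in> {w\<in>V. w k = \<zero>}" for w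
    proof -
      have "dot w (f(k := a)) = w k \<otimes> a \<oplus> dot w f"
        using f[OF fa(1)] x[OF fa(2)] v that k by (intro dot_upd) auto
      then show ?thesis
        using that f[OF fa(1)] x[OF fa(2)] v by auto
    qed
    then show "(\<forall>w\<in>{w\<in>V. w k = \<zero>}. dot w (f(k := a)) = \<zero>) = (\<forall>w\<in>{w\<in>V. w k = \<zero>}. dot w f = \<zero>)"
      by simp
  qed auto
  finally show ?thesis .
qed

text \<open>Odlyzko's argument: restrict \<open>W\<close> to its vectors supported below
  \<open>k\<close>, and lower \<open>k\<close> step by step. Whenever the dimension drops, it drops
  by one and a factor \<open>p\<close> is gained.\<close>

lemma perp_row_le:
  assumes W: "subsp W" and d: "card W = q ^ d"
    and set: "\<And>j. j < n \<Longrightarrow> set_pmf (\<mu> j) \<subseteq> carrier F"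
    and p: "\<And>j x. j < n \<Longrightarrow> pmf (\<mu> j) x \<le> p" "0 \<le> p"
  shows "perp (row \<mu>) W \<le> p ^ d"
proof -
  define V where "V = (\<lambda>k. {w\<in>W. \<forall>j\<ge>k. w j = \<zero>})"
  have v: "w \<in> vecs" if "w \<in> W" for w
    using that subspD(1)[OF W] by auto
  have sub: "subsp (V k)" for k
    using W v unfolding subsp_def V_def by (auto simp: vadd_def smul_def zvec_def)
  have "card (V k) = q ^ e \<Longrightarrow> perp (row \<mu>) (V k) \<le> p ^ e" if "k \<le> n" for k e
    using that
  proof (induction k arbitrary: e)
    case 0
    have "V 0 = {zvec}"
      using subspD(2)[OF W] by (auto simp: V_def zvec_def fun_eq_iff)
    then have "q ^ e = 1"
      using 0 by simp
    then have "e = 0"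
      using q_ge_2 by (cases e) auto
    then show ?case
      by simp
  next
    case (Suc k)
    have eq: "V k = {w \<in> V (Suc k). w k = \<zero>}"
      unfolding V_def by auto (metis le_antisym not_less_eq_eq)
    show ?case
    proof (cases "\<exists>w0\<in>V (Suc k). w0 k \<noteq> \<zero>")
      case False
      then have "V (Suc k) = V k"
        using eq by auto
      then show ?thesis
        using Suc by simp
    next
      case True
      then obtain w0 where w0: "w0 \<in> V (Suc k)" "w0 k \<noteq> \<zero>"
        by blast
      have card: "card (V (Suc k)) = q * card (V k)"
        unfolding eq
        by (rule card_kernel[where \<phi> = "\<lambda>w. w k", OF sub _ _ _ w0]) (auto simp: vadd_def smul_def V_def v)
      have "e \<noteq> 0"
      proof
        assume "e = 0"
        then have "q * card (V k) = 1"
          using card Suc.prems(1) by simp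
        then show False
          using q_ge_2 by simp
      qed
      then obtain e' where e': "e = Suc e'"
        by (cases e) auto
      then have "card (V k) = q ^ e'"
        using card Suc.prems(1) q_ge_2 by simp
      then have "perp (row \<mu>) (V k) \<le> p ^ e'"
        using Suc by simp
      then have "p * perp (row \<mu>) (V k) \<le> p * p ^ e'"
        using p(2) by (rule mult_left_mono)
      moreover have "perp (row \<mu>) (V (Suc k)) \<le> p * perp (row \<mu>) (V k)"
        unfolding eq by (rule perp_row_truncate[OF sub _ w0 set]) (use Suc.prems p in auto)
      ultimately show ?thesis
        using e' by simp
    qed
  qed
  moreover have "V n = W"
    using v by (auto simp: V_def vecs_iff)
  ultimately show ?thesis
    using d by blast
qed

text \<open>Points are the cosets of the trivial subgroup.\<close>

lemma pmf_balanced_le: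
  assumes "balanced_on \<alpha> \<mu>"
  shows "pmf \<mu> x \<le> 1 - \<alpha>"
proof -
  have "additive_subgroup {\<zero>} F"
    by unfold_locales auto
  moreover have "{\<zero>} \<subset> carrier F"
  proof -
    have "\<one> \<in> carrier F - {\<zero>}"
      by simp
    then show ?thesis
      using zero_closed by blast
  qed
  ultimately have *: "measure_pmf.prob \<mu> (x <+ {\<zero>}) \<le> 1 - \<alpha>" if "x \<in> carrier F" for x
    using assms that by (auto simp: balanced_on_def)
  show ?thesis
  proof (cases "x \<in> carrier F")
    case True
    then show ?thesis
      using *[OF True] by (simp add: a_l_coset_def' measure_pmf_single)
  next
    case False
    then have "pmf \<mu> x = 0"
      using assms by (auto simp: balanced_on_def set_pmf_eq)
    then show ?thesis
      using order_trans[OF measure_nonneg *[OF zero_closed]] by simp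
  qed
qed

lemma balanced_on_le_1: "balanced_on \<alpha> \<mu> \<Longrightarrow> \<alpha> < 1"
proof -
  assume b: "balanced_on \<alpha> \<mu>"
  obtain x where "x \<in> set_pmf \<mu>"
    using set_pmf_not_empty[of \<mu>] by blast
  then have "pmf \<mu> x > 0"
    by (simp add: pmf_positive_iff)
  then show ?thesis
    using pmf_balanced_le[OF b, of x] by simp
qed

text \<open>Given the second copy, only one value of the first one produces the difference
  \<open>x\<close>.\<close>

lemma pmf_sym_diff_le:
  assumes "balanced_on \<alpha> \<mu>"
  shows "pmf (sym_diff \<mu>) x \<le> 1 - \<alpha>"
proof -
  have supp: "set_pmf \<mu> \<subseteq> carrier F"
    using assms by (simp add: balanced_on_def)
  have "sym_diff \<mu> = bind_pmf \<mu> (\<lambda>y. map_pmf (\<lambda>z. z \<ominus> y) \<mu>)"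
    unfolding sym_diff_def pair_pmf_def
    by (subst bind_commute_pmf) (simp add: map_pmf_def bind_assoc_pmf bind_return_pmf)
  then have "pmf (sym_diff \<mu>) x = E \<mu> (\<lambda>y. measure_pmf.prob \<mu> {z. z \<ominus> y = x})"
    by (simp add: pmf_bind pmf_map vimage_def)
  also have "\<dots> \<le> E \<mu> (\<lambda>y. 1 - \<alpha>)"
  proof (rule integral_mono_AE)
    show "integrable (measure_pmf \<mu>) (\<lambda>y. measure_pmf.prob \<mu> {z. z \<ominus> y = x})"
      by (rule measure_pmf.integrable_const_bound[where B = 1]) auto
    show "AE y in measure_pmf \<mu>. measure_pmf.prob \<mu> {z. z \<ominus> y = x} \<le> 1 - \<alpha>"
    proof (rule AE_pmfI, rule prob_le_if_unique)
      fix y a b assume "y \<in> set_pmf \<mu>" "a \<in> set_pmf \<mu>" "b \<in> set_pmf \<mu>" "a \<ominus> y = x" "b \<ominus> y = x"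
      then have "a \<oplus> \<ominus> y = b \<oplus> \<ominus> y" "a \<in> carrier F" "b \<in> carrier F" "y \<in> carrier F"
        using supp by (auto simp: minus_eq)
      then show "a = b"
        by simp
    qed (use pmf_balanced_le[OF assms] balanced_on_le_1[OF assms] in auto)
  qed auto
  finally show ?thesis
    by simp
qed

lemma perp_lazy_row_le:
  assumes W: "subsp W" and d: "card W = q ^ d" and bal: "\<And>j. j < n \<Longrightarrow> balanced_on \<alpha> (\<mu> j)"
    and b: "0 \<le> b" "b \<le> 1" "0 \<le> \<alpha>" "\<alpha> \<le> 1"
  shows "perp (lazy_row b \<mu>) W \<le> (1 - b * \<alpha>) ^ d"
  unfolding lazy_row_def
proof (rule perp_row_le[OF W d])
  show "set_pmf (lazy b (sym_diff (\<mu> j)) \<zero>) \<subseteq> carrier F" if "j < n" for j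
    using bal[OF that] by (intro set_lazy) (simp add: balanced_on_def)
  show "pmf (lazy b (sym_diff (\<mu> j)) \<zero>) x \<le> 1 - b * \<alpha>" if "j < n" for j x
    by (rule pmf_lazy_le[OF b(1,2) pmf_sym_diff_le[OF bal[OF that]]])
  show "0 \<le> 1 - b * \<alpha>"
    using b mult_mono[of b 1 \<alpha> 1] by simp
qed

text \<open>The modulus of the Fourier transform at \<open>t\<close> is at most
  \<open>exp (- defect \<mu> t / 2)\<close>, so this controls its moment of order
  \<open>2 * l\<close>. The growth of sublevel sets is applied to the additive group of the field
  itself, and \<open>\<zero>\<close> contributes the summand \<open>1\<close>.\<close>

lemma sum_exp_defect_le:
  assumes bal: "balanced_on \<alpha> \<mu>" and "\<alpha> > 0" "l > 0"
  shows "(\<Sum>t\<in>carrier F. exp (- (l * defect \<mu> t))) \<le> 1 + real q * ((1/2) ^ k + exp (- (l * \<alpha>) / 22 ^ k))"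
proof -
  \<comment> \<open>The factor \<open>2 * l\<close> makes up for the halved exponent in the growth
    estimate.\<close>
  interpret Q: quasinormed_group "carrier F" "(\<oplus>)" \<zero> "\<lambda>t. 2 * l * defect \<mu> t" "2 * l * \<alpha>"
  proof
    show "2 * l * \<alpha> > 0"
      using assms by simp
    show "inj_on ((\<oplus>) a) (carrier F)" if "a \<in> carrier F" for a
      using that by (auto simp: inj_on_def)
    show "2 * l * defect \<mu> (a \<oplus> b) \<le> 2 * (2 * l * defect \<mu> a + 2 * l * defect \<mu> b)" if "a \<in> carrier F" "b \<in> carrier F" for a b
      using mult_left_mono[OF defect_add[OF that, of \<mu>], of "2 * l"] assms(3) by (simp add: algebra_simps)
    show "2 * l * defect \<mu> a \<le> 2 * (2 * l * defect \<mu> (a \<oplus> b) + 2 * l * defect \<mu> b)" if "a \<in> carrier F" "b \<in> carrier F" for a b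
      using mult_left_mono[OF defect_diff[OF that, of \<mu>], of "2 * l"] assms(3) by (simp add: algebra_simps)
    show "\<exists>j. 2 * l * \<alpha> \<le> 2 * l * defect \<mu> (((\<oplus>) t ^^ j) \<zero>)" if t: "t \<in> carrier F" "t \<noteq> \<zero>" for t
    proof -
      have "\<exists>j<q. \<alpha> \<le> defect \<mu> (((\<oplus>) t ^^ j) \<zero>)"
      proof (rule ccontr)
        assume "\<not> ?thesis"
        then have "(\<Sum>j<q. defect \<mu> (((\<oplus>) t ^^ j) \<zero>)) < (\<Sum>j<q. \<alpha>)"
          by (intro sum_strict_mono) (auto simp: not_le lessThan_empty_iff)
        then show False
          using sum_defect_iterate_ge[OF bal t] by simp
      qed
      then show ?thesis
        using assms(3) by auto
    qed
  qed (use assms in auto)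
  have "(\<Sum>t\<in>carrier F. exp (- (l * defect \<mu> t))) = 1 + (\<Sum>t\<in>carrier F - {\<zero>}. exp (- (l * defect \<mu> t)))"
    by (subst sum.remove[of _ \<zero>]) auto
  also have "(\<Sum>t\<in>carrier F - {\<zero>}. exp (- (l * defect \<mu> t))) \<le>
     (1/2) ^ k * (\<Sum>t\<in>carrier F - {\<zero>}. exp (- (2 * l * defect \<mu> t) / (2 * 22 ^ k))) + q * exp (- (l * \<alpha>) / 22 ^ k)"
    using Q.sum_exp_quasinorm_le[of k] by simp
  also have "(\<Sum>t\<in>carrier F - {\<zero>}. exp (- (2 * l * defect \<mu> t) / (2 * 22 ^ k))) \<le> (\<Sum>t\<in>carrier F - {\<zero>}. 1)"
    using assms defect_nonneg by (intro sum_mono) (auto intro!: divide_nonneg_nonneg mult_nonneg_nonneg)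
  also have "\<dots> \<le> real q"
    using card_mono[of "carrier F" "carrier F - {\<zero>}"] by simp
  finally show ?thesis
    by (simp add: algebra_simps)
qed

section \<open>Multiples of a single vector\<close>

lemma vec_defect_nonneg: "w \<in> vecs \<Longrightarrow> 0 \<le> vec_defect \<mu> w"
  unfolding vec_defect_def by (intro sum_nonneg defect_nonneg) auto

lemma iterate_vadd_vecs: "w \<in> vecs \<Longrightarrow> (vadd w ^^ j) zvec \<in> vecs"
  by (induction j) auto

lemma vec_defect_iterate_le: "w \<in> vecs \<Longrightarrow> vec_defect \<mu> ((vadd w ^^ j) zvec) \<le> 4 ^ j * vec_defect \<mu> w"
proof (induction j)
  case (Suc j)
  have "vec_defect \<mu> ((vadd w ^^ Suc j) zvec) \<le> 2 * (vec_defect \<mu> w + vec_defect \<mu> ((vadd w ^^ j) zvec))"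
    using vec_defect_add[OF Suc.prems iterate_vadd_vecs[OF Suc.prems]] by simp
  also have "\<dots> \<le> 2 * (4 ^ j * vec_defect \<mu> w + 4 ^ j * vec_defect \<mu> w)"
    using Suc mult_right_mono[of 1 "4 ^ j" "vec_defect \<mu> w"] vec_defect_nonneg[OF Suc.prems, of \<mu>]
    by (intro mult_left_mono add_mono) auto
  finally show ?case
    by (simp add: mult_ac)
qed (simp add: vec_defect_nonneg)

text \<open>The multiple of large defect is reached in fewer than \<open>q\<close> additions, each
  costing at most a factor \<open>4\<close>. The loss \<open>4 ^ q\<close> makes this a tool for
  fields of bounded size.\<close>

lemma vec_defect_ge:
  assumes bal: "\<And>j. j < n \<Longrightarrow> balanced_on \<alpha> (\<mu> j)" and w: "w \<in> vecs"
  shows "\<alpha> * real (card (supp w)) \<le> 4 ^ q * vec_defect \<mu> w"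
proof -
  obtain j where j: "j < q" "\<alpha> * real (card (supp w)) \<le> vec_defect \<mu> ((vadd w ^^ j) zvec)"
    using vec_defect_iterate_ge[where \<alpha> = \<alpha> and \<mu> = \<mu>, OF bal w] by blast
  note j(2)
  also have "vec_defect \<mu> ((vadd w ^^ j) zvec) \<le> 4 ^ j * vec_defect \<mu> w"
    by (rule vec_defect_iterate_le[OF w])
  also have "\<dots> \<le> 4 ^ q * vec_defect \<mu> w"
    using j(1) vec_defect_nonneg[OF w] by (intro mult_right_mono power_increasing) auto
  finally show ?thesis .
qed

definition line :: "(nat \<Rightarrow> 'a) \<Rightarrow> (nat \<Rightarrow> 'a) set" where
  "line w = (\<lambda>t. smul t w) ` carrier F"

lemma subsp_line: "w \<in> vecs \<Longrightarrow> subsp (line w)"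
  unfolding subsp_def
proof (intro conjI ballI)
  assume w: "w \<in> vecs"
  show "line w \<subseteq> vecs"
    using w by (auto simp: line_def)
  show "zvec \<in> line w"
    using w by (auto simp: line_def zvec_def smul_def intro!: image_eqI[of _ _ \<zero>])
next
  fix u v assume w: "w \<in> vecs" and "u \<in> line w" "v \<in> line w"
  then obtain s t where "s \<in> carrier F" "t \<in> carrier F" "u = smul s w" "v = smul t w"
    by (auto simp: line_def)
  then have "vadd u v = smul (s \<oplus> t) w" "s \<oplus> t \<in> carrier F"
    using w by (auto simp: vadd_def smul_def fun_eq_iff l_distr)
  then show "vadd u v \<in> line w"
    unfolding line_def by blast
next
  fix s v assume w: "w \<in> vecs" and s: "s \<in> carrier F" and "v \<in> line w"
  then obtain t where "t \<in> carrier F" "v = smul t w"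
    by (auto simp: line_def)
  then have "smul s v = smul (s \<otimes> t) w" "s \<otimes> t \<in> carrier F"
    using w s by (auto simp: smul_def fun_eq_iff m_assoc)
  then show "smul s v \<in> line w"
    unfolding line_def by blast
qed

lemma inj_smul: "w \<in> vecs \<Longrightarrow> w \<noteq> zvec \<Longrightarrow> inj_on (\<lambda>t. smul t w) (carrier F)"
proof (rule inj_onI)
  fix s t assume w: "w \<in> vecs" "w \<noteq> zvec" and st: "s \<in> carrier F" "t \<in> carrier F" "smul s w = smul t w"
  obtain j where "w j \<noteq> \<zero>"
    using w by (auto simp: zvec_def)
  moreover have "s \<otimes> w j = t \<otimes> w j"
    using fun_cong[OF st(3), of j] by (simp add: smul_def)
  ultimately show "s = t"
    using m_rcancel[of "w j" s t] st w by simp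
qed

lemma card_line: "w \<in> vecs \<Longrightarrow> w \<noteq> zvec \<Longrightarrow> card (line w) = q"
  unfolding line_def by (rule card_image[OF inj_smul])

lemma supp_smul: "t \<in> carrier F \<Longrightarrow> t \<noteq> \<zero> \<Longrightarrow> w \<in> vecs \<Longrightarrow> supp (smul t w) = supp w"
  by (auto simp: supp_def smul_def integral_iff)

lemma smul_zero [simp]: "w \<in> vecs \<Longrightarrow> smul \<zero> w = zvec"
  by (simp add: smul_def zvec_def)

lemma smul_one [simp]: "w \<in> vecs \<Longrightarrow> smul \<one> w = w"
  by (simp add: smul_def)

text \<open>Bounds for subspaces thus apply to single vectors. The two events are compared on
  \<open>vecs\<close>, where the product is linear, which is why the support of \<open>\<xi>\<close>
  enters.\<close>

lemma perp_singleton: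
  assumes "set_pmf \<xi> \<subseteq> vecs" "w \<in> vecs"
  shows "perp \<xi> {w} = perp \<xi> (line w)"
  unfolding perp_def
proof (rule measure_prob_cong_0)
  fix x assume x: "x \<in> {x. \<forall>w\<in>{w}. dot w x = \<zero>} - {x. \<forall>w\<in>line w. dot w x = \<zero>}"
  show "pmf \<xi> x = 0"
  proof (rule ccontr)
    assume "pmf \<xi> x \<noteq> 0"
    then have "x \<in> vecs"
      using assms(1) by (auto simp: set_pmf_eq)
    then show False
      using x assms(2) by (auto simp: line_def dot_smul)
  qed
next
  fix x assume x: "x \<in> {x. \<forall>w\<in>line w. dot w x = \<zero>} - {x. \<forall>w\<in>{w}. dot w x = \<zero>}"
  have "w \<in> line w"
    unfolding line_def using assms(2) by (auto intro!: image_eqI[of _ _ \<one>])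
  then show "pmf \<xi> x = 0"
    using x by auto
qed

end

section \<open>The exchange argument\<close>

lemma prob_Pi_pmf_insert_ge:
  assumes "finite A" "i \<notin> A"
    and c: "\<And>f. f \<in> set_pmf (Pi_pmf A d p) \<Longrightarrow> R f \<Longrightarrow> c \<le> measure_pmf.prob (p i) {x. Q (f(i := x))}"
  shows "c * measure_pmf.prob (Pi_pmf A d p) {f. R f} \<le> measure_pmf.prob (Pi_pmf (insert i A) d p) {f. Q f}"
proof -
  have "measure_pmf.expectation (Pi_pmf A d p) (\<lambda>f. c * indicator {f. R f} f) \<le>
      measure_pmf.expectation (Pi_pmf A d p) (\<lambda>f. measure_pmf.prob (p i) {x. Q (f(i := x))})"
  proof (rule integral_mono_AE)
    show "integrable (measure_pmf (Pi_pmf A d p)) (\<lambda>f. measure_pmf.prob (p i) {x. Q (f(i := x))})"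
      by (rule measure_pmf.integrable_const_bound[where B = 1]) auto
    show "integrable (measure_pmf (Pi_pmf A d p)) (\<lambda>f. c * indicator {f. R f} f)"
      by (rule measure_pmf.integrable_const_bound[where B = "\<bar>c\<bar>"]) (auto simp: indicator_def)
    show "AE f in measure_pmf (Pi_pmf A d p). c * indicator {f. R f} f \<le> measure_pmf.prob (p i) {x. Q (f(i := x))}"
    proof (rule AE_pmfI)
      fix f assume f: "f \<in> set_pmf (Pi_pmf A d p)"
      show "c * indicator {f. R f} f \<le> measure_pmf.prob (p i) {x. Q (f(i := x))}"
        using c[OF f] by (cases "R f") simp_all
    qed
  qed
  then show ?thesis
    by (simp add: prob_Pi_pmf_insert[OF assms(1,2)])
qed

lemma sum_prob_le_card:
  assumes "finite V" "\<And>z. z \<in> set_pmf M \<Longrightarrow> card {v\<in>V. P v z} \<le> N"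
  shows "(\<Sum>v\<in>V. measure_pmf.prob M {z. P v z}) \<le> real N"
proof -
  have "(\<Sum>v\<in>V. measure_pmf.prob M {z. P v z}) = (\<Sum>v\<in>V. measure_pmf.expectation M (indicator {z. P v z}))"
    by simp
  also have "\<dots> = measure_pmf.expectation M (\<lambda>z. \<Sum>v\<in>V. indicator {z. P v z} z)"
    by (rule Bochner_Integration.integral_sum[symmetric], rule measure_pmf.integrable_const_bound[where B = 1]) auto
  also have "\<dots> = measure_pmf.expectation M (\<lambda>z. real (card {v\<in>V. P v z}))"
    using assms(1) by (simp add: indicator_def sum.If_cases Collect_conj_eq)
  also have "\<dots> \<le> measure_pmf.expectation M (\<lambda>z. real N)"
  proof (rule integral_mono_AE)
    show "integrable (measure_pmf M) (\<lambda>z. real (card {v\<in>V. P v z}))"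
      by (rule measure_pmf.integrable_const_bound[where B = "real (card V)"])
         (use assms(1) in \<open>auto intro!: card_mono\<close>)
    show "AE z in measure_pmf M. real (card {v\<in>V. P v z}) \<le> real N"
      by (rule AE_pmfI) (use assms(2) in simp)
  qed simp
  finally show ?thesis
    by simp
qed

lemma set_Pi_pmf_nth: "finite A \<Longrightarrow> f \<in> set_pmf (Pi_pmf A d p) \<Longrightarrow> i \<in> A \<Longrightarrow> f i \<in> set_pmf (p i)"
  by (simp add: set_Pi_pmf PiE_dflt_def)

lemma prob_Pi_pmf_all:
  assumes "finite A" "B \<subseteq> A"
  shows "measure_pmf.prob (Pi_pmf A d p) {f. \<forall>i\<in>B. Q (f i)} = (\<Prod>i\<in>B. measure_pmf.prob (p i) {x. Q x})"
proof -
  have "measure_pmf.prob (Pi_pmf A d p) {f. \<forall>i\<in>B. Q (f i)} = measure_pmf.prob (Pi_pmf B d p) {f. \<forall>i\<in>B. Q (f i)}"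
    by (rule prob_Pi_pmf_mono_set[OF assms]) simp
  also have "\<dots> = measure_pmf.prob (Pi_pmf B d p) (Pi B (\<lambda>_. {x. Q x}))"
    by (simp add: Pi_def Ball_def)
  also have "\<dots> = (\<Prod>i\<in>B. measure_pmf.prob (p i) {x. Q x})"
    by (rule measure_Pi_pmf_Pi) (use assms finite_subset in auto)
  finally show ?thesis .
qed

lemma prob_subset_sum:
  assumes "finite I" "\<And>z. z \<in> set_pmf M \<Longrightarrow> P z \<Longrightarrow> \<exists>i\<in>I. Q i z"
  shows "measure_pmf.prob M {z. P z} \<le> (\<Sum>i\<in>I. measure_pmf.prob M {z. Q i z})"
proof -
  have "measure_pmf.prob M {z. P z} = measure_pmf.prob M ({z. P z} \<inter> set_pmf M)"
    by (simp add: measure_Int_set_pmf)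
  also have "\<dots> \<le> measure_pmf.prob M (\<Union>i\<in>I. {z. Q i z})"
    using assms(2) by (intro measure_pmf.finite_measure_mono) auto
  also have "\<dots> \<le> (\<Sum>i\<in>I. measure_pmf.prob M {z. Q i z})"
    by (rule measure_pmf.finite_measure_subadditive_finite) (use assms(1) in auto)
  finally show ?thesis .
qed

context finite_field_character begin

definition indep_in :: "'i set \<Rightarrow> (nat \<Rightarrow> 'a) set \<Rightarrow> ('i \<Rightarrow> nat \<Rightarrow> 'a) \<Rightarrow> bool" where
  "indep_in I W Z \<longleftrightarrow> indep I Z \<and> W \<subseteq> ann I Z"

lemma indep_in_cong: "(\<And>i. i \<in> I \<Longrightarrow> Z i = Z' i) \<Longrightarrow> indep_in I W Z = indep_in I W Z'"
  unfolding indep_in_def using indep_cong[of I Z Z'] ann_cong[of I Z Z'] by simp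

text \<open>Rows are drawn one at a time. A new row orthogonal to \<open>W\<close> fails only if it
  depends on the earlier ones, that is, if it is orthogonal to their annihilator. With fewer than
  \<open>r\<close> rows present this annihilator has dimension above \<open>n - r\<close>, so
  \<open>\<theta>\<close> bounds the loss.\<close>

lemma prob_indep_in_ge:
  assumes W: "W \<subseteq> vecs" and \<theta>: "\<theta> \<le> \<pi>" and "finite A"
    and set: "\<And>i. i \<in> A \<Longrightarrow> set_pmf (p i) \<subseteq> vecs"
    and \<pi>: "\<And>i. i \<in> A \<Longrightarrow> perp (p i) W = \<pi>"
    and \<theta>2: "\<And>i U d. i \<in> A \<Longrightarrow> subsp U \<Longrightarrow> card U = q ^ d \<Longrightarrow> n < d + r \<Longrightarrow> perp (p i) U \<le> \<theta>"
    and r: "card A \<le> r" "r \<le> n"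
  shows "(\<pi> - \<theta>) ^ card A \<le> measure_pmf.prob (Pi_pmf A zvec p) {Z. indep_in A W Z}"
  using \<open>finite A\<close> set \<pi> \<theta>2 r(1)
proof (induction A rule: finite_induct)
  case empty
  show ?case
    using W by (simp add: indep_in_def)
next
  case (insert i A)
  have IH: "(\<pi> - \<theta>) ^ card A \<le> measure_pmf.prob (Pi_pmf A zvec p) {Z. indep_in A W Z}"
    by (rule insert.IH) (use insert.prems insert.hyps in auto)
  have "(\<pi> - \<theta>) * measure_pmf.prob (Pi_pmf A zvec p) {Z. indep_in A W Z} \<le>
     measure_pmf.prob (Pi_pmf (insert i A) zvec p) {Z. indep_in (insert i A) W Z}"
  proof (rule prob_Pi_pmf_insert_ge[OF insert.hyps])
    fix f assume f: "f \<in> set_pmf (Pi_pmf A zvec p)" "indep_in A W f"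
    have fv: "f j \<in> vecs" if "j \<in> A" for j
      using set_Pi_pmf_nth[OF insert.hyps(1) f(1) that] insert.prems(1)[of j] that by auto
    have sub: "subsp (ann A f)"
      by (rule subsp_ann'[OF fv])
    have ca: "card (ann A f) = q ^ (n - card A)"
      using f(2) indep_card_ann by (auto simp: indep_in_def)
    have lt: "n < (n - card A) + r"
      using insert.prems(4) insert.hyps r(2) by simp
    have "{x. \<forall>w\<in>W. dot w x = \<zero>} \<inter> set_pmf (p i) \<subseteq>
        {x. indep_in (insert i A) W (f(i := x))} \<union> {x. \<forall>w\<in>ann A f. dot w x = \<zero>}"
    proof (rule subsetI, rule UnCI)
      fix x assume x: "x \<in> {x. \<forall>w\<in>W. dot w x = \<zero>} \<inter> set_pmf (p i)"
        and nx: "x \<notin> {x. \<forall>w\<in>ann A f. dot w x = \<zero>}"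
      let ?f = "f(i := x)"
      have eq: "ann A ?f = ann A f" "indep A ?f = indep A f"
        using insert.hyps by (auto intro!: ann_cong indep_cong)
      have xv: "x \<in> vecs"
        using x insert.prems(1)[of i] by auto
      have "indep (insert i A) ?f \<longleftrightarrow> (\<exists>w\<in>ann A ?f. dot w (?f i) \<noteq> \<zero>)"
        by (rule indep_insert_iff) (use insert.hyps f(2) eq xv fv in \<open>auto simp: indep_in_def\<close>)
      then have "indep (insert i A) ?f"
        using nx eq by auto
      moreover have "W \<subseteq> ann (insert i A) ?f"
        using x f(2) insert.hyps W by (auto simp: indep_in_def ann_def subset_iff)
      ultimately show "x \<in> {x. indep_in (insert i A) W (f(i := x))}"
        by (simp add: indep_in_def)
    qed
    then have "measure_pmf.prob (p i) ({x. \<forall>w\<in>W. dot w x = \<zero>} \<inter> set_pmf (p i)) \<le>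
        measure_pmf.prob (p i) ({x. indep_in (insert i A) W (f(i := x))} \<union> {x. \<forall>w\<in>ann A f. dot w x = \<zero>})"
      by (intro measure_pmf.finite_measure_mono) auto
    also have "\<dots> \<le> measure_pmf.prob (p i) {x. indep_in (insert i A) W (f(i := x))} + perp (p i) (ann A f)"
      unfolding perp_def by (rule measure_Un_le) auto
    finally have "perp (p i) W \<le> measure_pmf.prob (p i) {x. indep_in (insert i A) W (f(i := x))} + perp (p i) (ann A f)"
      by (simp add: measure_Int_set_pmf perp_def)
    then show "\<pi> - \<theta> \<le> measure_pmf.prob (p i) {x. indep_in (insert i A) W (f(i := x))}"
      using insert.prems(2)[of i] insert.prems(3)[OF _ sub ca lt, of i] by simp
  qed
  moreover have "(\<pi> - \<theta>) * (\<pi> - \<theta>) ^ card A \<le> (\<pi> - \<theta>) * measure_pmf.prob (Pi_pmf A zvec p) {Z. indep_in A W Z}"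
    using \<theta> by (intro mult_left_mono IH) auto
  ultimately show ?case
    using insert.hyps by simp
qed

text \<open>Steinitz exchange in terms of annihilators: some \<open>B \<subseteq> I\<close>
  completes \<open>Y\<close> to the annihilator of \<open>Y \<union> I\<close>. The latter lies
  inside the annihilator of \<open>I\<close>, and comparing cardinalities gives
  \<open>card B \<ge> card I - card Y\<close>.\<close>

lemma exchange:
  assumes fin: "finite I" "finite Y" "I \<inter> Y = {}" and v: "\<And>i. i \<in> I \<union> Y \<Longrightarrow> Z i \<in> vecs"
    and I: "indep_in I W Z" and Y: "indep_in Y W Z" and le: "card Y \<le> card I"
  shows "\<exists>S\<subseteq>I. card S = card I - card Y \<and> indep_in (S \<union> Y) W Z"
proof -
  have sub: "subsp (ann Y Z)"
    using v by (intro subsp_ann') auto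
  obtain B where B: "B \<subseteq> I" "ann Y Z \<inter> ann B Z = ann Y Z \<inter> ann I Z"
    "card (ann Y Z \<inter> ann B Z) * q ^ card B = card (ann Y Z)"
    using exists_basis[OF sub fin(1), of Z] v by auto
  have ci: "card (ann I Z) = q ^ (n - card I)" "card I \<le> n" "card (ann Y Z) = q ^ (n - card Y)" "card Y \<le> n"
    using indep_card_ann I Y by (auto simp: indep_in_def)
  have finB: "finite B" "B \<inter> Y = {}"
    using B(1) fin finite_subset by auto
  have "q ^ (n - card Y) \<le> q ^ (n - card I) * q ^ card B"
    unfolding ci(3)[symmetric] B(3)[symmetric] ci(1)[symmetric] B(2)
    by (intro mult_right_mono card_mono) (auto intro: finite_subset[OF ann_subset_vecs])
  then have "n - card Y \<le> n - card I + card B"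
    using q_ge_2 by (simp add: power_increasing_iff flip: power_add)
  then have "card I - card Y \<le> card B"
    using ci by linarith
  then obtain S where S: "S \<subseteq> B" "card S = card I - card Y"
    using obtain_subset_with_card_n by metis
  have "card (ann (B \<union> Y) Z) * q ^ card (B \<union> Y) = q ^ n"
    using B(3) Y finB fin(2) by (simp add: ann_Un Int_commute card_Un_disjoint power_add indep_in_def indep_def flip: mult.assoc)
  then have "indep (S \<union> Y) Z"
    using S B(1) finB fin v by (intro indep_subset[of "B \<union> Y" Z "S \<union> Y"]) (auto simp: indep_def)
  moreover have "W \<subseteq> ann (S \<union> Y) Z"
    using I Y S(1) B(1) by (auto simp: indep_in_def ann_Un ann_def)
  ultimately show ?thesis
    using S B(1) by (intro exI[of _ S]) (auto simp: indep_in_def)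
qed

text \<open>
  The exchange argument of Kahn, Komlos and Szemeredi: \<open>r\<close> of the rows are traded for independent
  copies of a vector that is much more likely to be orthogonal to \<open>W\<close>.
\<close>

lemma prob_indep_in_le:
  fixes \<xi> :: "nat \<Rightarrow> (nat \<Rightarrow> 'a) pmf" and \<nu> :: "(nat \<Rightarrow> 'a) pmf"
  defines "p \<equiv> \<lambda>m i. if i < m then \<xi> i else \<nu>"
  assumes W: "W \<subseteq> vecs" and \<xi>: "\<And>i. i < m \<Longrightarrow> set_pmf (\<xi> i) \<subseteq> vecs" and \<nu>: "set_pmf \<nu> \<subseteq> vecs"
    and r: "r \<le> m" "m \<le> n" and pos: "0 < perp \<nu> W" and g: "0 \<le> g"
    and dom: "\<And>i. i < m \<Longrightarrow> perp (\<xi> i) W \<le> g * perp \<nu> W"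
    and \<theta>: "\<And>U d. subsp U \<Longrightarrow> card U = q ^ d \<Longrightarrow> n < d + r \<Longrightarrow> perp \<nu> U \<le> \<theta>"
    and \<theta>_le: "2 * real r * \<theta> \<le> perp \<nu> W" "0 \<le> \<theta>" "\<theta> \<le> perp \<nu> W"
  shows "measure_pmf.prob (Pi_pmf {..<m + r} zvec (p m)) {Z. indep_in {..<m} W Z} \<le>
    2 * g ^ r * (\<Sum>S | S \<subseteq> {..<m} \<and> card S = m - r.
      measure_pmf.prob (Pi_pmf {..<m + r} zvec (p m)) {Z. indep_in (S \<union> {m..<m+r}) W Z})"
proof -
  let ?C = "{..<m + r}" and ?Y = "{m..<m+r}" and ?\<pi> = "perp \<nu> W"
  let ?P = "Pi_pmf ?C zvec (p m)"
  let ?Ss = "{S. S \<subseteq> {..<m} \<and> card S = m - r}"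
  have finS: "finite ?Ss"
    by (rule finite_subset[of _ "Pow {..<m}"]) auto
  have Zv: "Z i \<in> vecs" if "Z \<in> set_pmf ?P" "i < m + r" for Z i
    using set_Pi_pmf_nth[OF _ that(1), of i] that(2) \<xi>[of i] \<nu> by (auto simp: p_def split: if_splits)
  have "measure_pmf.prob ?P {Z. indep_in ?Y W Z} = measure_pmf.prob (Pi_pmf ?Y zvec (p m)) {Z. indep_in ?Y W Z}"
    by (rule prob_Pi_pmf_mono_set; (rule indep_in_cong)?; fastforce)
  moreover have "(?\<pi> - \<theta>) ^ card ?Y \<le> measure_pmf.prob (Pi_pmf ?Y zvec (p m)) {Z. indep_in ?Y W Z}"
    by (rule prob_indep_in_ge[where r = r]) (use W \<nu> \<theta> \<theta>_le r in \<open>auto simp: p_def\<close>)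
  \<comment> \<open>Bernoulli's inequality: since \<open>2 * r * \<theta>\<close> is at most
    \<open>perp \<nu> W\<close>, possible dependences among the \<open>r\<close> copies cost no more
    than a factor \<open>2\<close> altogether.\<close>
  moreover have "?\<pi> ^ r / 2 \<le> (?\<pi> - \<theta>) ^ r"
  proof -
    have "1 - real r * (\<theta> / ?\<pi>) \<le> (1 - \<theta> / ?\<pi>) ^ r"
      using Bernoulli_inequality[of "- (\<theta> / ?\<pi>)" r] \<theta>_le pos by simp
    moreover have "real r * (\<theta> / ?\<pi>) \<le> 1 / 2"
      using \<theta>_le pos by (simp add: field_simps)
    ultimately have "1 / 2 \<le> (1 - \<theta> / ?\<pi>) ^ r"
      by linarith
    then have "?\<pi> ^ r * (1 / 2) \<le> ?\<pi> ^ r * (1 - \<theta> / ?\<pi>) ^ r"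
      using pos by (intro mult_left_mono) auto
    also have "\<dots> = (?\<pi> - \<theta>) ^ r"
      using pos by (simp add: right_diff_distrib flip: power_mult_distrib)
    finally show ?thesis
      by simp
  qed
  ultimately have Y: "?\<pi> ^ r / 2 \<le> measure_pmf.prob ?P {Z. indep_in ?Y W Z}"
    by simp
  \<comment> \<open>The \<open>r\<close> rows outside \<open>S\<close> are independent of the kept
    rows and of the copies; only their orthogonality to \<open>W\<close> is retained.\<close>
  have S: "measure_pmf.prob ?P {Z. indep_in (S \<union> ?Y) W Z \<and> (\<forall>i\<in>{..<m} - S. \<forall>w\<in>W. dot w (Z i) = \<zero>)}
      \<le> measure_pmf.prob ?P {Z. indep_in (S \<union> ?Y) W Z} * (g ^ r * ?\<pi> ^ r)" if S: "S \<in> ?Ss" for S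
  proof -
    have "measure_pmf.prob ?P {Z. indep_in (S \<union> ?Y) W Z \<and> (\<forall>i\<in>{..<m} - S. \<forall>w\<in>W. dot w (Z i) = \<zero>)} =
        measure_pmf.prob ?P {Z. indep_in (S \<union> ?Y) W Z} *
        measure_pmf.prob ?P {Z. \<forall>i\<in>{..<m} - S. \<forall>w\<in>W. dot w (Z i) = \<zero>}"
      by (rule prob_Pi_pmf_indep[where A = "S \<union> ?Y" and B = "{..<m} - S"]; (rule indep_in_cong)?; use S in fastforce)
    also have "measure_pmf.prob ?P {Z. \<forall>i\<in>{..<m} - S. \<forall>w\<in>W. dot w (Z i) = \<zero>} = (\<Prod>i\<in>{..<m} - S. perp (p m i) W)"
      unfolding perp_def by (rule prob_Pi_pmf_all) auto
    also have "\<dots> \<le> (\<Prod>i\<in>{..<m} - S. g * ?\<pi>)"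
      by (rule prod_mono) (auto simp: p_def dom)
    also have "\<dots> = g ^ r * ?\<pi> ^ r"
      using S r by (simp add: card_Diff_subset finite_subset[of S "{..<m}"] power_mult_distrib)
    finally show ?thesis
      by (simp add: mult_left_mono)
  qed
  \<comment> \<open>Both ends carry the \<open>r\<close>-th power of \<open>perp \<nu> W\<close>, on
    the left from the copies being orthogonal to \<open>W\<close>, on the right from the domination
    of the discarded rows. It cancels and leaves \<open>2 * g ^ r\<close>.\<close>
  have "measure_pmf.prob ?P {Z. indep_in {..<m} W Z} * (?\<pi> ^ r / 2) \<le>
      measure_pmf.prob ?P {Z. indep_in {..<m} W Z} * measure_pmf.prob ?P {Z. indep_in ?Y W Z}"
    by (rule mult_left_mono[OF Y]) simp
  also have "\<dots> = measure_pmf.prob ?P {Z. indep_in {..<m} W Z \<and> indep_in ?Y W Z}"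
    by (rule prob_Pi_pmf_indep[symmetric, where A = "{..<m}" and B = ?Y]; (rule indep_in_cong)?; fastforce)
  also have "\<dots> \<le> (\<Sum>S\<in>?Ss. measure_pmf.prob ?P
      {Z. indep_in (S \<union> ?Y) W Z \<and> (\<forall>i\<in>{..<m} - S. \<forall>w\<in>W. dot w (Z i) = \<zero>)})"
  proof (rule prob_subset_sum[OF finS])
    fix Z assume Z: "Z \<in> set_pmf ?P" "indep_in {..<m} W Z \<and> indep_in ?Y W Z"
    have "\<exists>S\<subseteq>{..<m}. card S = card {..<m} - card ?Y \<and> indep_in (S \<union> ?Y) W Z"
      by (rule exchange) (use Z Zv r in auto)
    moreover have "\<forall>i\<in>{..<m}. \<forall>w\<in>W. dot w (Z i) = \<zero>"
      using Z(2) by (auto simp: indep_in_def ann_def)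
    ultimately show "\<exists>S\<in>?Ss. indep_in (S \<union> ?Y) W Z \<and> (\<forall>i\<in>{..<m} - S. \<forall>w\<in>W. dot w (Z i) = \<zero>)"
      by auto
  qed
  also have "\<dots> \<le> (\<Sum>S\<in>?Ss. measure_pmf.prob ?P {Z. indep_in (S \<union> ?Y) W Z} * (g ^ r * ?\<pi> ^ r))"
    by (rule sum_mono[OF S])
  also have "\<dots> = (2 * g ^ r * (\<Sum>S\<in>?Ss. measure_pmf.prob ?P {Z. indep_in (S \<union> ?Y) W Z})) * (?\<pi> ^ r / 2)"
    by (simp flip: sum_distrib_right)
  finally show ?thesis
    using pos by (simp only: mult_le_cancel_right) auto
qed

text \<open>For a fixed \<open>S\<close> the sum over \<open>W \<in> V\<close> is the expected
  number of members of \<open>V\<close> inside the annihilator of \<open>m\<close> independent rows.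
  The price is therefore the number \<open>N\<close> of candidates in one subspace of dimension
  \<open>n - m\<close> instead of the size of \<open>V\<close>; the factor \<open>2 ^ m\<close>
  counts the sets \<open>S\<close>.\<close>

lemma prob_exists_indep_in_le:
  fixes \<xi> :: "nat \<Rightarrow> (nat \<Rightarrow> 'a) pmf" and \<nu> :: "(nat \<Rightarrow> 'a) pmf"
  assumes V: "finite V" "\<And>W. W \<in> V \<Longrightarrow> W \<subseteq> vecs"
    and \<xi>: "\<And>i. i < m \<Longrightarrow> set_pmf (\<xi> i) \<subseteq> vecs" and \<nu>: "set_pmf \<nu> \<subseteq> vecs"
    and r: "r \<le> m" "m \<le> n" and g: "0 \<le> g"
    and pos: "\<And>W. W \<in> V \<Longrightarrow> 0 < perp \<nu> W"
    and dom: "\<And>W i. W \<in> V \<Longrightarrow> i < m \<Longrightarrow> perp (\<xi> i) W \<le> g * perp \<nu> W"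
    and \<theta>: "\<And>U d. subsp U \<Longrightarrow> card U = q ^ d \<Longrightarrow> n < d + r \<Longrightarrow> perp \<nu> U \<le> \<theta>" "0 \<le> \<theta>"
    and \<theta>_le: "\<And>W. W \<in> V \<Longrightarrow> 2 * real r * \<theta> \<le> perp \<nu> W" "\<And>W. W \<in> V \<Longrightarrow> \<theta> \<le> perp \<nu> W"
    and N: "\<And>U. subsp U \<Longrightarrow> card U = q ^ (n - m) \<Longrightarrow> card {W\<in>V. W \<subseteq> U} \<le> N"
  shows "measure_pmf.prob (Pi_pmf {..<m} zvec \<xi>) {Z. \<exists>W\<in>V. indep_in {..<m} W Z} \<le> 2 * g ^ r * 2 ^ m * real N"
proof -
  define p where "p = (\<lambda>i. if i < m then \<xi> i else \<nu>)"
  let ?P = "Pi_pmf {..<m + r} zvec p" and ?Y = "{m..<m+r}"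
  let ?Ss = "{S. S \<subseteq> {..<m} \<and> card S = m - r}"
  have finS: "finite ?Ss"
    by (rule finite_subset[of _ "Pow {..<m}"]) auto
  have Zv: "Z i \<in> vecs" if "Z \<in> set_pmf ?P" "i < m + r" for Z i
    using set_Pi_pmf_nth[OF _ that(1), of i] that(2) \<xi>[of i] \<nu> by (auto simp: p_def split: if_splits)
  have eq: "measure_pmf.prob (Pi_pmf {..<m} zvec \<xi>) {Z. indep_in {..<m} W Z} =
      measure_pmf.prob ?P {Z. indep_in {..<m} W Z}" for W
  proof -
    have "Pi_pmf {..<m} zvec \<xi> = Pi_pmf {..<m} zvec p"
      by (rule Pi_pmf_cong) (auto simp: p_def)
    also have "measure_pmf.prob \<dots> {Z. indep_in {..<m} W Z} = measure_pmf.prob ?P {Z. indep_in {..<m} W Z}"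
      by (rule prob_Pi_pmf_mono_set[symmetric]; (rule indep_in_cong)?; fastforce)
    finally show ?thesis .
  qed
  have "measure_pmf.prob (Pi_pmf {..<m} zvec \<xi>) {Z. \<exists>W\<in>V. indep_in {..<m} W Z} \<le>
      (\<Sum>W\<in>V. measure_pmf.prob (Pi_pmf {..<m} zvec \<xi>) {Z. indep_in {..<m} W Z})"
    by (rule prob_subset_sum[OF V(1)]) auto
  also have "\<dots> \<le> (\<Sum>W\<in>V. 2 * g ^ r * (\<Sum>S\<in>?Ss. measure_pmf.prob ?P {Z. indep_in (S \<union> ?Y) W Z}))"
    unfolding eq p_def
    by (intro sum_mono prob_indep_in_le[where \<theta> = \<theta>]) (use V \<xi> \<nu> r g pos dom \<theta> \<theta>_le in auto)
  also have "\<dots> = 2 * g ^ r * (\<Sum>S\<in>?Ss. \<Sum>W\<in>V. measure_pmf.prob ?P {Z. indep_in (S \<union> ?Y) W Z})"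
    by (subst sum.swap) (simp add: sum_distrib_left)
  also have "\<dots> \<le> 2 * g ^ r * (\<Sum>S\<in>?Ss. real N)"
  proof (intro mult_left_mono sum_mono sum_prob_le_card[OF V(1)])
    fix S Z assume S: "S \<in> ?Ss" and Z: "Z \<in> set_pmf ?P"
    show "card {W\<in>V. indep_in (S \<union> ?Y) W Z} \<le> N"
    proof (cases "indep (S \<union> ?Y) Z")
      case True
      have "card (S \<union> ?Y) = m"
        using S r by (subst card_Un_disjoint) (auto intro: finite_subset[of S "{..<m}"])
      then have "card (ann (S \<union> ?Y) Z) = q ^ (n - m)"
        using indep_card_ann[OF True] by simp
      moreover have "subsp (ann (S \<union> ?Y) Z)"
        using S Zv[OF Z] by (intro subsp_ann') auto
      ultimately show ?thesis
        using N True by (simp add: indep_in_def)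
    qed (simp add: indep_in_def)
  qed (use g in auto)
  also have "\<dots> \<le> 2 * g ^ r * (2 ^ m * real N)"
  proof -
    have "card ?Ss \<le> card (Pow {..<m})"
      by (rule card_mono) auto
    then have "real (card ?Ss) \<le> 2 ^ m"
      by (simp add: card_Pow)
    then show ?thesis
      using g by (auto intro!: mult_left_mono mult_right_mono)
  qed
  finally show ?thesis
    by (simp add: mult_ac)
qed

end

section \<open>Sparse normal vectors\<close>

definition small_subsets :: "nat \<Rightarrow> nat \<Rightarrow> nat set set" where
  "small_subsets N D = {T. T \<subseteq> {..<N} \<and> card T \<le> D}"

lemma finite_small_subsets [simp]: "finite (small_subsets N D)"
  by (rule finite_subset[of _ "Pow {..<N}"]) (auto simp: small_subsets_def)

text \<open>Generating function bound: in the expansion of \<open>(1 + x) ^ N\<close> every set of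
  size at most \<open>D\<close> has weight at least \<open>x ^ D\<close>.\<close>

lemma card_small_subsets_le:
  fixes x :: real
  assumes "0 < x" "x \<le> 1"
  shows "real (card (small_subsets N D)) * x ^ D \<le> (1 + x) ^ N"
proof -
  have "real (card (small_subsets N D)) * x ^ D = (\<Sum>T\<in>small_subsets N D. x ^ D)"
    by simp
  also have "\<dots> \<le> (\<Sum>T\<in>small_subsets N D. x ^ card T)"
    using assms by (intro sum_mono power_decreasing) (auto simp: small_subsets_def)
  also have "\<dots> \<le> (\<Sum>T\<in>Pow {..<N}. x ^ card T)"
    using assms by (intro sum_mono2) (auto simp: small_subsets_def)
  also have "\<dots> = (1 + x) ^ N"
  proof -
    have "(\<Prod>i<N. x + 1) = (\<Sum>T\<in>Pow {..<N}. (\<Prod>i\<in>T. x) * (\<Prod>i\<in>{..<N} - T. 1))"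
      by (rule prod_add) simp
    then show ?thesis
      by (simp add: add.commute)
  qed
  finally show ?thesis .
qed

section \<open>Random matrices with balanced entries\<close>

locale balanced_matrix = finite_field_character F n \<psi>
  for F :: "('a, 'm) ring_scheme" (structure) and n and \<psi> +
  fixes \<mu> :: "nat \<Rightarrow> nat \<Rightarrow> 'a pmf" and \<alpha> :: real
  assumes bal: "\<And>i j. i < n \<Longrightarrow> j < n \<Longrightarrow> balanced_on \<alpha> (\<mu> i j)"
    and alpha_pos: "\<alpha> > 0" and n_pos: "n > 0"
begin

definition row_law :: "nat \<Rightarrow> (nat \<Rightarrow> 'a) pmf" where
  "row_law i = row (\<mu> i)"
text \<open>Nine doublings give the factor \<open>2 ^ (- 9)\<close>; a main term of at most the same
  size still leaves \<open>2 ^ (- 8)\<close> per traded row. With \<open>n div 2\<close> rows traded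
  this outweighs the \<open>2 ^ m\<close> choices of the kept ones.\<close>

definition lazy_law :: "nat \<Rightarrow> (nat \<Rightarrow> 'a) pmf" where
  "lazy_law i = lazy_row (1 / (4 * 22 ^ 9)) (\<mu> i)"
text \<open>The additive error in the comparison with the lazy row for a subspace whose nonzero
  vectors have at least \<open>n / 64\<close> nonzero entries.\<close>

definition eps :: real where
  "eps = exp (- (\<alpha> * (n / 64)) / (2 * 22 ^ 9))"
definition spread :: "(nat \<Rightarrow> 'a) set \<Rightarrow> bool" where
  "spread W \<longleftrightarrow> (\<forall>w\<in>W. w \<noteq> zvec \<longrightarrow> real n / 64 \<le> real (card (supp w)))"
text \<open>The lazy row \<open>i\<close> can replace any row in the exchange argument. The lower
  bound \<open>eps\<close> keeps its probability large compared with the chance of dependences among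
  its copies.\<close>

definition dominated :: "nat \<Rightarrow> (nat \<Rightarrow> 'a) set \<Rightarrow> bool" where
  "dominated i W \<longleftrightarrow> i < n \<and> eps \<le> perp (lazy_law i) W \<and> (\<forall>i'<n. perp (row_law i') W \<le> (1/2) ^ 8 * perp (lazy_law i) W)"

lemma alpha_less_1: "\<alpha> < 1"
  using balanced_on_le_1[OF bal[OF n_pos n_pos]] .

lemma set_mu: "i < n \<Longrightarrow> j < n \<Longrightarrow> set_pmf (\<mu> i j) \<subseteq> carrier F"
  using bal by (simp add: balanced_on_def)

lemma set_row_law: "i < n \<Longrightarrow> set_pmf (row_law i) \<subseteq> vecs"
  unfolding row_law_def by (rule set_row) (rule set_mu)

lemma set_lazy_law: "i < n \<Longrightarrow> set_pmf (lazy_law i) \<subseteq> vecs"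
  unfolding lazy_law_def by (rule set_lazy_row) (rule set_mu)

lemma perp_row_law_le:
  assumes "subsp W" "card W = q ^ d" "i < n"
  shows "perp (row_law i) W \<le> (1 - \<alpha>) ^ d"
  unfolding row_law_def
  by (rule perp_row_le[OF assms(1,2) set_mu[OF assms(3)] pmf_balanced_le[OF bal[OF assms(3)]]])
     (use alpha_less_1 in auto)

lemma perp_lazy_law_le:
  assumes "subsp W" "card W = q ^ d" "i < n"
  shows "perp (lazy_law i) W \<le> (1 - 1 / (4 * 22 ^ 9) * \<alpha>) ^ d"
  unfolding lazy_law_def
  by (rule perp_lazy_row_le[OF assms(1,2) bal[OF assms(3)]]) (use alpha_less_1 alpha_pos in auto)

lemma perp_row_law_close:
  assumes "subsp W" "spread W" "i < n"
  shows "\<bar>perp (row_law i) W - 1 / card W\<bar> \<le> (1/2) ^ 9 * perp (lazy_law i) W + eps"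
  unfolding row_law_def lazy_law_def eps_def
  by (rule perp_row_close[OF assms(1) bal[OF assms(3)] alpha_pos])
     (use assms(2) n_pos in \<open>auto simp: spread_def\<close>)

lemma eps_pos: "eps > 0"
  by (simp add: eps_def)

text \<open>
  Some single lazy row dominates all rows because the rows need not be identically distributed: one
  takes the lazy row most likely to be orthogonal to \<open>W\<close>.
\<close>

lemma dominated_or_small:
  assumes W: "subsp W" "spread W"
  shows "(\<exists>i. dominated i W) \<or> (\<forall>i<n. perp (row_law i) W \<le> 2 * (1 / card W + eps))"
proof -
  let ?c = "1 / real (card W)"
  have c: "?c \<ge> 0"
    by simp
  have "\<exists>i\<in>{..<n}. \<forall>i'\<in>{..<n}. perp (lazy_law i') W \<le> perp (lazy_law i) W"
  proof -
    have "Max ((\<lambda>i. perp (lazy_law i) W) ` {..<n}) \<in> (\<lambda>i. perp (lazy_law i) W) ` {..<n}"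
      using n_pos by (intro Max_in) (auto simp: lessThan_empty_iff)
    then obtain i where "i < n" "perp (lazy_law i) W = Max ((\<lambda>i. perp (lazy_law i) W) ` {..<n})"
      by auto
    then show ?thesis
      by (intro bexI[of _ i]) auto
  qed
  then obtain i where i: "i < n" "\<And>i'. i' < n \<Longrightarrow> perp (lazy_law i') W \<le> perp (lazy_law i) W"
    by auto
  have le: "perp (row_law i') W \<le> ?c + (1/2) ^ 9 * perp (lazy_law i) W + eps" if "i' < n" for i'
  proof -
    have "(1/2) ^ 9 * perp (lazy_law i') W \<le> (1/2) ^ 9 * perp (lazy_law i) W"
      by (intro mult_left_mono i(2) that) simp
    then show ?thesis
      using perp_row_law_close[OF W that] by linarith
  qed
  show ?thesis
  \<comment> \<open>Either the lazy term outweighs the main term and \<open>eps\<close> together, so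
    that every row is dominated, or it is absorbed by them at the cost of a factor
    \<open>2\<close>.\<close>
  proof (cases "2 ^ 9 * (?c + eps) \<le> perp (lazy_law i) W")
    case True
    then have 1: "?c + eps \<le> (1/2) ^ 9 * perp (lazy_law i) W"
      by (simp add: field_simps)
    have "perp (row_law i') W \<le> (1/2) ^ 8 * perp (lazy_law i) W" if "i' < n" for i'
    proof -
      have "perp (row_law i') W \<le> (1/2) ^ 9 * perp (lazy_law i) W + (1/2) ^ 9 * perp (lazy_law i) W"
        using le[OF that] 1 by linarith
      then show ?thesis
        by (simp add: power_divide)
    qed
    moreover have "eps \<le> perp (lazy_law i) W"
    proof -
      have "eps \<le> (1/2) ^ 9 * perp (lazy_law i) W"
        using 1 c by linarith
      also have "\<dots> \<le> 1 * perp (lazy_law i) W"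
        by (intro mult_right_mono power_le_one) auto
      finally show ?thesis
        by simp
    qed
    ultimately show ?thesis
      using i(1) by (auto simp: dominated_def)
  next
    case False
    then have 1: "(1/2) ^ 9 * perp (lazy_law i) W \<le> ?c + eps"
      by (simp add: field_simps)
    have "perp (row_law i') W \<le> 2 * (?c + eps)" if "i' < n" for i'
    proof -
      have "perp (row_law i') W \<le> (?c + eps) + (?c + eps)"
        using le[OF that] 1 by linarith
      then show ?thesis
        by simp
    qed
    then show ?thesis
      by blast
  qed
qed

text \<open>A union bound over the dominating index costs the factor \<open>n\<close>; for each
  index \<open>n div 2\<close> rows are traded. By Odlyzko's bound for the lazy row,
  \<open>large\<close> keeps \<open>n\<close> times the chance of a dependence below
  \<open>eps\<close>.\<close>

lemma prob_exists_dominated_le: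
  assumes V: "finite V" "\<And>W. W \<in> V \<Longrightarrow> W \<subseteq> vecs" "\<And>W. W \<in> V \<Longrightarrow> \<exists>i. dominated i W"
    and m: "n div 2 \<le> m" "m \<le> n"
    and N: "\<And>U. subsp U \<Longrightarrow> card U = q ^ (n - m) \<Longrightarrow> card {W\<in>V. W \<subseteq> U} \<le> N"
    and large: "real n * (1 - 1 / (4 * 22 ^ 9) * \<alpha>) ^ (n - n div 2) \<le> eps"
  shows "measure_pmf.prob (Pi_pmf {..<m} zvec row_law) {Z. \<exists>W\<in>V. indep_in {..<m} W Z} \<le>
    real n * (2 * ((1/2) ^ 8) ^ (n div 2) * 2 ^ m * real N)"
proof -
  let ?P = "Pi_pmf {..<m} zvec row_law" and ?b = "1 / (4 * 22 ^ 9) * \<alpha>"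
  let ?\<theta> = "(1 - ?b) ^ (n - n div 2)"
  have b: "0 \<le> 1 - ?b" "1 - ?b \<le> 1"
    using alpha_less_1 alpha_pos by auto
  have le: "measure_pmf.prob ?P {Z. \<exists>W\<in>{W\<in>V. dominated i W}. indep_in {..<m} W Z} \<le>
      2 * ((1/2) ^ 8) ^ (n div 2) * 2 ^ m * real N" if i: "i < n" for i
  proof (rule prob_exists_indep_in_le)
    show "set_pmf (lazy_law i) \<subseteq> vecs"
      by (rule set_lazy_law[OF i])
    show "set_pmf (row_law i') \<subseteq> vecs" if "i' < m" for i'
      using that m by (intro set_row_law) simp
    show "0 < perp (lazy_law i) W" if "W \<in> {W\<in>V. dominated i W}" for W
      using that eps_pos by (auto simp: dominated_def)
    show "perp (row_law i') W \<le> (1/2) ^ 8 * perp (lazy_law i) W" if "W \<in> {W\<in>V. dominated i W}" "i' < m" for W i'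
      using that m by (auto simp: dominated_def)
    show "perp (lazy_law i) U \<le> ?\<theta>" if "subsp U" "card U = q ^ d" "n < d + n div 2" for U d
    proof -
      have "perp (lazy_law i) U \<le> (1 - ?b) ^ d"
        by (rule perp_lazy_law_le[OF that(1,2) i])
      also have "\<dots> \<le> ?\<theta>"
        using that(3) b by (intro power_decreasing) auto
      finally show ?thesis .
    qed
    show t: "0 \<le> ?\<theta>"
      using b by simp
    fix W assume W: "W \<in> {W\<in>V. dominated i W}"
    then have p: "eps \<le> perp (lazy_law i) W"
      by (auto simp: dominated_def)
    have "2 * real (n div 2) * ?\<theta> \<le> real n * ?\<theta>"
      using t by (intro mult_right_mono) auto
    then show "2 * real (n div 2) * ?\<theta> \<le> perp (lazy_law i) W"
      using large p by linarith
    have "1 * ?\<theta> \<le> real n * ?\<theta>"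
      using t n_pos by (intro mult_right_mono) auto
    then show "?\<theta> \<le> perp (lazy_law i) W"
      using large p by linarith
  next
    fix U assume U: "subsp U" "card U = q ^ (n - m)"
    have "card {W \<in> {W\<in>V. dominated i W}. W \<subseteq> U} \<le> card {W\<in>V. W \<subseteq> U}"
      using V(1) by (intro card_mono) auto
    then show "card {W \<in> {W\<in>V. dominated i W}. W \<subseteq> U} \<le> N"
      using N[OF U] by simp
  qed (use V m in auto)
  have "measure_pmf.prob ?P {Z. \<exists>W\<in>V. indep_in {..<m} W Z} \<le>
      (\<Sum>i<n. measure_pmf.prob ?P {Z. \<exists>W\<in>{W\<in>V. dominated i W}. indep_in {..<m} W Z})"
  proof (rule prob_subset_sum)
    fix Z assume "\<exists>W\<in>V. indep_in {..<m} W Z"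
    then obtain W where W: "W \<in> V" "indep_in {..<m} W Z"
      by blast
    then obtain i where "dominated i W"
      using V(3) by blast
    then show "\<exists>i\<in>{..<n}. \<exists>W\<in>{W\<in>V. dominated i W}. indep_in {..<m} W Z"
      using W by (intro bexI[of _ i]) (auto simp: dominated_def)
  qed simp
  also have "\<dots> \<le> (\<Sum>i<n. 2 * ((1/2) ^ 8) ^ (n div 2) * 2 ^ m * real N)"
    by (intro sum_mono le) simp
  finally show ?thesis
    by simp
qed

section \<open>Normal vectors of prescribed small support\<close>

definition pick :: "nat set \<Rightarrow> nat set \<Rightarrow> (nat \<Rightarrow> nat \<Rightarrow> 'a) \<Rightarrow> nat \<Rightarrow> 'a" where
  "pick S I Z = (SOME w. w \<in> ann I Z \<and> supp w = S)"

lemma pick_cong: "(\<And>i. i \<in> I \<Longrightarrow> Z i = Z' i) \<Longrightarrow> pick S I Z = pick S I Z'"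
  unfolding pick_def using ann_cong[of I Z Z'] by simp

lemma pick_ann: "w \<in> ann I Z \<Longrightarrow> supp w = S \<Longrightarrow> pick S I Z \<in> ann I Z \<and> supp (pick S I Z) = S"
  unfolding pick_def using someI[of "\<lambda>w. w \<in> ann I Z \<and> supp w = S" w] by simp

text \<open>\<open>pick S I Z\<close> is determined by the rows in \<open>I\<close>. It is thus a
  fixed vector while the rows in \<open>D\<close> are exposed, and each of these is orthogonal to it
  with conditional probability at most \<open>P\<close>.\<close>

lemma prob_pick_le:
  assumes fin: "finite D" "finite I" "I \<inter> D = {}" and P: "0 \<le> P"
    and perp: "\<And>i w. i \<in> D \<Longrightarrow> w \<in> vecs \<Longrightarrow> supp w = S \<Longrightarrow> perp (row_law i) {w} \<le> P"
  shows "measure_pmf.prob (Pi_pmf (I \<union> D) zvec row_law)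
    {Z. (\<exists>w\<in>ann I Z. supp w = S) \<and> (\<forall>i\<in>D. dot (pick S I Z) (Z i) = \<zero>)} \<le> P ^ card D"
  using fin(1,3) perp
proof (induction D rule: finite_induct)
  case (insert i D)
  let ?Q = "\<lambda>D Z. (\<exists>w\<in>ann I Z. supp w = S) \<and> (\<forall>i\<in>D. dot (pick S I Z) (Z i) = \<zero>)"
  have eq: "ann I (f(i := x)) = ann I f" "pick S I (f(i := x)) = pick S I f" for f x
    using insert.prems(1) by (auto intro!: ann_cong pick_cong)
  have "measure_pmf.prob (Pi_pmf (insert i (I \<union> D)) zvec row_law) {Z. ?Q (insert i D) Z} \<le>
      P * measure_pmf.prob (Pi_pmf (I \<union> D) zvec row_law) {Z. ?Q D Z}"
  proof (rule prob_Pi_pmf_insert_le[OF _ _ P])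
    fix f x assume "?Q (insert i D) (f(i := x))"
    then show "?Q D f"
      using insert.hyps by (auto simp: eq split: if_splits)
  next
    fix f assume f: "?Q D f"
    have "measure_pmf.prob (row_law i) {x. ?Q (insert i D) (f(i := x))} \<le> perp (row_law i) {pick S I f}"
      unfolding perp_def by (intro measure_pmf.finite_measure_mono) (auto simp: eq)
    also have "\<dots> \<le> P"
      using f pick_ann by (intro insert.prems(2)) (auto simp: ann_def)
    finally show "measure_pmf.prob (row_law i) {x. ?Q (insert i D) (f(i := x))} \<le> P" .
  qed (use insert fin in auto)
  also have "\<dots> \<le> P * P ^ card D"
    by (intro mult_left_mono insert.IH P) (use insert.prems in auto)
  finally show ?case
    using insert.hyps by simp
qed simp

lemma card_supp_subset:
  assumes "S \<subseteq> {..<n}"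
  shows "subsp {w\<in>vecs. supp w \<subseteq> S}" "card {w\<in>vecs. supp w \<subseteq> S} = q ^ card S"
proof -
  show "subsp {w\<in>vecs. supp w \<subseteq> S}"
    unfolding subsp_def
  proof (intro conjI ballI)
    show "zvec \<in> {w\<in>vecs. supp w \<subseteq> S}"
      by (auto simp: supp_def zvec_def vecs_iff)
    show "vadd v w \<in> {w\<in>vecs. supp w \<subseteq> S}" if "v \<in> {w\<in>vecs. supp w \<subseteq> S}" "w \<in> {w\<in>vecs. supp w \<subseteq> S}" for v w
    proof -
      have "supp (vadd v w) \<subseteq> supp v \<union> supp w"
        by (auto simp: supp_def vadd_def)
      then show ?thesis
        using that by auto
    qed
    show "smul t w \<in> {w\<in>vecs. supp w \<subseteq> S}" if "t \<in> carrier F" "w \<in> {w\<in>vecs. supp w \<subseteq> S}" for t w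
    proof -
      have "supp (smul t w) \<subseteq> supp w"
        using that by (auto simp: supp_def smul_def)
      then show ?thesis
        using that by auto
    qed
  qed auto
  have fin: "finite S"
    using assms finite_subset by blast
  have "{w\<in>vecs. supp w \<subseteq> S} = PiE_dflt S \<zero> (\<lambda>_. carrier F)"
  proof (intro equalityI subsetI)
    fix w assume w: "w \<in> {w\<in>vecs. supp w \<subseteq> S}"
    then have "w j = \<zero>" if "j \<notin> S" for j
      using that by (cases "j < n") (auto simp: supp_def vecs_iff)
    then show "w \<in> PiE_dflt S \<zero> (\<lambda>_. carrier F)"
      using w by (auto simp: PiE_dflt_def)
  next
    fix w assume w: "w \<in> PiE_dflt S \<zero> (\<lambda>_. carrier F)"
    then have "w j \<in> carrier F" for j
      by (cases "j \<in> S") (auto simp: PiE_dflt_def)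
    moreover have "w j = \<zero>" if "j \<ge> n" for j
      using w that assms by (auto simp: PiE_dflt_def)
    ultimately show "w \<in> {w\<in>vecs. supp w \<subseteq> S}"
      using w by (auto simp: vecs_iff supp_def PiE_dflt_def)
  qed
  then show "card {w\<in>vecs. supp w \<subseteq> S} = q ^ card S"
    using fin by (simp add: card_PiE_dflt)
qed

lemma line_subset: "subsp W \<Longrightarrow> w \<in> W \<Longrightarrow> line w \<subseteq> W"
  using subspD(4) by (auto simp: line_def)

text \<open>
  A vector with support \<open>S\<close> orthogonal to all rows is orthogonal to all rows as soon as it is
  orthogonal to some \<open>card S - 1\<close> of them that span the row space restricted to \<open>S\<close>.
\<close>

lemma prob_exists_supp_eq_le:
  assumes S: "S \<subseteq> {..<n}" "S \<noteq> {}" "card S \<le> D" and m: "D \<le> m" "m \<le> n" and P: "0 \<le> P" "P \<le> 1"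
    and perp: "\<And>i w. i < n \<Longrightarrow> w \<in> vecs \<Longrightarrow> supp w = S \<Longrightarrow> perp (row_law i) {w} \<le> P"
  shows "measure_pmf.prob (Pi_pmf {..<m} zvec row_law) {Z. \<exists>w\<in>ann {..<m} Z. supp w = S} \<le>
    real (card (small_subsets m D)) * P ^ (m - D)"
proof -
  let ?P = "Pi_pmf {..<m} zvec row_law"
  let ?Q = "\<lambda>I Z. (\<exists>w\<in>ann I Z. supp w = S) \<and> (\<forall>i\<in>{..<m} - I. dot (pick S I Z) (Z i) = \<zero>)"
  let ?U = "{w\<in>vecs. supp w \<subseteq> S}"
  have U: "subsp ?U" "card ?U = q ^ card S"
    by (rule card_supp_subset[OF S(1)])+
  have "measure_pmf.prob ?P {Z. \<exists>w\<in>ann {..<m} Z. supp w = S} \<le> (\<Sum>I\<in>small_subsets m D. measure_pmf.prob ?P {Z. ?Q I Z})"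
  proof (rule prob_subset_sum)
    fix Z assume Z: "Z \<in> set_pmf ?P" "\<exists>w\<in>ann {..<m} Z. supp w = S"
    then obtain w where w: "w \<in> ann {..<m} Z" "supp w = S"
      by blast
    have Zv: "Z i \<in> vecs" if "i < m" for i
      using set_Pi_pmf_nth[OF _ Z(1), of i] that set_row_law[of i] m by auto
    obtain I where I: "I \<subseteq> {..<m}" "?U \<inter> ann I Z = ?U \<inter> ann {..<m} Z"
        "card (?U \<inter> ann I Z) * q ^ card I = card ?U"
      using exists_basis[OF U(1), of "{..<m}" Z] Zv by auto
    have wv: "w \<in> vecs" "w \<noteq> zvec"
      using w S by (auto simp: ann_def supp_def zvec_def)
    have "subsp (?U \<inter> ann I Z)"
      by (rule subsp_ann[OF U(1)]) (use I(1) Zv in auto)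
    moreover have "w \<in> ?U \<inter> ann I Z"
      using w wv(1) ann_antimono[OF I(1), of Z] by auto
    ultimately have "line w \<subseteq> ?U \<inter> ann I Z"
      by (rule line_subset)
    then have "q \<le> card (?U \<inter> ann I Z)"
      unfolding card_line[OF wv, symmetric] by (rule card_mono[rotated]) simp
    then have "q * q ^ card I \<le> q ^ card S"
      unfolding U(2)[symmetric] I(3)[symmetric] by (rule mult_right_mono) simp
    then have "q ^ Suc (card I) \<le> q ^ card S"
      by simp
    then have "Suc (card I) \<le> card S"
      using q_ge_2 by (subst (asm) power_increasing_iff) auto
    then have "I \<in> small_subsets m D"
      using I(1) S(3) by (simp add: small_subsets_def)
    moreover have "?Q I Z"
    proof
      have wI: "w \<in> ann I Z"
        using w(1) ann_antimono[OF I(1)] by auto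
      then show "\<exists>w\<in>ann I Z. supp w = S"
        using w(2) by blast
      \<comment> \<open>Inside \<open>?U\<close> the annihilators of \<open>I\<close> and of all
        \<open>m\<close> rows agree, which transfers orthogonality from the rows in \<open>I\<close>
        to the others.\<close>
      have "pick S I Z \<in> ?U \<inter> ann I Z"
        using pick_ann[OF wI w(2)] by (auto simp: ann_def)
      then have "pick S I Z \<in> ann {..<m} Z"
        unfolding I(2) by simp
      then show "\<forall>i\<in>{..<m} - I. dot (pick S I Z) (Z i) = \<zero>"
        by (auto simp: ann_def)
    qed
    ultimately show "\<exists>I\<in>small_subsets m D. ?Q I Z"
      by blast
  qed simp
  also have "\<dots> \<le> (\<Sum>I\<in>small_subsets m D. P ^ (m - D))"
  proof (rule sum_mono)
    fix I assume I: "I \<in> small_subsets m D"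
    then have I': "I \<subseteq> {..<m}" "finite I" "card I \<le> D"
      using finite_subset[of I "{..<m}"] by (auto simp: small_subsets_def)
    have "measure_pmf.prob (Pi_pmf (I \<union> ({..<m} - I)) zvec row_law) {Z. ?Q I Z} \<le> P ^ card ({..<m} - I)"
      by (rule prob_pick_le) (use I' P perp m in auto)
    also have "\<dots> \<le> P ^ (m - D)"
      using I' P by (intro power_decreasing) (auto simp: card_Diff_subset)
    finally show "measure_pmf.prob ?P {Z. ?Q I Z} \<le> P ^ (m - D)"
      using I'(1) by (simp add: Un_absorb1)
  qed
  finally show ?thesis
    by simp
qed

lemma perp_row_law_singleton_le:
  assumes "i < n" "w \<in> vecs" "w \<noteq> zvec"
  shows "perp (row_law i) {w} \<le> 1 - \<alpha>"
  using perp_row_law_le[OF subsp_line[OF assms(2)], of 1 i] card_line[OF assms(2,3)] assms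
    perp_singleton[OF set_row_law[OF assms(1)] assms(2)] by simp

lemma card_supp_line:
  assumes "w \<in> vecs" "v \<in> line w" "v \<noteq> zvec"
  shows "supp v = supp w"
proof -
  obtain t where t: "t \<in> carrier F" "v = smul t w"
    using assms(2) by (auto simp: line_def)
  then have "t \<noteq> \<zero>"
    using assms by auto
  then show ?thesis
    using t assms(1) supp_smul by simp
qed

text \<open>Four doublings suffice, with the trivial bound \<open>1\<close> for the lazy row:
  \<open>1 / 2 + 1 / 16 + 1 / 40\<close> is below \<open>3 / 5\<close>. Unlike
  \<open>1 - \<alpha>\<close> this is an absolute constant, available once the support has size of
  order \<open>1 / \<alpha>\<close>.\<close>

lemma perp_row_law_singleton_le':
  assumes i: "i < n" and w: "w \<in> vecs" "w \<noteq> zvec" and D: "0 < D" "D \<le> card (supp w)"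
    and large: "exp (- (\<alpha> * real D) / (2 * 22 ^ 4)) \<le> 1 / 40"
  shows "perp (row_law i) {w} \<le> 3 / 5"
proof -
  have "\<bar>perp (row (\<mu> i)) (line w) - 1 / card (line w)\<bar> \<le>
      (1/2) ^ 4 * perp (lazy_row (1 / (4 * 22 ^ 4)) (\<mu> i)) (line w) + exp (- (\<alpha> * real D) / (2 * 22 ^ 4))"
  proof (rule perp_row_close[OF subsp_line[OF w(1)] bal[OF i] alpha_pos])
    show "real D \<le> real (card (supp v))" if "v \<in> line w" "v \<noteq> zvec" for v
      using card_supp_line[OF w(1) that] D by simp
  qed (use D in auto)
  moreover have "(1/2) ^ 4 * perp (lazy_row (1 / (4 * 22 ^ 4)) (\<mu> i)) (line w) \<le> (1/2) ^ 4 * 1"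
    by (intro mult_left_mono) auto
  moreover have "1 / real (card (line w)) \<le> 1 / 2"
    using q_ge_2 card_line[OF w] by (intro frac_le) auto
  moreover have "(1/2) ^ 4 * (1::real) = 1 / 16"
    by (simp add: power_divide)
  ultimately have "perp (row (\<mu> i)) (line w) \<le> 3 / 5"
    using large by linarith
  then show ?thesis
    using perp_singleton[OF set_row_law[OF i] w(1)] by (simp add: row_law_def)
qed

text \<open>For very small supports only \<open>1 - \<alpha>\<close> per row is available, which
  pays for few supports; beyond size \<open>D1\<close> the absolute constant \<open>3 / 5\<close>
  pays for supports up to size \<open>D2\<close>.\<close>

lemma prob_sparse_le:
  assumes D: "0 < D1" "D1 \<le> D2" "D2 \<le> m" "m \<le> n"
    and large: "exp (- (\<alpha> * real D1) / (2 * 22 ^ 4)) \<le> 1 / 40"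
  shows "measure_pmf.prob (Pi_pmf {..<m} zvec row_law) {Z. \<exists>w\<in>ann {..<m} Z. w \<noteq> zvec \<and> card (supp w) \<le> D2} \<le>
    real (card (small_subsets n D1)) * (real (card (small_subsets m D1)) * (1 - \<alpha>) ^ (m - D1)) +
    real (card (small_subsets n D2)) * (real (card (small_subsets m D2)) * (3/5) ^ (m - D2))"
proof -
  let ?P = "Pi_pmf {..<m} zvec row_law"
  let ?Q = "\<lambda>S Z. \<exists>w\<in>ann {..<m} Z. supp w = S"
  let ?A = "small_subsets n D1 - {{}}" and ?B = "small_subsets n D2 - small_subsets n D1"
  have v: "supp w \<noteq> {} \<Longrightarrow> w \<noteq> zvec" for w
    by (auto simp: supp_def zvec_def)
  have "measure_pmf.prob ?P {Z. \<exists>w\<in>ann {..<m} Z. w \<noteq> zvec \<and> card (supp w) \<le> D2} \<le>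
      (\<Sum>S\<in>?A \<union> ?B. measure_pmf.prob ?P {Z. ?Q S Z})"
  proof (rule prob_subset_sum)
    fix Z assume "\<exists>w\<in>ann {..<m} Z. w \<noteq> zvec \<and> card (supp w) \<le> D2"
    then obtain w where w: "w \<in> ann {..<m} Z" "w \<noteq> zvec" "card (supp w) \<le> D2"
      by blast
    then have "supp w \<noteq> {}"
      using supp_eq_empty_iff[of w] by (auto simp: ann_def)
    moreover have "supp w \<subseteq> {..<n}"
      by (auto simp: supp_def)
    ultimately have "supp w \<in> ?A \<union> ?B"
      using w(3) by (auto simp: small_subsets_def)
    then show "\<exists>S\<in>?A \<union> ?B. ?Q S Z"
      using w(1) by blast
  qed simp
  also have "\<dots> = (\<Sum>S\<in>?A. measure_pmf.prob ?P {Z. ?Q S Z}) + (\<Sum>S\<in>?B. measure_pmf.prob ?P {Z. ?Q S Z})"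
    by (rule sum.union_disjoint) auto
  also have "(\<Sum>S\<in>?A. measure_pmf.prob ?P {Z. ?Q S Z}) \<le>
      (\<Sum>S\<in>?A. real (card (small_subsets m D1)) * (1 - \<alpha>) ^ (m - D1))"
  proof (rule sum_mono)
    fix S assume S: "S \<in> ?A"
    show "measure_pmf.prob ?P {Z. ?Q S Z} \<le> real (card (small_subsets m D1)) * (1 - \<alpha>) ^ (m - D1)"
      by (rule prob_exists_supp_eq_le)
         (use S D alpha_pos alpha_less_1 v in \<open>auto simp: small_subsets_def intro!: perp_row_law_singleton_le\<close>)
  qed
  also have "\<dots> \<le> real (card (small_subsets n D1)) * (real (card (small_subsets m D1)) * (1 - \<alpha>) ^ (m - D1))"
    using alpha_less_1 by (simp del: of_nat_mult, intro mult_right_mono mult_nonneg_nonneg)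
      (auto intro!: card_mono)
  also have "(\<Sum>S\<in>?B. measure_pmf.prob ?P {Z. ?Q S Z}) \<le>
      (\<Sum>S\<in>?B. real (card (small_subsets m D2)) * (3/5) ^ (m - D2))"
  proof (rule sum_mono)
    fix S assume S: "S \<in> ?B"
    then have S': "S \<subseteq> {..<n}" "card S \<le> D2" "D1 < card S"
      by (auto simp: small_subsets_def)
    have ne: "S \<noteq> {}"
      using S'(3) by auto
    show "measure_pmf.prob ?P {Z. ?Q S Z} \<le> real (card (small_subsets m D2)) * (3/5) ^ (m - D2)"
    proof (rule prob_exists_supp_eq_le)
      show "perp (row_law i) {w} \<le> 3/5" if "i < n" "w \<in> vecs" "supp w = S" for i w
        by (rule perp_row_law_singleton_le'[OF that(1,2) _ D(1) _ large]) (use that S' ne v[of w] in auto)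
    qed (use S' D in auto)
  qed
  also have "\<dots> \<le> real (card (small_subsets n D2)) * (real (card (small_subsets m D2)) * (3/5) ^ (m - D2))"
    by (simp del: of_nat_mult, intro mult_right_mono mult_nonneg_nonneg)
      (auto intro!: card_mono)
  finally show ?thesis
    by simp
qed

end

section \<open>Exposing the rows one by one\<close>

context balanced_matrix begin

definition indep_prob :: "nat \<Rightarrow> real" where
  "indep_prob k = measure_pmf.prob (Pi_pmf {..<k} zvec row_law) {Z. indep {..<k} Z}"
text \<open>Only states with independent rows count, since a further row cannot restore
  independence.\<close>

definition bad_prob :: "nat \<Rightarrow> real \<Rightarrow> real" where
  "bad_prob k \<tau> = measure_pmf.prob (Pi_pmf {..<k} zvec row_law)
     {Z. indep {..<k} Z \<and> \<tau> < \<bar>perp (row_law k) (ann {..<k} Z) - 1 / q ^ (n - k)\<bar>}"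
definition sparse_prob :: "nat \<Rightarrow> real" where
  "sparse_prob k = measure_pmf.prob (Pi_pmf {..<k} zvec row_law)
     {Z. \<exists>w\<in>ann {..<k} Z. w \<noteq> zvec \<and> card (supp w) \<le> n div 64}"

lemma Pi_row_law_vecs:
  assumes "Z \<in> set_pmf (Pi_pmf {..<k} zvec row_law)" "k \<le> n" "i < k"
  shows "Z i \<in> vecs"
  using set_Pi_pmf_nth[OF _ assms(1), of i] set_row_law[of i] assms by auto

lemma prob_indep_Suc:
  assumes k: "k < n" and Z: "Z \<in> set_pmf (Pi_pmf {..<k} zvec row_law)"
  shows "measure_pmf.prob (row_law k) {x. indep (insert k {..<k}) (Z(k := x))} =
    (1 - perp (row_law k) (ann {..<k} Z)) * of_bool (indep {..<k} Z)"
proof -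
  have Zv: "Z i \<in> vecs" if "i < k" for i
    using Pi_row_law_vecs[OF Z _ that] k by simp
  have eq: "ann {..<k} (Z(k := x)) = ann {..<k} Z" "indep {..<k} (Z(k := x)) = indep {..<k} Z" for x
    by (auto intro!: ann_cong indep_cong)
  have iff: "indep (insert k {..<k}) (Z(k := x)) \<longleftrightarrow> indep {..<k} Z \<and> (\<exists>w\<in>ann {..<k} Z. dot w x \<noteq> \<zero>)"
    if x: "x \<in> vecs" for x
  proof (cases "indep {..<k} Z")
    case True
    have "indep (insert k {..<k}) (Z(k := x)) \<longleftrightarrow> (\<exists>w\<in>ann {..<k} (Z(k := x)). dot w ((Z(k := x)) k) \<noteq> \<zero>)"
      by (rule indep_insert_iff) (use True eq Zv x in auto)
    then show ?thesis
      using True eq by simp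
  next
    case False
    have "indep {..<k} (Z(k := x))" if "indep (insert k {..<k}) (Z(k := x))"
      by (rule indep_subset[OF that]) (use Zv x in auto)
    then show ?thesis
      using False eq by auto
  qed
  show ?thesis
  proof (cases "indep {..<k} Z")
    case True
    have "measure_pmf.prob (row_law k) {x. indep (insert k {..<k}) (Z(k := x))} =
        measure_pmf.prob (row_law k) (UNIV - {x. \<forall>w\<in>ann {..<k} Z. dot w x = \<zero>})"
    proof (rule measure_prob_cong_0)
      fix x assume "x \<in> {x. indep (insert k {..<k}) (Z(k := x))} - (UNIV - {x. \<forall>w\<in>ann {..<k} Z. dot w x = \<zero>})"
      then show "pmf (row_law k) x = 0"
        using iff[of x] set_row_law[OF k] True by (auto simp: set_pmf_eq)
    next
      fix x assume "x \<in> UNIV - {x. \<forall>w\<in>ann {..<k} Z. dot w x = \<zero>} - {x. indep (insert k {..<k}) (Z(k := x))}"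
      then show "pmf (row_law k) x = 0"
        using iff[of x] set_row_law[OF k] True by (auto simp: set_pmf_eq)
    qed
    also have "\<dots> = 1 - perp (row_law k) (ann {..<k} Z)"
      unfolding perp_def using measure_pmf.prob_compl[of "{x. \<forall>w\<in>ann {..<k} Z. dot w x = \<zero>}" "row_law k"] by simp
    finally show ?thesis
      using True by simp
  next
    case False
    have "measure_pmf.prob (row_law k) {x. indep (insert k {..<k}) (Z(k := x))} = 0"
      unfolding measure_pmf_zero_iff using iff set_row_law[OF k] False by auto
    then show ?thesis
      using False by simp
  qed
qed

text \<open>After \<open>k\<close> independent rows the next one preserves independence with
  probability one minus \<open>perp\<close>. Replacing this by \<open>1 - 1 / q ^ (n - k)\<close>
  costs \<open>\<tau>\<close> off the bad event and at most \<open>1\<close> on it.\<close>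

lemma indep_prob_Suc:
  assumes k: "k < n" and \<tau>: "0 \<le> \<tau>"
  shows "\<bar>indep_prob (Suc k) - indep_prob k * (1 - 1 / q ^ (n - k))\<bar> \<le> \<tau> + bad_prob k \<tau>"
proof -
  let ?P = "Pi_pmf {..<k} zvec row_law" and ?c = "1 / q ^ (n - k)"
  let ?p = "\<lambda>Z. perp (row_law k) (ann {..<k} Z)"
  let ?I = "\<lambda>Z. of_bool (indep {..<k} Z) :: real"
  let ?B = "{Z. indep {..<k} Z \<and> \<tau> < \<bar>?p Z - ?c\<bar>}"
  have c: "0 \<le> ?c" "?c \<le> 1"
  proof -
    have "1 \<le> real q ^ (n - k)"
      using q_ge_2 by (intro one_le_power) simp
    then show "?c \<le> 1"
      by simp
  qed simp
  have int: "integrable (measure_pmf ?P) f" if "\<And>Z. \<bar>f Z\<bar> \<le> 2 + \<tau>" for f :: "_ \<Rightarrow> real"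
    by (rule measure_pmf.integrable_const_bound[where B = "2 + \<tau>"]) (use that in auto)
  have "indep_prob (Suc k) = E ?P (\<lambda>Z. measure_pmf.prob (row_law k) {x. indep (insert k {..<k}) (Z(k := x))})"
    unfolding indep_prob_def lessThan_Suc by (rule prob_Pi_pmf_insert) auto
  also have "\<dots> = E ?P (\<lambda>Z. (1 - ?p Z) * ?I Z)"
    by (rule Bochner_Integration.integral_cong_AE) (auto simp: AE_measure_pmf_iff prob_indep_Suc[OF k])
  finally have 1: "indep_prob (Suc k) = E ?P (\<lambda>Z. (1 - ?p Z) * ?I Z)" .
  have "indep_prob k = E ?P (indicator {Z. indep {..<k} Z})"
    by (simp add: indep_prob_def)
  also have "(indicator {Z. indep {..<k} Z} :: _ \<Rightarrow> real) = ?I"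
    by (auto simp: fun_eq_iff indicator_def)
  finally have 2: "indep_prob k = E ?P ?I" .
  let ?f = "\<lambda>Z. (1 - ?p Z) * ?I Z - ?I Z * (1 - ?c)"
  have diff: "indep_prob (Suc k) - indep_prob k * (1 - ?c) = E ?P ?f"
  proof -
    have "integrable (measure_pmf ?P) (\<lambda>Z. (1 - ?p Z) * ?I Z)"
    proof (rule int)
      show "\<bar>(1 - ?p Z) * ?I Z\<bar> \<le> 2 + \<tau>" for Z
      proof -
        have "\<bar>1 - ?p Z\<bar> \<le> 2 + \<tau>"
          using perp_nonneg[of "row_law k" "ann {..<k} Z"] perp_le_1[of "row_law k" "ann {..<k} Z"] \<tau> by linarith
        then show ?thesis
          using \<tau> by (cases "indep {..<k} Z") auto
      qed
    qed
    moreover have "integrable (measure_pmf ?P) (\<lambda>Z. ?I Z * (1 - ?c))"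
    proof (rule int)
      have "\<bar>1 - ?c\<bar> \<le> 2 + \<tau>"
        using c \<tau> by linarith
      then show "\<bar>?I Z * (1 - ?c)\<bar> \<le> 2 + \<tau>" for Z
        using \<tau> by (cases "indep {..<k} Z") auto
    qed
    ultimately have "E ?P (\<lambda>Z. (1 - ?p Z) * ?I Z - ?I Z * (1 - ?c)) =
        E ?P (\<lambda>Z. (1 - ?p Z) * ?I Z) - E ?P (\<lambda>Z. ?I Z * (1 - ?c))"
      by (rule Bochner_Integration.integral_diff)
    also have "E ?P (\<lambda>Z. ?I Z * (1 - ?c)) = E ?P ?I * (1 - ?c)"
      by (rule integral_mult_left_zero)
    finally show ?thesis
      unfolding 1 2 by (rule sym)
  qed
  have f_le: "E ?P (\<lambda>Z. \<bar>?f Z\<bar>) \<le> E ?P (\<lambda>Z. \<tau> + indicator ?B Z)"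
  proof (rule integral_mono_AE)
    have b: "\<bar>(1 - ?p Z) * ?I Z - ?I Z * (1 - ?c)\<bar> \<le> 1" for Z
    proof -
      have "\<bar>(1 - x) - (1 - y)\<bar> \<le> 1" if "0 \<le> x" "x \<le> 1" "0 \<le> y" "y \<le> 1" for x y :: real
        using that by linarith
      from this[OF perp_nonneg perp_le_1 c] have "\<bar>(1 - ?p Z) - (1 - ?c)\<bar> \<le> 1" .
      then show ?thesis
        by (cases "indep {..<k} Z") (simp_all only: of_bool_eq mult_1_right mult_1_left mult_zero_right mult_zero_left diff_zero abs_zero zero_le_one)
    qed
    show "integrable (measure_pmf ?P) (\<lambda>Z. \<bar>(1 - ?p Z) * ?I Z - ?I Z * (1 - ?c)\<bar>)"
    proof (rule int)
      show "\<bar>\<bar>(1 - ?p Z) * ?I Z - ?I Z * (1 - ?c)\<bar>\<bar> \<le> 2 + \<tau>" for Z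
        using b[of Z] \<tau> by linarith
    qed
    show "integrable (measure_pmf ?P) (\<lambda>Z. \<tau> + indicator ?B Z)"
      by (rule int) (use \<tau> in \<open>auto simp: indicator_def\<close>)
    show "AE Z in measure_pmf ?P. \<bar>(1 - ?p Z) * ?I Z - ?I Z * (1 - ?c)\<bar> \<le> \<tau> + indicator ?B Z"
    proof (rule AE_pmfI)
      fix Z
      show "\<bar>(1 - ?p Z) * ?I Z - ?I Z * (1 - ?c)\<bar> \<le> \<tau> + indicator ?B Z"
      proof (cases "Z \<in> ?B")
        case True
        then show ?thesis
          using b[of Z] \<tau> by simp
      next
        case False
        then have "\<not> indep {..<k} Z \<or> \<bar>?p Z - ?c\<bar> \<le> \<tau>"
          by auto
        moreover have "\<bar>(1 - x) - (1 - y)\<bar> = \<bar>x - y\<bar>" for x y :: real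
          by linarith
        note this[of "?p Z" ?c]
        ultimately have "\<bar>(1 - ?p Z) * ?I Z - ?I Z * (1 - ?c)\<bar> \<le> \<tau>"
          using \<tau> by (cases "indep {..<k} Z")
            (simp_all only: of_bool_eq mult_1_right mult_1_left mult_zero_right mult_zero_left diff_zero abs_zero
              not_True_eq_False not_False_eq_True simp_thms)
        moreover have "indicator ?B Z = (0 :: real)"
          using False by (rule indicator_simps)
        ultimately show ?thesis
          by linarith
      qed
    qed
  qed
  have "E ?P (\<lambda>Z. \<tau> + indicator ?B Z) = \<tau> + bad_prob k \<tau>"
  proof -
    have "integrable (measure_pmf ?P) (indicator ?B :: _ \<Rightarrow> real)"
      by (rule measure_pmf.integrable_const_bound[where B = 1]) auto
    then show ?thesis
      unfolding bad_prob_def by (subst Bochner_Integration.integral_add) simp_all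
  qed
  with f_le have "E ?P (\<lambda>Z. \<bar>?f Z\<bar>) \<le> \<tau> + bad_prob k \<tau>"
    by (simp only:)
  then show ?thesis
    unfolding diff by (rule order_trans[OF integral_abs_bound])
qed

text \<open>Far from the last row both numbers being compared are small, the first by Odlyzko's
  bound. With the sum of their bounds as \<open>\<tau>\<close> there is no exceptional
  event.\<close>

lemma bad_prob_early:
  assumes k: "k < n"
  shows "bad_prob k ((1 - \<alpha>) ^ (n - k) + (1/2) ^ (n - k)) = 0"
  unfolding bad_prob_def measure_pmf_zero_iff
proof (rule equals0I)
  let ?P = "Pi_pmf {..<k} zvec row_law"
  fix Z assume Z: "Z \<in> set_pmf ?P \<inter> {Z. indep {..<k} Z \<and>
      (1 - \<alpha>) ^ (n - k) + (1/2) ^ (n - k) < \<bar>perp (row_law k) (ann {..<k} Z) - 1 / q ^ (n - k)\<bar>}"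
  have "subsp (ann {..<k} Z)"
    using Z Pi_row_law_vecs[of Z k] k by (intro subsp_ann') auto
  moreover have "card (ann {..<k} Z) = q ^ (n - k)"
    using indep_card_ann(2)[of "{..<k}" Z] Z by simp
  ultimately have "perp (row_law k) (ann {..<k} Z) \<le> (1 - \<alpha>) ^ (n - k)"
    using k by (rule perp_row_law_le)
  moreover have "1 / real (q ^ (n - k)) \<le> (1/2) ^ (n - k)"
    using q_ge_2 by (simp add: power_divide frac_le power_mono)
  moreover have "0 \<le> (1 - \<alpha>) ^ (n - k)" "0 \<le> 1 / real (q ^ (n - k))"
    using alpha_less_1 by auto
  moreover have "0 \<le> perp (row_law k) (ann {..<k} Z)"
    by simp
  ultimately have "\<bar>perp (row_law k) (ann {..<k} Z) - 1 / real (q ^ (n - k))\<bar> \<le> (1 - \<alpha>) ^ (n - k) + (1/2) ^ (n - k)"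
    by linarith
  then show False
    using Z by simp
qed

lemma spread_if_not_sparse:
  assumes "\<not> (\<exists>w\<in>W. w \<noteq> zvec \<and> card (supp w) \<le> n div 64)" "V \<subseteq> W"
  shows "spread V"
  unfolding spread_def
proof (intro ballI impI)
  fix w assume "w \<in> V" "w \<noteq> zvec"
  then have "n div 64 < card (supp w)"
    using assms by auto
  then have "n \<le> 64 * card (supp w)"
    by linarith
  then have "real n \<le> 64 * real (card (supp w))"
    by linarith
  then show "real n / 64 \<le> real (card (supp w))"
    by simp
qed

lemma sparse_prob_eq:
  assumes "k0 \<le> k"
  shows "sparse_prob k0 = measure_pmf.prob (Pi_pmf {..<k} zvec row_law)
     {Z. \<exists>w\<in>ann {..<k0} Z. w \<noteq> zvec \<and> card (supp w) \<le> n div 64}"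
  unfolding sparse_prob_def
proof (rule prob_Pi_pmf_mono_set[symmetric])
  fix f g :: "nat \<Rightarrow> nat \<Rightarrow> 'a" assume "\<And>i. i \<in> {..<k0} \<Longrightarrow> f i = g i"
  then have "ann {..<k0} f = ann {..<k0} g"
    by (rule ann_cong)
  then show "(\<exists>w\<in>ann {..<k0} f. w \<noteq> zvec \<and> card (supp w) \<le> n div 64) =
      (\<exists>w\<in>ann {..<k0} g. w \<noteq> zvec \<and> card (supp w) \<le> n div 64)"
    by simp
qed (use assms in auto)

lemma prob_disj3_le:
  assumes "\<And>z. z \<in> set_pmf M \<Longrightarrow> P z \<Longrightarrow> Q1 z \<or> Q2 z \<or> Q3 z"
  shows "measure_pmf.prob M {z. P z} \<le>
    measure_pmf.prob M {z. Q1 z} + measure_pmf.prob M {z. Q2 z} + measure_pmf.prob M {z. Q3 z}"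
proof -
  have "measure_pmf.prob M {z. P z} = measure_pmf.prob M ({z. P z} \<inter> set_pmf M)"
    by (simp add: measure_Int_set_pmf)
  also have "\<dots> \<le> measure_pmf.prob M (({z. Q1 z} \<union> {z. Q2 z}) \<union> {z. Q3 z})"
    using assms by (intro measure_pmf.finite_measure_mono) auto
  also have "\<dots> \<le> measure_pmf.prob M ({z. Q1 z} \<union> {z. Q2 z}) + measure_pmf.prob M {z. Q3 z}"
    by (rule measure_Un_le) auto
  also have "measure_pmf.prob M ({z. Q1 z} \<union> {z. Q2 z}) \<le> measure_pmf.prob M {z. Q1 z} + measure_pmf.prob M {z. Q2 z}"
    by (rule measure_Un_le) auto
  finally show ?thesis
    by simp
qed

text \<open>The target \<open>1 / q ^ (n - k)\<close> is at most \<open>eps\<close> here, so an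
  upper bound of order \<open>eps\<close> for \<open>perp\<close> already gives closeness. It holds
  unless the first \<open>k0\<close> rows have a sparse normal vector or the annihilator is
  dominated.\<close>

lemma bad_prob_middle:
  assumes k: "k0 \<le> k" "k < n" "n div 2 \<le> k" and small: "1 / real (q ^ (n - k)) \<le> eps"
    and large: "real n * (1 - 1 / (4 * 22 ^ 9) * \<alpha>) ^ (n - n div 2) \<le> eps"
  shows "bad_prob k (4 * eps) \<le> sparse_prob k0 + real n * (2 * ((1/2) ^ 8) ^ (n div 2) * 2 ^ k)"
proof -
  let ?P = "Pi_pmf {..<k} zvec row_law"
  let ?V = "{W. subsp W \<and> card W = q ^ (n - k) \<and> (\<exists>i. dominated i W)}"
  have finV: "finite ?V"
    by (rule finite_subset[of _ "Pow vecs"]) (auto dest: subspD(1))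
  have "bad_prob k (4 * eps) \<le>
      measure_pmf.prob ?P {Z. \<exists>w\<in>ann {..<k0} Z. w \<noteq> zvec \<and> card (supp w) \<le> n div 64} +
      measure_pmf.prob ?P {Z. \<exists>W\<in>?V. indep_in {..<k} W Z} + measure_pmf.prob ?P {Z. False}"
    unfolding bad_prob_def
  proof (rule prob_disj3_le)
    fix Z assume Z: "Z \<in> set_pmf ?P"
      and b: "indep {..<k} Z \<and> 4 * eps < \<bar>perp (row_law k) (ann {..<k} Z) - 1 / q ^ (n - k)\<bar>"
    let ?W = "ann {..<k} Z"
    have W: "subsp ?W" "card ?W = q ^ (n - k)"
      using Pi_row_law_vecs[OF Z] k indep_card_ann(2)[of "{..<k}" Z] b by (auto intro: subsp_ann')
    show "(\<exists>w\<in>ann {..<k0} Z. w \<noteq> zvec \<and> card (supp w) \<le> n div 64) \<or>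
      (\<exists>W\<in>?V. indep_in {..<k} W Z) \<or> False"
    proof (rule ccontr)
      assume no: "\<not> ?thesis"
      have "ann {..<k} Z \<subseteq> ann {..<k0} Z"
        using k by (intro ann_antimono) auto
      then have "spread ?W"
        using no by (intro spread_if_not_sparse[of "ann {..<k0} Z"]) auto
      moreover have "\<not> (\<exists>i. dominated i ?W)"
        using no W b by (auto simp: indep_in_def)
      ultimately have "perp (row_law k) ?W \<le> 2 * (1 / card ?W + eps)"
        using dominated_or_small[OF W(1)] k by blast
      then have "perp (row_law k) ?W \<le> 4 * eps"
        using small unfolding W(2) by argo
      moreover have "0 \<le> perp (row_law k) ?W" "0 \<le> 1 / real (q ^ (n - k))"
        by auto
      ultimately have "\<bar>perp (row_law k) ?W - 1 / real (q ^ (n - k))\<bar> \<le> 4 * eps"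
        using small eps_pos by linarith
      then show False
        using b by simp
    qed
  qed
  moreover have "measure_pmf.prob ?P {Z. \<exists>W\<in>?V. indep_in {..<k} W Z} \<le>
      real n * (2 * ((1/2) ^ 8) ^ (n div 2) * 2 ^ k * real 1)"
  proof (rule prob_exists_dominated_le[OF finV])
    fix U assume U: "subsp U" "card U = q ^ (n - k)"
    \<comment> \<open>All members of \<open>?V\<close> have the dimension of \<open>U\<close>, so at
      most one fits into it, and the exchange argument loses no factor for the number of
      subspaces.\<close>
    have "{W\<in>?V. W \<subseteq> U} \<subseteq> {U}"
      using U card_subset_eq[OF subspD(5)[OF U(1)]] by auto
    then have "card {W\<in>?V. W \<subseteq> U} \<le> card {U}"
      by (rule card_mono[rotated]) simp
    then show "card {W\<in>?V. W \<subseteq> U} \<le> 1"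
      by simp
  qed (use k large in \<open>auto dest: subspD(1)\<close>)
  ultimately show ?thesis
    using sparse_prob_eq[OF k(1)] by simp
qed

text \<open>Double counting of the pairs of \<open>w \<in> W\<close> and \<open>x\<close> with \<open>dot w x = \<zero>\<close>.\<close>

lemma perp_minus_le:
  assumes W: "subsp W" and \<xi>: "set_pmf \<xi> \<subseteq> vecs" and t: "0 \<le> t"
    and le: "\<And>w. w \<in> W \<Longrightarrow> w \<noteq> zvec \<Longrightarrow> \<bar>perp \<xi> {w} - 1 / q\<bar> \<le> t"
  shows "\<bar>perp \<xi> W - 1 / card W\<bar> \<le> 2 * t"
proof -
  let ?p = "perp \<xi> W" and ?c = "real (card W)" and ?q = "real q"
  have c: "?c > 0" "finite W" "zvec \<in> W"
    using subspD[OF W] by auto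
  have q: "?q \<ge> 2"
    using q_ge_2 by simp
  have "(\<Sum>w\<in>W. perp \<xi> {w}) = (\<Sum>w\<in>W. E \<xi> (indicator {x. dot w x = \<zero>}))"
    by (simp add: perp_def)
  also have "\<dots> = E \<xi> (\<lambda>x. \<Sum>w\<in>W. indicator {x. dot w x = \<zero>} x)"
    by (rule Bochner_Integration.integral_sum[symmetric], rule measure_pmf.integrable_const_bound[where B = 1]) auto
  \<comment> \<open>A vector \<open>x\<close> is orthogonal either to all of \<open>W\<close> or to
    exactly a fraction \<open>1 / q\<close> of it.\<close>
  also have "\<dots> = E \<xi> (\<lambda>x. ?c / ?q + (?c - ?c / ?q) * indicator {x. \<forall>w\<in>W. dot w x = \<zero>} x)"
  proof (rule Bochner_Integration.integral_cong_AE)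
    show "AE x in measure_pmf \<xi>. (\<Sum>w\<in>W. indicator {x. dot w x = \<zero>} x) =
        ?c / ?q + (?c - ?c / ?q) * indicator {x. \<forall>w\<in>W. dot w x = \<zero>} x"
    proof (rule AE_pmfI)
      fix x assume "x \<in> set_pmf \<xi>"
      then have x: "x \<in> vecs"
        using \<xi> by auto
      have "(\<Sum>w\<in>W. indicator {x. dot w x = \<zero>} x) = real (card {w\<in>W. dot w x = \<zero>})"
        using c by (simp add: indicator_def sum.If_cases Collect_conj_eq)
      also have "\<dots> = ?c / ?q + (?c - ?c / ?q) * indicator {x. \<forall>w\<in>W. dot w x = \<zero>} x"
      proof (cases "\<forall>w\<in>W. dot w x = \<zero>")
        case True
        then have "{w\<in>W. dot w x = \<zero>} = W"
          by auto
        then show ?thesis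
          using True by simp
      next
        case False
        then obtain w0 where "w0 \<in> W" "dot w0 x \<noteq> \<zero>"
          by blast
        then have "card W = q * card {w\<in>W. dot w x = \<zero>}"
          by (rule card_dot_kernel[OF W x])
        then show ?thesis
          using False q by (simp add: field_simps)
      qed
      finally show "(\<Sum>w\<in>W. indicator {x. dot w x = \<zero>} x) =
        ?c / ?q + (?c - ?c / ?q) * indicator {x. \<forall>w\<in>W. dot w x = \<zero>} x" .
    qed
  qed auto
  also have "\<dots> = ?c / ?q + (?c - ?c / ?q) * ?p"
  proof -
    have "integrable (measure_pmf \<xi>) (indicat_real {x. \<forall>w\<in>W. dot w x = \<zero>})"
      by (rule measure_pmf.integrable_const_bound[where B = 1]) auto
    then show ?thesis
      unfolding perp_def by (subst Bochner_Integration.integral_add) simp_all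
  qed
  finally have s: "(\<Sum>w\<in>W. perp \<xi> {w}) = ?c / ?q + (?c - ?c / ?q) * ?p" .
  have "perp \<xi> {zvec} = measure_pmf.prob \<xi> UNIV"
    unfolding perp_def by (rule measure_prob_cong_0) (use \<xi> in \<open>auto simp: set_pmf_eq\<close>)
  then have "(\<Sum>w\<in>W. perp \<xi> {w}) = 1 + (\<Sum>w\<in>W - {zvec}. perp \<xi> {w})"
    using c by (subst sum.remove) auto
  moreover have "(\<Sum>w\<in>W - {zvec}. perp \<xi> {w} - 1 / ?q) = (\<Sum>w\<in>W - {zvec}. perp \<xi> {w}) - (?c - 1) / ?q"
    using c by (simp add: sum_subtractf card_Diff_singleton of_nat_diff Suc_leI card_gt_0_iff)
  ultimately have e: "(\<Sum>w\<in>W - {zvec}. perp \<xi> {w} - 1 / ?q) = (1 - 1 / ?q) * (?c * ?p - 1)"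
    using s q by (simp add: field_simps)
  have "\<bar>(1 - 1 / ?q) * (?c * ?p - 1)\<bar> \<le> (\<Sum>w\<in>W - {zvec}. t)"
    unfolding e[symmetric] by (rule order_trans[OF sum_abs sum_mono]) (use le in auto)
  also have "\<dots> \<le> ?c * t"
    using t c(2) by (auto intro!: mult_right_mono card_mono)
  finally have "(1 - 1 / ?q) * \<bar>?c * ?p - 1\<bar> \<le> ?c * t"
    using q by (simp add: abs_mult)
  \<comment> \<open>\<open>1 - 1 / q \<ge> 1 / 2\<close> is the origin of the factor
    \<open>2\<close> in the conclusion.\<close>
  moreover have "1 / 2 * \<bar>?c * ?p - 1\<bar> \<le> (1 - 1 / ?q) * \<bar>?c * ?p - 1\<bar>"
    using q by (intro mult_right_mono) (auto simp: field_simps)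
  ultimately have "1 / 2 * \<bar>?c * ?p - 1\<bar> \<le> ?c * t"
    by (rule order_trans[rotated])
  then have "\<bar>?c * ?p - 1\<bar> \<le> 2 * (?c * t)"
    by simp
  moreover have "\<bar>?c * ?p - 1\<bar> = ?c * \<bar>?p - 1 / ?c\<bar>"
  proof -
    have "?c * ?p - 1 = ?c * (?p - 1 / ?c)"
      using c(1) by (simp add: right_diff_distrib)
    then show ?thesis
      using c(1) by (simp add: abs_mult)
  qed
  ultimately have "?c * \<bar>?p - 1 / ?c\<bar> \<le> ?c * (2 * t)"
    by (simp add: mult_ac)
  then show ?thesis
    using c(1) by simp
qed

text \<open>The bias is at most \<open>1 / q\<close> times the sum, over the nonzero multiples of
  \<open>w\<close>, of these bounds for the Fourier transform; if it exceeds \<open>\<tau>\<close>,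
  one of them does.\<close>

lemma exists_large_character_sum:
  assumes i: "i < n" and w: "w \<in> vecs" "w \<noteq> zvec" and "\<tau> < \<bar>perp (row_law i) {w} - 1 / q\<bar>" "0 \<le> \<tau>"
  shows "\<exists>t\<in>carrier F - {\<zero>}. \<tau> < exp (- vec_defect (\<mu> i) (smul t w) / 2)"
proof (rule ccontr)
  assume no: "\<not> ?thesis"
  have "(\<Sum>v\<in>line w - {zvec}. exp (- vec_defect (\<mu> i) v / 2)) \<le> (\<Sum>v\<in>line w - {zvec}. \<tau>)"
  proof (rule sum_mono)
    fix v assume v: "v \<in> line w - {zvec}"
    then obtain t where t: "t \<in> carrier F" "v = smul t w"
      by (auto simp: line_def)
    then have "t \<noteq> \<zero>"
      using v w by auto
    then show "exp (- vec_defect (\<mu> i) v / 2) \<le> \<tau>"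
      using no t by (force simp: not_less)
  qed
  also have "\<dots> \<le> real q * \<tau>"
    using assms(5) card_mono[of "line w" "line w - {zvec}"] card_line[OF w] subspD(5)[OF subsp_line[OF w(1)]]
    by (auto intro!: mult_right_mono)
  finally have "(\<Sum>v\<in>line w - {zvec}. exp (- vec_defect (\<mu> i) v / 2)) / real q \<le> \<tau>"
    using q_pos by (simp add: divide_le_eq mult.commute)
  then have "\<bar>perp (row (\<mu> i)) (line w) - 1 / real q\<bar> \<le> \<tau>"
    using perp_row_close_sum[OF subsp_line[OF w(1)], of "\<mu> i", OF set_mu[OF i]] card_line[OF w] by simp
  then show False
    using assms(4) perp_singleton[OF set_row_law[OF i] w(1)] by (simp add: row_law_def)
qed

text \<open>Markov's inequality for the moment of order \<open>2 * l\<close>. A biased vector has a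
  nonzero multiple whose exponential exceeds \<open>\<tau>\<close>, and allowing for the multiplier
  costs a factor \<open>q\<close>. The moment, summed over all of \<open>vecs\<close>, factorises
  over the coordinates.\<close>

lemma card_biased_le:
  assumes i: "i < n" and \<tau>: "0 < \<tau>" and l: "0 < l"
  shows "real (card {w\<in>vecs. w \<noteq> zvec \<and> \<tau> < \<bar>perp (row_law i) {w} - 1 / q\<bar>}) * \<tau> ^ (2 * l) \<le>
    real q * (1 + real q * ((1/2) ^ 5 + exp (- (real l * \<alpha>) / 22 ^ 5))) ^ n"
proof -
  let ?B = "{w\<in>vecs. w \<noteq> zvec \<and> \<tau> < \<bar>perp (row_law i) {w} - 1 / q\<bar>}"
  let ?G = "{v\<in>vecs. \<tau> < exp (- vec_defect (\<mu> i) v / 2)}"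
  have "?B \<subseteq> (\<Union>t\<in>carrier F - {\<zero>}. {w\<in>vecs. smul t w \<in> ?G})"
  proof
    fix w assume w: "w \<in> ?B"
    then obtain t where "t \<in> carrier F - {\<zero>}" "\<tau> < exp (- vec_defect (\<mu> i) (smul t w) / 2)"
      using exists_large_character_sum[OF i, of w \<tau>] \<tau> by auto
    then show "w \<in> (\<Union>t\<in>carrier F - {\<zero>}. {w\<in>vecs. smul t w \<in> ?G})"
      using w by auto
  qed
  then have "card ?B \<le> card (\<Union>t\<in>carrier F - {\<zero>}. {w\<in>vecs. smul t w \<in> ?G})"
    by (rule card_mono[rotated]) simp
  also have "\<dots> \<le> (\<Sum>t\<in>carrier F - {\<zero>}. card {w\<in>vecs. smul t w \<in> ?G})"
    by (rule card_UN_le) simp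
  also have "\<dots> \<le> (\<Sum>t\<in>carrier F - {\<zero>}. card ?G)"
  proof (rule sum_mono)
    fix t assume t: "t \<in> carrier F - {\<zero>}"
    have "inj_on (smul t) vecs"
    proof (rule inj_on_inverseI)
      fix w assume "w \<in> vecs"
      then show "smul (inv t) (smul t w) = w"
        using t field_Units by (auto simp: smul_def fun_eq_iff simp flip: m_assoc)
    qed
    then show "card {w\<in>vecs. smul t w \<in> ?G} \<le> card ?G"
      by (intro card_inj_on_le[of "smul t"]) (auto intro: inj_on_subset)
  qed
  also have "\<dots> \<le> q * card ?G"
    using card_mono[of "carrier F" "carrier F - {\<zero>}"] by (auto intro!: mult_right_mono)
  finally have B: "real (card ?B) \<le> real q * real (card ?G)"
    by (simp flip: of_nat_mult)
  have "real (card ?G) * \<tau> ^ (2 * l) = (\<Sum>v\<in>?G. \<tau> ^ (2 * l))"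
    by simp
  also have "\<dots> \<le> (\<Sum>v\<in>?G. exp (- (real l * vec_defect (\<mu> i) v)))"
  proof (rule sum_mono)
    fix v assume "v \<in> ?G"
    then have "\<tau> ^ (2 * l) \<le> exp (- vec_defect (\<mu> i) v / 2) ^ (2 * l)"
      using \<tau> by (intro power_mono) auto
    also have "\<dots> = exp (- (real l * vec_defect (\<mu> i) v))"
      by (simp flip: exp_of_nat_mult)
    finally show "\<tau> ^ (2 * l) \<le> exp (- (real l * vec_defect (\<mu> i) v))" .
  qed
  also have "\<dots> \<le> (\<Sum>v\<in>vecs. exp (- (real l * vec_defect (\<mu> i) v)))"
    by (intro sum_mono2) auto
  also have "\<dots> = (\<Sum>v\<in>vecs. \<Prod>j<n. exp (- (real l * defect (\<mu> i j) (v j))))"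
    by (simp add: vec_defect_def sum_distrib_left sum_negf flip: exp_sum)
  also have "\<dots> = (\<Prod>j<n. \<Sum>t\<in>carrier F. exp (- (real l * defect (\<mu> i j) t)))"
    unfolding vecs_def by (rule prod_sum_PiE_dflt[symmetric]) auto
  also have "\<dots> \<le> (\<Prod>j<n. 1 + real q * ((1/2) ^ 5 + exp (- (real l * \<alpha>) / 22 ^ 5)))"
    by (intro prod_mono conjI sum_nonneg sum_exp_defect_le bal i alpha_pos) (use l in auto)
  finally have G: "real (card ?G) * \<tau> ^ (2 * l) \<le> (1 + real q * ((1/2) ^ 5 + exp (- (real l * \<alpha>) / 22 ^ 5))) ^ n"
    by simp
  have "real (card ?B) * \<tau> ^ (2 * l) \<le> real q * real (card ?G) * \<tau> ^ (2 * l)"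
    using B \<tau> by (intro mult_right_mono) auto
  also have "\<dots> \<le> real q * (1 + real q * ((1/2) ^ 5 + exp (- (real l * \<alpha>) / 22 ^ 5))) ^ n"
    using mult_left_mono[OF G, of "real q"] by (simp add: mult.assoc)
  finally show ?thesis .
qed

text \<open>For bounded \<open>q\<close> the loss \<open>4 ^ q\<close> in passing from a multiple
  back to the vector is a constant. Every nonzero multiple of \<open>w\<close> thus has a defect of
  order \<open>\<alpha> * n\<close> itself, which rules out a bias above
  \<open>\<tau>\<close>.\<close>

lemma unbiased_if_small_field:
  assumes i: "i < n" and w: "w \<in> vecs" "w \<noteq> zvec" "spread (line w)" and q: "q \<le> 32"
    and \<tau>: "exp (- (\<alpha> * (real n / 64)) / (2 * 4 ^ 32)) \<le> \<tau>"
  shows "\<bar>perp (row_law i) {w} - 1 / q\<bar> \<le> \<tau>"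
proof (rule ccontr)
  assume "\<not> ?thesis"
  then obtain t where t: "t \<in> carrier F - {\<zero>}" "\<tau> < exp (- vec_defect (\<mu> i) (smul t w) / 2)"
    using exists_large_character_sum[OF i w(1,2), of \<tau>] order_trans[OF exp_ge_zero \<tau>] by auto
  let ?v = "smul t w"
  have v: "?v \<in> vecs" "?v \<in> line w"
    using t w by (auto simp: line_def)
  have "supp w \<noteq> {}"
    using supp_eq_empty_iff[OF w(1)] w(2) by simp
  then have "?v \<noteq> zvec"
    using supp_eq_empty_iff[OF v(1)] supp_smul[of t w] t w(1) by auto
  then have "real n / 64 \<le> real (card (supp ?v))"
    using w(3) v by (auto simp: spread_def)
  then have "\<alpha> * (real n / 64) \<le> \<alpha> * real (card (supp ?v))"
    using alpha_pos by (intro mult_left_mono) auto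
  also have "\<dots> \<le> 4 ^ q * vec_defect (\<mu> i) ?v"
    by (rule vec_defect_ge[OF bal[OF i] v(1)])
  also have "\<dots> \<le> 4 ^ 32 * vec_defect (\<mu> i) ?v"
    using q vec_defect_nonneg[OF v(1)] by (intro mult_right_mono power_increasing) auto
  finally have "exp (- vec_defect (\<mu> i) ?v / 2) \<le> exp (- (\<alpha> * (real n / 64)) / (2 * 4 ^ 32))"
    by (simp add: field_simps)
  then show False
    using t(2) \<tau> by linarith
qed

lemma dominated_line:
  assumes "w \<in> vecs" "dominated i (line w)"
  shows "dominated i {w}"
  unfolding dominated_def
proof (intro conjI allI impI)
  show i: "i < n"
    using assms(2) by (simp add: dominated_def)
  have lazy_law: "perp (lazy_law i) {w} = perp (lazy_law i) (line w)"
    by (rule perp_singleton[OF set_lazy_law[OF i] assms(1)])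
  show "eps \<le> perp (lazy_law i) {w}"
    using assms(2) lazy_law by (simp add: dominated_def)
  fix i' assume i': "i' < n"
  have "perp (row_law i') {w} = perp (row_law i') (line w)"
    by (rule perp_singleton[OF set_row_law[OF i'] assms(1)])
  then show "perp (row_law i') {w} \<le> (1/2) ^ 8 * perp (lazy_law i) {w}"
    using assms(2) lazy_law i' by (simp add: dominated_def)
qed

text \<open>
  In this range a union bound over vectors rather than subspaces is affordable, since the annihilator
  of the first \<open>m\<close> rows has only \<open>q ^ (n - m)\<close> elements.
\<close>

lemma bad_prob_late:
  fixes \<tau> :: real and k :: nat
  defines "B \<equiv> {w\<in>vecs. w \<noteq> zvec \<and> spread (line w) \<and> \<tau> < \<bar>perp (row_law k) {w} - 1 / q\<bar>}"
  assumes k: "k0 \<le> m" "m \<le> k" "k < n" "n div 2 \<le> m" and \<tau>: "0 \<le> \<tau>" and eps: "eps \<le> 1 / q"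
    and large: "real n * (1 - 1 / (4 * 22 ^ 9) * \<alpha>) ^ (n - n div 2) \<le> eps"
  shows "bad_prob k (2 * \<tau>) \<le> sparse_prob k0 +
    real n * (2 * ((1/2) ^ 8) ^ (n div 2) * 2 ^ m * real (q ^ (n - m))) + real (card B) * (4 / q) ^ m"
proof -
  let ?P = "Pi_pmf {..<k} zvec row_law"
  \<comment> \<open>Singletons make the exchange argument count the vectors in the annihilator of
    \<open>m\<close> rows, of which there are \<open>q ^ (n - m)\<close>.\<close>
  let ?V = "(\<lambda>w. {w}) ` {w\<in>vecs. \<exists>i. dominated i {w}}"
  let ?B = "{w\<in>B. \<forall>i<n. perp (row_law i) {w} \<le> 4 / q}"
  have finB: "finite B"
    by (simp add: B_def)
  have "bad_prob k (2 * \<tau>) \<le>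
      measure_pmf.prob ?P {Z. \<exists>w\<in>ann {..<k0} Z. w \<noteq> zvec \<and> card (supp w) \<le> n div 64} +
      measure_pmf.prob ?P {Z. \<exists>W\<in>?V. indep_in {..<m} W Z} +
      measure_pmf.prob ?P {Z. \<exists>w\<in>?B. \<forall>i\<in>{..<m}. \<forall>w'\<in>{w}. dot w' (Z i) = \<zero>}"
    unfolding bad_prob_def
  proof (rule prob_disj3_le)
    fix Z assume Z: "Z \<in> set_pmf ?P"
      and b: "indep {..<k} Z \<and> 2 * \<tau> < \<bar>perp (row_law k) (ann {..<k} Z) - 1 / q ^ (n - k)\<bar>"
    let ?W = "ann {..<k} Z"
    have Zv: "Z i \<in> vecs" if "i < k" for i
      using Pi_row_law_vecs[OF Z _ that] k by simp
    have W: "subsp ?W" "card ?W = q ^ (n - k)"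
      using Zv indep_card_ann(2)[of "{..<k}" Z] b by (auto intro: subsp_ann')
    \<comment> \<open>Were no nonzero vector of the annihilator biased, double counting would bring
      \<open>perp\<close> within \<open>2 * \<tau>\<close> of its target.\<close>
    have "\<exists>w\<in>?W. w \<noteq> zvec \<and> \<tau> < \<bar>perp (row_law k) {w} - 1 / q\<bar>"
    proof (rule ccontr)
      assume no: "\<not> ?thesis"
      have "\<bar>perp (row_law k) ?W - 1 / card ?W\<bar> \<le> 2 * \<tau>"
        by (rule perp_minus_le[OF W(1) set_row_law[OF k(3)] \<tau>]) (use no in auto)
      then show False
        using b W(2) by simp
    qed
    then obtain w where w: "w \<in> ?W" "w \<noteq> zvec" "\<tau> < \<bar>perp (row_law k) {w} - 1 / q\<bar>"
      by blast
    have wv: "w \<in> vecs"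
      using w(1) by (simp add: ann_def)
    have wm: "w \<in> ann {..<m} Z"
      using w(1) ann_antimono[of "{..<m}" "{..<k}" Z] k by auto
    have "indep {..<m} Z"
      by (rule indep_subset[of "{..<k}"]) (use b k Zv in auto)
    then have im: "indep_in {..<m} {w} Z"
      using wm by (simp add: indep_in_def)
    show "(\<exists>w\<in>ann {..<k0} Z. w \<noteq> zvec \<and> card (supp w) \<le> n div 64) \<or>
      (\<exists>W\<in>?V. indep_in {..<m} W Z) \<or> (\<exists>w\<in>?B. \<forall>i\<in>{..<m}. \<forall>w'\<in>{w}. dot w' (Z i) = \<zero>)"
    proof (rule ccontr)
      assume no: "\<not> ?thesis"
      have "line w \<subseteq> ?W"
        by (rule line_subset[OF W(1) w(1)])
      also have "?W \<subseteq> ann {..<k0} Z"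
        using k by (intro ann_antimono) auto
      finally have sp: "spread (line w)"
        using no by (intro spread_if_not_sparse[of "ann {..<k0} Z"]) auto
      have "\<not> (\<exists>i. dominated i (line w))"
      proof
        assume "\<exists>i. dominated i (line w)"
        then have "{w} \<in> ?V"
          using dominated_line wv by blast
        then show False
          using no im by blast
      qed
      then have le: "perp (row_law i) (line w) \<le> 2 * (1 / q + eps)" if "i < n" for i
        using dominated_or_small[OF subsp_line[OF wv] sp] that card_line[OF wv w(2)] by auto
      have "perp (row_law i) {w} \<le> 4 / q" if "i < n" for i
      proof -
        \<comment> \<open>A line that is not dominated obeys the bound
          \<open>2 * (1 / q + eps)\<close>; in this range \<open>eps \<le> 1 / q\<close>, whence
          \<open>4 / q\<close>.\<close>
        have "2 * (1 / q + eps) \<le> 2 * (1 / q + 1 / real q)"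
          using eps by (intro mult_left_mono add_mono) auto
        also have "\<dots> = 4 / q"
          by simp
        finally show ?thesis
          using le[OF that] perp_singleton[OF set_row_law[OF that] wv] by simp
      qed
      then have "w \<in> ?B"
        using wv w sp by (simp add: B_def)
      then show False
        using no wm by (auto simp: ann_def)
    qed
  qed
  moreover have "measure_pmf.prob ?P {Z. \<exists>W\<in>?V. indep_in {..<m} W Z} \<le>
      real n * (2 * ((1/2) ^ 8) ^ (n div 2) * 2 ^ m * real (q ^ (n - m)))"
  proof -
    have "measure_pmf.prob ?P {Z. \<exists>W\<in>?V. indep_in {..<m} W Z} =
        measure_pmf.prob (Pi_pmf {..<m} zvec row_law) {Z. \<exists>W\<in>?V. indep_in {..<m} W Z}"
    proof (rule prob_Pi_pmf_mono_set)
      fix f g :: "nat \<Rightarrow> nat \<Rightarrow> 'a" assume "\<And>i. i \<in> {..<m} \<Longrightarrow> f i = g i"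
      then have "indep_in {..<m} W f = indep_in {..<m} W g" for W
        by (rule indep_in_cong)
      then show "(\<exists>W\<in>?V. indep_in {..<m} W f) = (\<exists>W\<in>?V. indep_in {..<m} W g)"
        by simp
    qed (use k in auto)
    also have "\<dots> \<le> real n * (2 * ((1/2) ^ 8) ^ (n div 2) * 2 ^ m * real (q ^ (n - m)))"
    proof (rule prob_exists_dominated_le)
      fix U assume U: "subsp U" "card U = q ^ (n - m)"
      have "{W\<in>?V. W \<subseteq> U} \<subseteq> (\<lambda>w. {w}) ` U"
        by auto
      then have "card {W\<in>?V. W \<subseteq> U} \<le> card ((\<lambda>w. {w}) ` U)"
        using subspD(5)[OF U(1)] by (intro card_mono) auto
      also have "\<dots> \<le> q ^ (n - m)"
        using card_image_le[OF subspD(5)[OF U(1)]] U(2) by metis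
      finally show "card {W\<in>?V. W \<subseteq> U} \<le> q ^ (n - m)" .
    qed (use k large in auto)
    finally show ?thesis .
  qed
  moreover have "measure_pmf.prob ?P {Z. \<exists>w\<in>?B. \<forall>i\<in>{..<m}. \<forall>w'\<in>{w}. dot w' (Z i) = \<zero>} \<le> real (card B) * (4 / q) ^ m"
  proof -
    have "measure_pmf.prob ?P {Z. \<exists>w\<in>?B. \<forall>i\<in>{..<m}. \<forall>w'\<in>{w}. dot w' (Z i) = \<zero>} \<le>
        (\<Sum>w\<in>?B. measure_pmf.prob ?P {Z. \<forall>i\<in>{..<m}. \<forall>w'\<in>{w}. dot w' (Z i) = \<zero>})"
      by (rule prob_subset_sum) (use finB in auto)
    also have "\<dots> \<le> (\<Sum>w\<in>?B. (4 / q) ^ m)"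
    proof (rule sum_mono)
      fix w assume w: "w \<in> ?B"
      have "measure_pmf.prob ?P {Z. \<forall>i\<in>{..<m}. \<forall>w'\<in>{w}. dot w' (Z i) = \<zero>} = (\<Prod>i<m. perp (row_law i) {w})"
        unfolding perp_def by (rule prob_Pi_pmf_all) (use k in auto)
      also have "\<dots> \<le> (\<Prod>i<m. 4 / real q)"
        by (rule prod_mono) (use w k in auto)
      finally show "measure_pmf.prob ?P {Z. \<forall>i\<in>{..<m}. \<forall>w'\<in>{w}. dot w' (Z i) = \<zero>} \<le> (4 / q) ^ m"
        by simp
    qed
    also have "\<dots> \<le> real (card B) * (4 / q) ^ m"
      using finB by (auto intro!: mult_right_mono card_mono)
    finally show ?thesis .
  qed
  ultimately show ?thesis
    using sparse_prob_eq[of k0 k] k by linarith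
qed

end

section \<open>Quantitative estimates\<close>

lemma one_minus_power_le_exp:
  fixes a :: real
  assumes "a \<le> 1"
  shows "(1 - a) ^ k \<le> exp (- (a * real k))"
proof -
  have "1 - a \<le> exp (- a)"
    using exp_ge_add_one_self[of "- a"] by simp
  then have "(1 - a) ^ k \<le> exp (- a) ^ k"
    using assms by (intro power_mono) auto
  then show ?thesis
    by (simp add: mult.commute flip: exp_of_nat_mult)
qed

lemma small_subsets_le_exp:
  assumes "0 < x" "x \<le> 1" "N \<le> n"
  shows "real (card (small_subsets N D)) \<le> exp (real n * x + real D * ln (1 / x))"
proof -
  have "real (card (small_subsets N D)) * x ^ D \<le> (1 + x) ^ N"
    by (rule card_small_subsets_le[OF assms(1,2)])
  also have "\<dots> \<le> (1 + x) ^ n"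
    using assms by (intro power_increasing) auto
  also have "\<dots> \<le> exp (real n * x)"
    using one_minus_power_le_exp[of "- x" n] assms by (simp add: mult.commute)
  finally have "real (card (small_subsets N D)) * x ^ D * (1 / x) ^ D \<le> exp (real n * x) * (1 / x) ^ D"
    using assms by (intro mult_right_mono) auto
  moreover have "real (card (small_subsets N D)) * x ^ D * (1 / x) ^ D = real (card (small_subsets N D))"
    using assms by (simp add: mult.assoc flip: power_mult_distrib)
  moreover have "(1 / x) ^ D = exp (real D * ln (1 / x))"
    using assms by (simp add: exp_of_nat_mult)
  ultimately show ?thesis
    by (simp only: exp_add)
qed

context balanced_matrix begin

text \<open>The worst exponent stems from fields with at most \<open>32\<close> elements. It is
  \<open>\<alpha> * n / (64 * 2 * 4 ^ 32)\<close>, and \<open>64 * 2 * 4 ^ 32\<close> is at most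
  \<open>4 ^ 36\<close>.\<close>

definition rate :: real where
  "rate = exp (- (\<alpha> * real n / 4 ^ 36))"

lemma alpha_n_le: "\<alpha> * real n \<le> real n"
  using alpha_less_1 mult_right_mono[of \<alpha> 1 "real n"] by simp

lemma alpha_n_nonneg: "0 \<le> \<alpha> * real n"
  using alpha_pos by simp

lemma eps_ge: "exp (- (real n / 100)) \<le> eps"
  using alpha_n_le by (simp add: eps_def)

lemma eps_less_1: "eps < 1"
  using alpha_pos n_pos by (simp add: eps_def)

lemma eps_le_rate: "eps \<le> rate"
  using alpha_n_nonneg by (simp add: eps_def rate_def)

lemma half_power_le:
  assumes "64 \<le> n"
  shows "(1/2) ^ (n div 4) \<le> exp (- (real n / 10))"
proof -
  have "(1/2 :: real) ^ (n div 4) \<le> exp (- (1/2 * real (n div 4)))"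
    using one_minus_power_le_exp[of "1/2" "n div 4"] by simp
  also have "real n / 10 \<le> 1/2 * real (n div 4)"
    using assms by linarith
  then have "exp (- (1/2 * real (n div 4))) \<le> exp (- (real n / 10))"
    by simp
  finally show ?thesis .
qed

text \<open>Supports and spanning sets of rows are counted with generating parameter
  \<open>\<alpha> / 16\<close> up to size \<open>D\<close> and with \<open>1 / 32\<close> beyond. In
  both ranges the two counts together are outweighed by the decay over the remaining rows, at least
  \<open>n / 2\<close> of them.\<close>

lemma sparse_prob_le:
  assumes n: "64 \<le> n" and D: "0 < D" "D \<le> n div 64"
    and h2: "exp (- (\<alpha> * real D) / (2 * 22 ^ 4)) \<le> 1 / 40"
    and h3: "2 * (real D * ln (16 / \<alpha>)) \<le> \<alpha> * real n / 8"
  shows "sparse_prob (n - n div 4) \<le> exp (- (\<alpha> * real n / 8)) + exp (- (real n / 10))"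
proof -
  let ?k = "n - n div 4" and ?D = "n div 64"
  have "sparse_prob ?k \<le>
      real (card (small_subsets n D)) * (real (card (small_subsets ?k D)) * (1 - \<alpha>) ^ (?k - D)) +
      real (card (small_subsets n ?D)) * (real (card (small_subsets ?k ?D)) * (3/5) ^ (?k - ?D))"
    unfolding sparse_prob_def by (rule prob_sparse_le) (use D h2 in auto)
  also have "\<dots> \<le> exp (- (\<alpha> * real n / 8)) + exp (- (real n / 10))"
  proof (rule add_mono)
    \<comment> \<open>Two counts of size \<open>exp ?c\<close> amount to
      \<open>\<alpha> * n / 8\<close> in the exponent from the parameter and, by \<open>h3\<close>,
      at most as much again, against a decay of \<open>\<alpha> * n / 2\<close>.\<close>
    let ?c = "real n * (\<alpha> / 16) + real D * ln (1 / (\<alpha> / 16))"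
    have c: "real (card (small_subsets N D)) \<le> exp ?c" if "N \<le> n" for N
      by (rule small_subsets_le_exp) (use alpha_pos alpha_less_1 that in auto)
    have "(1 - \<alpha>) ^ (?k - D) \<le> exp (- (\<alpha> * real (?k - D)))"
      by (rule one_minus_power_le_exp) (use alpha_less_1 in simp)
    also have "real n / 2 \<le> real (?k - D)"
      using D n by linarith
    then have "\<alpha> * (real n / 2) \<le> \<alpha> * real (?k - D)"
      using alpha_pos by (intro mult_left_mono) auto
    then have "exp (- (\<alpha> * real (?k - D))) \<le> exp (- (\<alpha> * (real n / 2)))"
      by simp
    finally have "real (card (small_subsets n D)) * (real (card (small_subsets ?k D)) * (1 - \<alpha>) ^ (?k - D)) \<le>
        exp ?c * (exp ?c * exp (- (\<alpha> * (real n / 2))))"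
      by (intro mult_mono c) (use alpha_less_1 in auto)
    also have "\<dots> = exp (?c + (?c - \<alpha> * (real n / 2)))"
      by (simp only: exp_add diff_conv_add_uminus)
    also have "?c + (?c - \<alpha> * (real n / 2)) \<le> - (\<alpha> * real n / 8)"
    proof -
      have "?c + ?c = \<alpha> * real n / 8 + 2 * (real D * ln (16 / \<alpha>))"
        by simp
      also have "\<dots> \<le> \<alpha> * real n / 8 + \<alpha> * real n / 8"
        using h3 by simp
      finally show ?thesis
        using alpha_n_nonneg by simp
    qed
    finally show "real (card (small_subsets n D)) * (real (card (small_subsets ?k D)) * (1 - \<alpha>) ^ (?k - D)) \<le>
        exp (- (\<alpha> * real n / 8))"
      by simp
  next
    \<comment> \<open>Here both counts together cost less than \<open>0.18 * n\<close> in the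
      exponent, and the decay is \<open>0.292 * n\<close>.\<close>
    let ?c = "real n * (1 / 32) + real ?D * ln (1 / (1 / 32))"
    have c: "real (card (small_subsets N ?D)) \<le> exp ?c" if "N \<le> n" for N
      by (rule small_subsets_le_exp) (use that in auto)
    have ln32: "ln (32 :: real) \<le> 7 / 2"
    proof -
      have "ln (32 :: real) = 5 * ln 2"
        using ln_realpow[of 2 5] by simp
      then show ?thesis
        using ln2_le_25_over_36 by simp
    qed
    have "(3/5 :: real) ^ (?k - ?D) \<le> exp (- (2/5 * real (?k - ?D)))"
      using one_minus_power_le_exp[of "2/5" "?k - ?D"] by simp
    also have "73 / 100 * real n \<le> real (?k - ?D)"
      using n by linarith
    then have "exp (- (2/5 * real (?k - ?D))) \<le> exp (- (2/5 * (73 / 100 * real n)))"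
      by simp
    finally have "real (card (small_subsets n ?D)) * (real (card (small_subsets ?k ?D)) * (3/5) ^ (?k - ?D)) \<le>
        exp ?c * (exp ?c * exp (- (2/5 * (73 / 100 * real n))))"
      by (intro mult_mono c) auto
    also have "\<dots> = exp (?c + (?c - 2/5 * (73 / 100 * real n)))"
      by (simp only: exp_add diff_conv_add_uminus)
    also have "?c + (?c - 2/5 * (73 / 100 * real n)) \<le> - (real n / 10)"
    proof -
      have "real ?D * ln 32 \<le> real n / 64 * (7 / 2)"
        using ln32 by (intro mult_mono) auto
      then have "real ?D * ln (1 / (1 / 32)) \<le> real n / 64 * (7 / 2)"
        by simp
      have arith: "x * (1 / 32) + y + (x * (1 / 32) + y - 2/5 * (73 / 100 * x)) \<le> - (x / 10)"
        if "y \<le> x / 64 * (7 / 2)" "0 \<le> x" for x y :: real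
        using that by argo
      show ?thesis
        by (rule arith[OF \<open>real ?D * ln (1 / (1 / 32)) \<le> real n / 64 * (7 / 2)\<close>]) simp
    qed
    finally show "real (card (small_subsets n ?D)) * (real (card (small_subsets ?k ?D)) * (3/5) ^ (?k - ?D)) \<le>
        exp (- (real n / 10))"
      by simp
  qed
  finally show ?thesis .
qed

text \<open>From \<open>8 * (n div 2) \<ge> 4 * n - 4\<close> comes the factor
  \<open>16 * 2 ^ (- 4 * n)\<close>. One \<open>2 ^ (- n)\<close> of it cancels
  \<open>2 ^ m\<close>; the rest, at most \<open>exp (- 3 * n / 2)\<close>, absorbs
  \<open>N \<le> exp (n / 50)\<close>.\<close>

lemma swap_loss_le:
  assumes m: "m \<le> n" and N: "N \<le> 1 / eps ^ 2"
  shows "real n * (2 * ((1/2) ^ 8) ^ (n div 2) * 2 ^ m * N) \<le> 32 * real n * exp (- (real n / 10))"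
proof -
  have "((1/2 :: real) ^ 8) ^ (n div 2) = (1/2) ^ (8 * (n div 2))"
    by (simp add: power_mult)
  also have "\<dots> \<le> (1/2) ^ (4 * n - 4)"
    by (intro power_decreasing) auto
  also have "\<dots> \<le> 16 * (1/2) ^ (4 * n)"
  proof -
    have "(1/2 :: real) ^ (4 * n) = (1/2) ^ (4 * n - 4) * (1/2) ^ 4"
      using n_pos by (simp flip: power_add)
    then show ?thesis
      by (simp add: power_divide)
  qed
  also have "(1/2 :: real) ^ (4 * n) = (1/2) ^ (3 * n) * (1/2) ^ n"
    by (simp flip: power_add)
  finally have 1: "((1/2 :: real) ^ 8) ^ (n div 2) \<le> 16 * ((1/2) ^ (3 * n) * (1/2) ^ n)"
    by simp
  have 2: "(2 :: real) ^ m \<le> 2 ^ n"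
    using m by (intro power_increasing) auto
  have "((1/2 :: real) ^ 8) ^ (n div 2) * 2 ^ m \<le> (16 * ((1/2) ^ (3 * n) * (1/2) ^ n)) * 2 ^ n"
    by (intro mult_mono 1 2) auto
  also have "\<dots> = 16 * (1/2) ^ (3 * n)"
    by (simp add: power_divide)
  also have "\<dots> \<le> 16 * exp (- (1/2 * real (3 * n)))"
    using one_minus_power_le_exp[of "1/2" "3 * n"] by simp
  finally have 3: "((1/2 :: real) ^ 8) ^ (n div 2) * 2 ^ m \<le> 16 * exp (- (1/2 * real (3 * n)))" .
  have "1 / eps ^ 2 \<le> 1 / exp (- (real n / 100)) ^ 2"
    using eps_ge eps_pos by (intro divide_left_mono power_mono) auto
  also have "\<dots> = exp (real n / 50)"
    by (simp add: exp_minus field_simps flip: exp_double)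
  finally have 4: "N \<le> exp (real n / 50)"
    using N by simp
  have "((1/2) ^ 8) ^ (n div 2) * 2 ^ m * N \<le> ((1/2) ^ 8) ^ (n div 2) * 2 ^ m * exp (real n / 50)"
    using 4 by (intro mult_left_mono) auto
  also have "\<dots> \<le> 16 * exp (- (1/2 * real (3 * n))) * exp (real n / 50)"
    using 3 by (intro mult_right_mono) auto
  also have "\<dots> = 16 * exp (- (1/2 * real (3 * n)) + real n / 50)"
    by (simp only: exp_add mult.assoc)
  also have "\<dots> \<le> 16 * exp (- (real n / 10))"
    by simp
  finally have "((1/2) ^ 8) ^ (n div 2) * 2 ^ m * N \<le> 16 * exp (- (real n / 10))" .
  then have "real n * 2 * (((1/2) ^ 8) ^ (n div 2) * 2 ^ m * N) \<le> real n * 2 * (16 * exp (- (real n / 10)))"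
    by (intro mult_left_mono) auto
  then show ?thesis
    by (simp add: mult_ac)
qed

text \<open>The power is at most \<open>exp (- \<alpha> * n / (8 * 22 ^ 9))\<close>. Half of this
  exponent absorbs the factor \<open>n\<close>, and the other half suffices for
  \<open>eps\<close>.\<close>

lemma large_if:
  assumes h4: "real n \<le> exp (\<alpha> * real n / (16 * 22 ^ 9))"
  shows "real n * (1 - 1 / (4 * 22 ^ 9) * \<alpha>) ^ (n - n div 2) \<le> eps"
proof -
  let ?b = "1 / (4 * 22 ^ 9) * \<alpha>"
  have "(1 - ?b) ^ (n - n div 2) \<le> exp (- (?b * real (n - n div 2)))"
    by (rule one_minus_power_le_exp) (use alpha_less_1 in simp)
  also have "real n / 2 \<le> real (n - n div 2)"
    by linarith
  then have "?b * (real n / 2) \<le> ?b * real (n - n div 2)"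
    using alpha_pos by (intro mult_left_mono) auto
  then have "exp (- (?b * real (n - n div 2))) \<le> exp (- (?b * (real n / 2)))"
    by simp
  finally have "real n * (1 - ?b) ^ (n - n div 2) \<le> exp (\<alpha> * real n / (16 * 22 ^ 9)) * exp (- (?b * (real n / 2)))"
    using h4 alpha_less_1 by (intro mult_mono) auto
  also have "\<dots> = exp (\<alpha> * real n / (16 * 22 ^ 9) - ?b * (real n / 2))"
    by (simp only: exp_diff exp_minus divide_inverse)
  also have "\<dots> \<le> eps"
    using alpha_n_nonneg by (simp add: eps_def)
  finally show ?thesis .
qed

text \<open>For \<open>q > 32\<close> and up to minor factors, there are at most
  \<open>(1 + q / 16) ^ n\<close> biased vectors against a probability of \<open>(4 / q) ^ n\<close>
  each. The product of the bases is \<open>4 / q + 1 / 4\<close>, which is at most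
  \<open>3 / 8\<close>; the minor factors are exponentials of small multiples of
  \<open>n\<close>.\<close>

lemma biased_union_le:
  fixes B m k
  defines "B \<equiv> {w\<in>vecs. w \<noteq> zvec \<and> spread (line w) \<and> rate < \<bar>perp (row_law k) {w} - 1 / q\<bar>}"
  assumes k: "k < n" and m: "m \<le> n" and N: "real (q ^ (n - m)) \<le> 1 / eps ^ 2" and q: "real q \<le> 1 / eps"
  shows "real (card B) * (4 / q) ^ m \<le> exp (- (real n / 10))"
proof (cases "q \<le> 32")
  case True
  have "exp (- (\<alpha> * (real n / 64)) / (2 * 4 ^ 32)) \<le> rate"
    using alpha_n_nonneg by (simp add: rate_def)
  then have "B = {}"
    unfolding B_def using unbiased_if_small_field[OF k _ _ _ True, of _ rate] by force
  then show ?thesis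
    by simp
next
  case False
  then have q32: "real q \<ge> 32"
    by simp
  \<comment> \<open>Large enough for \<open>exp (- l * \<alpha> / 22 ^ 5) \<le> exp (- 4)\<close>,
    which is at most \<open>1 / 32\<close> and so matches the other summand
    \<open>(1/2) ^ 5\<close>.\<close>
  define l where "l = nat \<lceil>4 * 22 ^ 5 / \<alpha>\<rceil>"
  have "4 * 22 ^ 5 / \<alpha> \<le> real l" "real l \<le> 4 * 22 ^ 5 / \<alpha> + 1"
    using alpha_pos by (auto simp: l_def)
  then have l: "4 * 22 ^ 5 \<le> real l * \<alpha>" "real l * \<alpha> \<le> 5 * 22 ^ 5"
    using alpha_pos alpha_less_1 by (auto simp: field_simps)
  then have lpos: "0 < l"
    by (auto intro: Nat.gr0I)
  let ?\<kappa> = "(1/2) ^ 5 + exp (- (real l * \<alpha>) / 22 ^ 5) :: real"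
  have "exp (- (real l * \<alpha>) / 22 ^ 5) \<le> exp (- 4)"
    using l(1) by simp
  also have "exp (- 4) \<le> (1 / 32 :: real)"
  proof -
    have "(5/2 :: real) \<le> exp 1"
      using exp_lower_Taylor_quadratic[of 1] by simp
    then have "(5/2 :: real) ^ 4 \<le> exp 1 ^ 4"
      by (intro power_mono) auto
    then have "32 \<le> exp (4 :: real)"
      by (simp add: power_divide flip: exp_of_nat_mult)
    then show ?thesis
      by (simp add: exp_minus field_simps)
  qed
  finally have \<kappa>: "?\<kappa> \<le> 1 / 16"
    by (simp add: power_divide)
  have r: "rate > 0"
    by (simp add: rate_def)
  have "real (card B) * rate ^ (2 * l) \<le>
      real (card {w\<in>vecs. w \<noteq> zvec \<and> rate < \<bar>perp (row_law k) {w} - 1 / q\<bar>}) * rate ^ (2 * l)"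
    unfolding B_def using r by (intro mult_right_mono) (auto intro!: card_mono)
  also have "\<dots> \<le> real q * (1 + real q * ?\<kappa>) ^ n"
    by (rule card_biased_le[OF k r lpos])
  finally have cB: "real (card B) * rate ^ (2 * l) \<le> real q * (1 + real q * ?\<kappa>) ^ n" .
  \<comment> \<open>\<open>l\<close> is of order \<open>1 / \<alpha>\<close>, so the \<alpha> in the
    exponent of \<open>rate\<close> cancels and the loss is independent of it.\<close>
  have rl: "exp (- (real n / 10)) \<le> rate ^ (2 * l)"
  proof -
    have "rate ^ (2 * l) = exp (- (2 * (real l * \<alpha>) * real n / 4 ^ 36))"
      by (simp add: rate_def mult_ac flip: exp_of_nat_mult)
    moreover have "2 * (real l * \<alpha>) * real n / 4 ^ 36 \<le> 2 * (5 * 22 ^ 5) * real n / 4 ^ 36"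
      using l(2) by (intro divide_right_mono mult_right_mono mult_left_mono) auto
    ultimately show ?thesis
      by simp
  qed
  have "real (card B) * exp (- (real n / 10)) \<le> real (card B) * rate ^ (2 * l)"
    using rl by (intro mult_left_mono) auto
  with cB have cB': "real (card B) * exp (- (real n / 10)) \<le> real q * (1 + real q * ?\<kappa>) ^ n"
    by linarith
  \<comment> \<open>Only \<open>m\<close> rows are available; completing the power to
    \<open>n\<close> costs at most \<open>q ^ (n - m)\<close>, hence at most
    \<open>1 / eps ^ 2\<close>.\<close>
  have "(4 / real q) ^ m \<le> (4 / real q) ^ n * real (q ^ (n - m))"
  proof -
    have "(4 / real q) ^ n * real (q ^ (n - m)) = (4 / real q) ^ m * ((4 / real q) ^ (n - m) * real q ^ (n - m))"
      using m by (simp add: mult.assoc flip: power_add)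
    also have "(4 / real q) ^ (n - m) * real q ^ (n - m) = 4 ^ (n - m)"
      using q32 by (simp flip: power_mult_distrib)
    finally show ?thesis
      using q32 by (simp add: mult_le_cancel_left1)
  qed
  also have "\<dots> \<le> (4 / real q) ^ n * (1 / eps ^ 2)"
    using N by (intro mult_left_mono) auto
  finally have q4: "(4 / real q) ^ m \<le> (4 / real q) ^ n * (1 / eps ^ 2)" .
  have "real (card B) * exp (- (real n / 10)) * (4 / real q) ^ m \<le>
      (real q * (1 + real q * ?\<kappa>) ^ n) * ((4 / real q) ^ n * (1 / eps ^ 2))"
    by (intro mult_mono cB' q4) (auto intro!: mult_nonneg_nonneg add_nonneg_nonneg)
  also have "\<dots> = real q * (1 / eps ^ 2) * ((1 + real q * ?\<kappa>) * (4 / real q)) ^ n"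
    by (simp only: power_mult_distrib mult_ac)
  also have "\<dots> \<le> (1 / eps) * (1 / eps ^ 2) * (3 / 8) ^ n"
  proof (intro mult_mono power_mono q)
    have "(1 + real q * ?\<kappa>) * (4 / real q) = 4 / real q + 4 * ?\<kappa>"
      using q32 by (simp add: field_simps)
    also have "\<dots> \<le> 4 / 32 + 4 * (1 / 16)"
      using q32 \<kappa> by (intro add_mono mult_left_mono divide_left_mono) auto
    finally show "(1 + real q * ?\<kappa>) * (4 / real q) \<le> 3 / 8"
      by simp
  qed (use eps_pos in \<open>auto intro!: mult_nonneg_nonneg add_nonneg_nonneg\<close>)
  also have "(1 / eps) * (1 / eps ^ 2) \<le> exp (3 * real n / 100)"
  proof -
    have "(1 / eps) * (1 / eps ^ 2) = (1 / eps) ^ 3"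
      by (simp add: power_divide power3_eq_cube power2_eq_square)
    also have "1 / eps \<le> 1 / exp (- (real n / 100))"
      using eps_ge eps_pos by (intro divide_left_mono) auto
    then have "(1 / eps) ^ 3 \<le> exp (real n / 100) ^ 3"
      using eps_pos by (intro power_mono) (auto simp: exp_minus field_simps)
    also have "\<dots> = exp (3 * real n / 100)"
      by (simp flip: exp_of_nat_mult)
    finally show ?thesis .
  qed
  also have "(3 / 8 :: real) ^ n \<le> exp (- (5/8 * real n))"
    using one_minus_power_le_exp[of "5/8" n] by simp
  finally have "real (card B) * exp (- (real n / 10)) * (4 / real q) ^ m \<le> exp (3 * real n / 100) * exp (- (5/8 * real n))"
    by (simp add: mult_left_mono mult_right_mono)
  then have "(real (card B) * (4 / real q) ^ m) * exp (- (real n / 10)) \<le> exp (3 * real n / 100) * exp (- (5/8 * real n))"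
    by (simp add: mult_ac)
  also have "\<dots> = exp (3 * real n / 100 - 5/8 * real n + real n / 10) * exp (- (real n / 10))"
    by (simp flip: exp_add)
  finally have "real (card B) * (4 / real q) ^ m \<le> exp (3 * real n / 100 - 5/8 * real n + real n / 10)"
    by simp
  also have "\<dots> \<le> exp (- (real n / 10))"
    by simp
  finally show ?thesis .
qed

text \<open>The least \<open>d\<close> with \<open>1 / q ^ d \<le> eps\<close>. Minimality will give
  \<open>q ^ d \<le> 1 / eps ^ 2\<close> as soon as \<open>d \<ge> 2\<close>. It does not exceed
  \<open>n div 4\<close> because \<open>eps\<close> is at least
  \<open>exp (- n / 100)\<close>.\<close>

lemma exists_threshold_codim:
  assumes "64 \<le> n"
  shows "\<exists>d. 0 < d \<and> d \<le> n div 4 \<and> 1 / real (q ^ d) \<le> eps \<and> eps < 1 / real (q ^ (d - 1))"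
proof -
  have "1 / real (q ^ (n div 4)) \<le> (1/2) ^ (n div 4)"
    using q_ge_2 by (simp add: power_divide frac_le power_mono)
  also have "\<dots> \<le> exp (- (real n / 10))"
    by (rule half_power_le[OF assms])
  also have "\<dots> \<le> exp (- (real n / 100))"
    by simp
  also have "\<dots> \<le> eps"
    by (rule eps_ge)
  finally have ex: "1 / real (q ^ (n div 4)) \<le> eps" .
  define d where "d = (LEAST d. 1 / real (q ^ d) \<le> eps)"
  have d: "1 / real (q ^ d) \<le> eps" "d \<le> n div 4"
    unfolding d_def by (rule LeastI[of "\<lambda>d. 1 / real (q ^ d) \<le> eps", OF ex])
      (rule Least_le[of "\<lambda>d. 1 / real (q ^ d) \<le> eps", OF ex])
  have "d \<noteq> 0"
  proof
    assume "d = 0"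
    then show False
      using d(1) eps_less_1 by simp
  qed
  then have "\<not> 1 / real (q ^ (d - 1)) \<le> eps"
    using not_less_Least[of "d - 1" "\<lambda>d. 1 / real (q ^ d) \<le> eps"] by (simp add: d_def)
  then show ?thesis
    using d \<open>d \<noteq> 0\<close> by (intro exI[of _ d]) auto
qed

text \<open>\<open>\<tau>\<close> changes with the range of \<open>k\<close>, at
  \<open>n - n div 4\<close> and where the annihilator reaches the threshold dimension
  \<open>d\<close>. In \<open>50 * n\<close> the part \<open>32 * n\<close> is the loss of the
  exchange argument; the rest covers sparse vectors, biased vectors and \<open>\<tau>\<close>
  itself.\<close>

lemma exists_step_bound:
  assumes n: "64 \<le> n" and D: "0 < D" "D \<le> n div 64"
    and h2: "exp (- (\<alpha> * real D) / (2 * 22 ^ 4)) \<le> 1 / 40"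
    and h3: "2 * (real D * ln (16 / \<alpha>)) \<le> \<alpha> * real n / 8"
    and h4: "real n \<le> exp (\<alpha> * real n / (16 * 22 ^ 9))"
    and k: "k < n"
  shows "\<exists>\<tau>\<ge>0. \<tau> + bad_prob k \<tau> \<le> 50 * real n * rate"
proof -
  let ?k0 = "n - n div 4"
  obtain d where d: "0 < d" "d \<le> n div 4" "1 / real (q ^ d) \<le> eps" "eps < 1 / real (q ^ (d - 1))"
    using exists_threshold_codim[OF n] by blast
  have rate: "0 < rate" "exp (- (real n / 10)) \<le> rate" "exp (- (\<alpha> * real n / 8)) \<le> rate"
    using alpha_n_le alpha_n_nonneg by (auto simp: rate_def)
  have nr: "rate \<le> real n * rate"
    using rate n by simp
  have sparse: "sparse_prob ?k0 \<le> 2 * rate"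
    using sparse_prob_le[OF n D h2 h3] rate by linarith
  have large: "real n * (1 - 1 / (4 * 22 ^ 9) * \<alpha>) ^ (n - n div 2) \<le> eps"
    by (rule large_if[OF h4])
  have loss: "32 * real n * exp (- (real n / 10)) \<le> 32 * real n * rate"
    using rate by (intro mult_left_mono) auto
  consider "k < ?k0" | "?k0 \<le> k" "k \<le> n - d" | "n - d < k"
    by linarith
  then show ?thesis
  proof cases
    case 1
    let ?\<tau> = "(1 - \<alpha>) ^ (n - k) + (1/2) ^ (n - k)"
    have "(1 - \<alpha>) ^ (n - k) \<le> (1 - \<alpha>) ^ (n div 4)"
      using 1 alpha_less_1 alpha_pos by (intro power_decreasing) auto
    also have "\<dots> \<le> exp (- (\<alpha> * real (n div 4)))"
      by (rule one_minus_power_le_exp) (use alpha_less_1 in simp)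
    also have "real n / 8 \<le> real (n div 4)"
      using n by linarith
    then have "\<alpha> * (real n / 8) \<le> \<alpha> * real (n div 4)"
      using alpha_pos by (intro mult_left_mono) auto
    then have "exp (- (\<alpha> * real (n div 4))) \<le> rate"
      using rate(3) by (intro order_trans[OF _ rate(3)]) simp
    finally have a: "(1 - \<alpha>) ^ (n - k) \<le> rate" .
    have "(1/2 :: real) ^ (n - k) \<le> (1/2) ^ (n div 4)"
      using 1 by (intro power_decreasing) auto
    also have "\<dots> \<le> rate"
      using half_power_le[OF n] rate by linarith
    finally have "?\<tau> \<le> 2 * rate"
      using a by simp
    then have "?\<tau> + bad_prob k ?\<tau> \<le> 50 * real n * rate"
      using bad_prob_early[OF k] nr rate by linarith
    then show ?thesis
      using alpha_less_1 by (intro exI[of _ ?\<tau>]) auto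
  next
    case 2
    have "1 / real (q ^ (n - k)) \<le> 1 / real (q ^ d)"
      using 2 k d q_ge_2 by (intro divide_left_mono) (auto intro!: power_increasing)
    then have small: "1 / real (q ^ (n - k)) \<le> eps"
      using d(3) by linarith
    have "1 \<le> 1 / eps ^ 2"
      using eps_pos eps_less_1 by (simp add: power_le_one)
    then have "real n * (2 * ((1/2) ^ 8) ^ (n div 2) * 2 ^ k * 1) \<le> 32 * real n * exp (- (real n / 10))"
      using k by (intro swap_loss_le) auto
    note swap = this[unfolded mult_1_right]
    have "n div 2 \<le> k"
      using 2(1) by linarith
    from bad_prob_middle[OF 2(1) k this small large]
    have "bad_prob k (4 * eps) \<le> 2 * rate + 32 * real n * rate"
      using sparse loss swap by linarith
    then have "4 * eps + bad_prob k (4 * eps) \<le> 50 * real n * rate"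
      using eps_le_rate nr rate by linarith
    then show ?thesis
      using eps_pos by (intro exI[of _ "4 * eps"]) auto
  next
    case 3
    \<comment> \<open>\<open>n - d < k < n\<close> forces \<open>d \<ge> 2\<close>, and then
      \<open>q \<le> q ^ (d - 1) < 1 / eps\<close>: for larger fields this range is empty.\<close>
    have d2: "2 \<le> d"
      using 3 k by linarith
    have eps_pow: "eps < 1 / real q ^ (d - 1)" "0 < real q"
      using d(4) q_pos by (auto simp: card_gt_0_iff)
    have "1 / real q ^ (d - 1) \<le> 1 / real q"
      using q_ge_2 d2 power_increasing[of 1 "d - 1" "real q"] by (intro divide_left_mono) auto
    then have eps_q: "eps \<le> 1 / real q"
      using eps_pow by linarith
    then have q_eps: "real q \<le> 1 / eps"
      using eps_pos eps_pow(2) by (simp add: field_simps)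
    have "real q ^ (d - 1) \<le> 1 / eps"
      using eps_pos eps_pow by (simp add: field_simps)
    then have "real q * real q ^ (d - 1) \<le> (1 / eps) * (1 / eps)"
      using q_eps eps_pos by (intro mult_mono) auto
    then have N: "real (q ^ d) \<le> 1 / eps ^ 2"
      using d(1) by (simp add: power2_eq_square flip: power_Suc)
    have nd: "n - (n - d) = d"
      using d(2) by linarith
    have "real n * (2 * ((1/2) ^ 8) ^ (n div 2) * 2 ^ (n - d) * real (q ^ (n - (n - d)))) \<le> 32 * real n * exp (- (real n / 10))"
      unfolding nd by (rule swap_loss_le[OF _ N]) simp
    moreover have "real (card {w\<in>vecs. w \<noteq> zvec \<and> spread (line w) \<and> rate < \<bar>perp (row_law k) {w} - 1 / q\<bar>}) * (4 / q) ^ (n - d)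
        \<le> exp (- (real n / 10))"
      by (rule biased_union_le[OF k _ _ q_eps]) (use N nd in auto)
    moreover have "bad_prob k (2 * rate) \<le> sparse_prob ?k0 +
        real n * (2 * ((1/2) ^ 8) ^ (n div 2) * 2 ^ (n - d) * real (q ^ (n - (n - d)))) +
        real (card {w\<in>vecs. w \<noteq> zvec \<and> spread (line w) \<and> rate < \<bar>perp (row_law k) {w} - 1 / q\<bar>}) * (4 / q) ^ (n - d)"
      by (rule bad_prob_late) (use d 3 k n rate eps_q large in auto)
    ultimately have "2 * rate + bad_prob k (2 * rate) \<le> 50 * real n * rate"
      using sparse loss nr rate by linarith
    then show ?thesis
      using rate by (intro exI[of _ "2 * rate"]) auto
  qed
qed

text \<open>The recursion is unrolled over the rows. All factors lie between \<open>0\<close> and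
  \<open>1\<close>, so earlier errors are not amplified and \<open>n\<close> steps cost
  \<open>n\<close> times the error of one.\<close>

lemma indep_prob_close:
  assumes n: "64 \<le> n" and D: "0 < D" "D \<le> n div 64"
    and h2: "exp (- (\<alpha> * real D) / (2 * 22 ^ 4)) \<le> 1 / 40"
    and h3: "2 * (real D * ln (16 / \<alpha>)) \<le> \<alpha> * real n / 8"
    and h4: "real n \<le> exp (\<alpha> * real n / (16 * 22 ^ 9))"
  shows "\<bar>indep_prob n - (\<Prod>i<n. 1 - 1 / real q ^ Suc i)\<bar> \<le> 50 * (real n)\<^sup>2 * rate"
proof -
  have "\<bar>indep_prob k - (\<Prod>i<k. 1 - 1 / real q ^ (n - i))\<bar> \<le> real k * (50 * real n * rate)" if "k \<le> n" for k
    using that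
  proof (induction k)
    case 0
    have "indep_prob 0 = 1"
      by (simp add: indep_prob_def)
    then show ?case
      by simp
  next
    case (Suc k)
    let ?c = "1 - 1 / real q ^ (n - k)" and ?p = "\<Prod>i<k. 1 - 1 / real q ^ (n - i)"
    have c: "0 \<le> ?c" "?c \<le> 1"
    proof -
      have "1 \<le> real q ^ (n - k)"
        using q_ge_2 by (intro one_le_power) simp
      then show "0 \<le> ?c"
        by simp
    qed simp
    obtain \<tau> where "0 \<le> \<tau>" "\<tau> + bad_prob k \<tau> \<le> 50 * real n * rate"
      using exists_step_bound[OF n D h2 h3 h4, of k] Suc.prems by (auto simp: Suc_le_eq)
    then have 1: "\<bar>indep_prob (Suc k) - indep_prob k * ?c\<bar> \<le> 50 * real n * rate"
      using indep_prob_Suc[of k \<tau>] Suc.prems by simp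
    have "\<bar>indep_prob k * ?c - ?p * ?c\<bar> = \<bar>indep_prob k - ?p\<bar> * ?c"
      using c by (simp add: abs_mult flip: left_diff_distrib)
    also have "\<dots> \<le> \<bar>indep_prob k - ?p\<bar> * 1"
      using c by (intro mult_left_mono) auto
    also have "\<dots> \<le> real k * (50 * real n * rate)"
      using Suc by simp
    finally have "\<bar>indep_prob (Suc k) - ?p * ?c\<bar> \<le> 50 * real n * rate + real k * (50 * real n * rate)"
      using 1 by linarith
    then show ?case
      by (simp add: distrib_right)
  qed
  from this[of n] have "\<bar>indep_prob n - (\<Prod>i<n. 1 - 1 / real q ^ (n - i))\<bar> \<le> 50 * (real n)\<^sup>2 * rate"
    by (simp add: power2_eq_square mult_ac)
  \<comment> \<open>Reversal of the order: the first row contributes the factor closest to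
    \<open>1\<close>.\<close>
  also have "(\<Prod>i<n. 1 - 1 / real q ^ (n - i)) = (\<Prod>i<n. 1 - 1 / real q ^ Suc i)"
    by (subst prod.nat_diff_reindex[symmetric]) (auto intro!: prod.cong simp: Suc_diff_Suc)
  finally show ?thesis .
qed

end

section \<open>Nonsingular matrices\<close>

lemma (in abelian_monoid) finsum_finsum_swap:
  assumes "finite A" "finite B" "\<And>i j. i \<in> A \<Longrightarrow> j \<in> B \<Longrightarrow> f i j \<in> carrier G"
  shows "(\<Oplus>i\<in>A. \<Oplus>j\<in>B. f i j) = (\<Oplus>j\<in>B. \<Oplus>i\<in>A. f i j)"
  using assms(1,3)
proof (induction A rule: finite_induct)
  case empty
  then show ?case
    by simp
next
  case (insert a A)
  have f: "f i j \<in> carrier G" if "i \<in> insert a A" "j \<in> B" for i j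
    using insert.prems that by blast
  have "(\<Oplus>i\<in>insert a A. \<Oplus>j\<in>B. f i j) = (\<Oplus>j\<in>B. f a j) \<oplus> (\<Oplus>i\<in>A. \<Oplus>j\<in>B. f i j)"
    using insert.hyps f by (intro finsum_insert) (auto intro!: finsum_closed)
  also have "\<dots> = (\<Oplus>j\<in>B. f a j) \<oplus> (\<Oplus>j\<in>B. \<Oplus>i\<in>A. f i j)"
    using insert.IH f by simp
  also have "\<dots> = (\<Oplus>j\<in>B. f a j \<oplus> (\<Oplus>i\<in>A. f i j))"
    using f by (intro finsum_addf[symmetric]) (auto intro!: finsum_closed)
  also have "\<dots> = (\<Oplus>j\<in>B. \<Oplus>i\<in>insert a A. f i j)"
    using insert.hyps f by (intro finsum_cong') (auto simp: finsum_insert Pi_def intro!: finsum_closed)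
  finally show ?case .
qed

lemma (in cring) mat_mult_closed:
  assumes "\<And>k. k < n \<Longrightarrow> A i k \<in> carrier R" "\<And>k. k < n \<Longrightarrow> B k j \<in> carrier R"
  shows "mat_mult R n A B i j \<in> carrier R"
  unfolding mat_mult_def using assms by (intro finsum_closed) auto

lemma (in cring) mat_mult_assoc:
  assumes "\<And>k. k < n \<Longrightarrow> A i k \<in> carrier R" "\<And>k l. k < n \<Longrightarrow> l < n \<Longrightarrow> B k l \<in> carrier R"
    "\<And>l. l < n \<Longrightarrow> C l j \<in> carrier R"
  shows "mat_mult R n (mat_mult R n A B) C i j = mat_mult R n A (mat_mult R n B C) i j"
proof -
  have "mat_mult R n (mat_mult R n A B) C i j = (\<Oplus>l\<in>{..<n}. \<Oplus>k\<in>{..<n}. A i k \<otimes> B k l \<otimes> C l j)"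
    unfolding mat_mult_def using assms by (intro finsum_cong' finsum_ldistr) (auto intro!: finsum_closed)
  also have "\<dots> = (\<Oplus>k\<in>{..<n}. \<Oplus>l\<in>{..<n}. A i k \<otimes> B k l \<otimes> C l j)"
    using assms by (intro finsum_finsum_swap) auto
  also have "\<dots> = mat_mult R n A (mat_mult R n B C) i j"
    unfolding mat_mult_def
  proof (rule finsum_cong')
    fix k assume "k \<in> {..<n}"
    then show "(\<Oplus>l\<in>{..<n}. A i k \<otimes> B k l \<otimes> C l j) = A i k \<otimes> (\<Oplus>l\<in>{..<n}. B k l \<otimes> C l j)"
      using assms by (subst finsum_rdistr) (auto intro!: finsum_cong' simp: m_assoc)
  qed (use assms in \<open>auto intro!: finsum_closed\<close>)
  finally show ?thesis .
qed

lemma (in cring) mat_mult_one_left: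
  assumes "i < n" "\<And>k. k < n \<Longrightarrow> B k j \<in> carrier R" "\<And>k. k < n \<Longrightarrow> I i k = (if i = k then \<one> else \<zero>)"
  shows "mat_mult R n I B i j = B i j"
proof -
  have "mat_mult R n I B i j = (\<Oplus>k\<in>{..<n}. if i = k then B k j else \<zero>)"
    unfolding mat_mult_def using assms by (intro finsum_cong') auto
  also have "\<dots> = B i j"
    using assms by (intro add.finprod_singleton[where f = "\<lambda>k. B k j"]) auto
  finally show ?thesis .
qed

context finite_field_vectors begin

definition rows_of :: "(nat \<Rightarrow> nat \<Rightarrow> 'a) \<Rightarrow> nat \<Rightarrow> nat \<Rightarrow> 'a" where
  "rows_of A = (\<lambda>i. if i < n then (\<lambda>j. if j < n then A i j else \<zero>) else zvec)"

text \<open>Independence of all \<open>n\<close> rows means that the map \<open>T\<close>, taking a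
  vector to its products with the rows, has trivial kernel. A left inverse of the matrix gives this.
  Conversely \<open>T\<close> is injective on a finite set, hence onto; the preimages of unit
  vectors are the columns of a right inverse, which injectivity makes two-sided.\<close>

lemma nonsingular_iff_indep:
  assumes A: "\<And>i j. i < n \<Longrightarrow> j < n \<Longrightarrow> A i j \<in> carrier F"
  shows "nonsingular F n A \<longleftrightarrow> indep {..<n} (rows_of A)"
proof -
  let ?Z = "rows_of A"
  have Zv: "?Z i \<in> vecs" for i
    using A by (auto simp: rows_of_def vecs_iff zvec_def)
  have sub: "subsp (ann {..<n} ?Z)"
    using Zv by (intro subsp_ann')
  \<comment> \<open>A vector is treated as a matrix all of whose columns equal it, so that
    associativity of the matrix product applies; the column index is immaterial.\<close>
  have dot: "dot w (?Z i) = mat_mult F n A (\<lambda>j _. w j) i k" if "w \<in> vecs" "i < n" for w i k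
    unfolding dot_def mat_mult_def
    by (rule finsum_cong') (use that A in \<open>auto simp: rows_of_def m_comm\<close>)
  have ind: "indep {..<n} ?Z \<longleftrightarrow> ann {..<n} ?Z = {zvec}"
  proof -
    have "indep {..<n} ?Z \<longleftrightarrow> card (ann {..<n} ?Z) = 1"
      using zero_closed by (auto simp: indep_def)
    also have "\<dots> \<longleftrightarrow> ann {..<n} ?Z = {zvec}"
      using subspD(2)[OF sub] by (auto simp: card_1_singleton_iff)
    finally show ?thesis .
  qed
  show ?thesis
  proof
    assume "nonsingular F n A"
    then obtain B where "\<forall>i<n. \<forall>j<n. B i j \<in> carrier F"
      "\<forall>i<n. \<forall>j<n. mat_mult F n B A i j = (if i = j then \<one> else \<zero>)"
      unfolding nonsingular_def by (elim exE conjE)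
    then have B: "\<And>i j. i < n \<Longrightarrow> j < n \<Longrightarrow> B i j \<in> carrier F"
      "\<And>i j. i < n \<Longrightarrow> j < n \<Longrightarrow> mat_mult F n B A i j = (if i = j then \<one> else \<zero>)"
      by simp_all
    have "w = zvec" if w: "w \<in> ann {..<n} ?Z" for w
    proof -
      have wv: "w \<in> vecs"
        using w by (simp add: ann_def)
      have "w i = \<zero>" if i: "i < n" for i
      proof -
        have "w i = mat_mult F n (mat_mult F n B A) (\<lambda>j _. w j) i 0"
          using i wv B(2) by (subst mat_mult_one_left) auto
        also have "\<dots> = mat_mult F n B (mat_mult F n A (\<lambda>j _. w j)) i 0"
          using i wv B(1) A by (intro mat_mult_assoc) auto
        also have "\<dots> = (\<Oplus>k\<in>{..<n}. B i k \<otimes> \<zero>)"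
          unfolding mat_mult_def[of _ _ B]
          using w wv B(1) i dot[OF wv, of _ 0] by (intro finsum_cong') (auto simp: ann_def)
        also have "\<dots> = (\<Oplus>k\<in>{..<n}. \<zero>)"
          using B(1) i by (intro finsum_cong') auto
        also have "\<dots> = \<zero>"
          by simp
        finally show ?thesis .
      qed
      then have "w j = \<zero>" for j
        using wv by (cases "j < n") (auto simp: vecs_iff)
      then show ?thesis
        by (auto simp: zvec_def)
    qed
    then show "indep {..<n} ?Z"
      unfolding ind using subspD(2)[OF sub] by blast
  next
    assume "indep {..<n} ?Z"
    then have triv: "ann {..<n} ?Z = {zvec}"
      using ind by simp
    define T where "T = (\<lambda>w i. if i < n then dot w (?Z i) else \<zero>)"
    have Tv: "T w \<in> vecs" if "w \<in> vecs" for w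
      using that Zv by (auto simp: T_def vecs_iff[of "\<lambda>i. _ i"])
    have inj: "inj_on T vecs"
    proof (rule inj_onI)
      fix v w assume vw: "v \<in> vecs" "w \<in> vecs" "T v = T w"
      let ?u = "vadd (smul (\<ominus> \<one>) v) w"
      have "dot ?u (?Z i) = \<zero>" if "i < n" for i
      proof -
        have "dot v (?Z i) = dot w (?Z i)"
          using fun_cong[OF vw(3), of i] that by (simp add: T_def)
        then show ?thesis
          using vw Zv by (simp add: dot_vadd dot_smul l_minus l_neg)
      qed
      then have "?u \<in> ann {..<n} ?Z"
        using vw by (simp add: ann_def)
      then have "?u = zvec"
        using triv by blast
      then have "vadd v zvec = w"
        using vadd_neg_cancel(1)[OF vw(1,2)] by simp
      then show "v = w"
        using vw by (simp add: vadd_def zvec_def)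
    qed
    have surj: "T ` vecs = vecs"
      by (rule endo_inj_surj) (use Tv inj in auto)
    define e where "e = (\<lambda>k i. if i = k \<and> k < n then \<one> else \<zero>)"
    have ev: "e k \<in> vecs" for k
      by (auto simp: e_def vecs_iff)
    have "\<exists>w\<in>vecs. T w = e k" for k
      using ev[of k] surj by (metis imageE)
    then obtain C where C: "\<And>k. C k \<in> vecs" "\<And>k. T (C k) = e k"
      by metis
    define B where "B = (\<lambda>j k. C k j)"
    have Bc: "B j k \<in> carrier F" for j k
      using C(1) by (simp add: B_def)
    have AB: "mat_mult F n A B i k = (if i = k then \<one> else \<zero>)" if "i < n" "k < n" for i k
    proof -
      have "mat_mult F n A B i k = mat_mult F n A (\<lambda>j _. C k j) i 0"
        by (simp add: mat_mult_def B_def)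
      also have "\<dots> = T (C k) i"
        using that by (simp add: T_def dot[of "C k" i 0, OF C(1)])
      also have "\<dots> = (if i = k then \<one> else \<zero>)"
        using that by (simp add: C(2) e_def)
      finally show ?thesis .
    qed
    have BA: "mat_mult F n B A i k = (if i = k then \<one> else \<zero>)" if "i < n" "k < n" for i k
    proof -
      \<comment> \<open>A column of \<open>B A\<close>. As \<open>A (B A) = (A B) A = A\<close>, it
        has the same image under \<open>T\<close> as the unit vector \<open>e k\<close>.\<close>
      define v where "v = (\<lambda>i. if i < n then mat_mult F n B A i k else \<zero>)"
      have vv: "v \<in> vecs"
        unfolding v_def vecs_iff using Bc A that by (auto intro!: mat_mult_closed)
      have "T v i = T (e k) i" for i
      proof (cases "i < n")
        case True
        have "T v i = mat_mult F n A (\<lambda>j _. v j) i k"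
          using True by (simp add: T_def dot[OF vv, of i k])
        also have "\<dots> = mat_mult F n A (mat_mult F n B A) i k"
          unfolding mat_mult_def[of _ _ A] using True that Bc A
          by (intro finsum_cong') (auto simp: v_def intro!: mat_mult_closed)
        also have "\<dots> = mat_mult F n (mat_mult F n A B) A i k"
          using True that Bc A by (intro mat_mult_assoc[symmetric]) auto
        also have "\<dots> = A i k"
          using True that A AB by (intro mat_mult_one_left) auto
        also have "\<dots> = dot (?Z i) (e k)"
        proof -
          have "dot (?Z i) (e k) = (\<Oplus>j\<in>{..<n}. if k = j then A i j else \<zero>)"
            unfolding dot_def by (rule finsum_cong') (use True that A in \<open>auto simp: rows_of_def e_def\<close>)
          also have "\<dots> = A i k"
            using True that A by (intro add.finprod_singleton) auto
          finally show ?thesis ..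
        qed
        also have "\<dots> = T (e k) i"
          using True by (simp add: T_def dot_commute[OF Zv ev])
        finally show ?thesis .
      qed (simp add: T_def)
      then have "T v = T (e k)"
        by (rule ext)
      then have "v = e k"
        using inj vv ev by (auto dest: inj_onD)
      then have "v i = e k i"
        by (rule fun_cong)
      then show ?thesis
        using that by (simp add: v_def e_def)
    qed
    show "nonsingular F n A"
      unfolding nonsingular_def using Bc AB BA by (intro exI[of _ B]) auto
  qed
qed

end

context balanced_matrix begin

text \<open>By independence of the entries the point masses of the padded matrix are products over
  all entries, exactly as for independent rows with independent entries. The result then follows by
  translating nonsingularity into independence of the rows.\<close>

lemma prob_nonsingular_eq:
  assumes indep: "prob_space.indep_vars (measure_pmf M) (\<lambda>_. count_space UNIV) (\<lambda>(i, j) A. A i j) ({..<n} \<times> {..<n})"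
    and law: "\<And>i j. i < n \<Longrightarrow> j < n \<Longrightarrow> map_pmf (\<lambda>A. A i j) M = \<mu> i j"
  shows "measure_pmf.prob M {A. nonsingular F n A} = indep_prob n"
proof -
  have "map_pmf rows_of M = Pi_pmf {..<n} zvec row_law"
  proof (rule pmf_eqI)
    fix x
    have e: "pmf (Pi_pmf {..<n} zvec row_law) x = (if \<forall>i. i \<notin> {..<n} \<longrightarrow> x i = zvec then \<Prod>i<n. pmf (row_law i) (x i) else 0)"
      by (rule pmf_Pi) simp
    have e': "pmf (row_law i) y = (if \<forall>j. j \<notin> {..<n} \<longrightarrow> y j = \<zero> then \<Prod>j<n. pmf (\<mu> i j) (y j) else 0)" for i y
      unfolding row_law_def row_def by (rule pmf_Pi) simp
    have m: "pmf (map_pmf rows_of M) x = measure_pmf.prob M {A. rows_of A = x}"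
      by (simp add: pmf_map vimage_def)
    show "pmf (map_pmf rows_of M) x = pmf (Pi_pmf {..<n} zvec row_law) x"
    \<comment> \<open>Points that violate the padding have mass zero on both sides.\<close>
    proof (cases "(\<forall>i\<ge>n. x i = zvec) \<and> (\<forall>i<n. \<forall>j\<ge>n. x i j = \<zero>)")
      case True
      have "{A. rows_of A = x} = (\<Inter>ij\<in>{..<n} \<times> {..<n}. (\<lambda>(i, j) A. A i j) ij -` {x (fst ij) (snd ij)} \<inter> space (measure_pmf M))"
      proof (intro equalityI subsetI)
        fix A assume "A \<in> {A. rows_of A = x}"
        then have "x i j = A i j" if "i < n" "j < n" for i j
          using that by (auto simp: rows_of_def)
        then show "A \<in> (\<Inter>ij\<in>{..<n} \<times> {..<n}. (\<lambda>(i, j) A. A i j) ij -` {x (fst ij) (snd ij)} \<inter> space (measure_pmf M))"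
          by auto
      next
        fix A assume "A \<in> (\<Inter>ij\<in>{..<n} \<times> {..<n}. (\<lambda>(i, j) A. A i j) ij -` {x (fst ij) (snd ij)} \<inter> space (measure_pmf M))"
        then have "A i j = x i j" if "i < n" "j < n" for i j
          using that by auto
        then have "rows_of A i = x i" for i
          using True by (cases "i < n") (auto simp: rows_of_def fun_eq_iff)
        then show "A \<in> {A. rows_of A = x}"
          by auto
      qed
      then have "measure_pmf.prob M {A. rows_of A = x} = measure_pmf.prob M
          (\<Inter>ij\<in>{..<n} \<times> {..<n}. (\<lambda>(i, j) A. A i j) ij -` {x (fst ij) (snd ij)} \<inter> space (measure_pmf M))"
        by simp
      also have "\<dots> = (\<Prod>ij\<in>{..<n} \<times> {..<n}. measure_pmf.prob M
          ((\<lambda>(i, j) A. A i j) ij -` {x (fst ij) (snd ij)} \<inter> space (measure_pmf M)))"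
        by (rule prob_space.indep_varsD_finite[OF measure_pmf.prob_space_axioms indep]) (use n_pos in auto)
      also have "\<dots> = (\<Prod>ij\<in>{..<n} \<times> {..<n}. pmf (\<mu> (fst ij) (snd ij)) (x (fst ij) (snd ij)))"
      proof (rule prod.cong[OF refl])
        fix ij assume "ij \<in> {..<n} \<times> {..<n}"
        then obtain i j where ij: "ij = (i, j)" "i < n" "j < n"
          by auto
        then show "measure_pmf.prob M ((\<lambda>(i, j) A. A i j) ij -` {x (fst ij) (snd ij)} \<inter> space (measure_pmf M)) =
            pmf (\<mu> (fst ij) (snd ij)) (x (fst ij) (snd ij))"
          using law[of i j, symmetric] by (simp add: pmf_map)
      qed
      also have "\<dots> = (\<Prod>i<n. \<Prod>j<n. pmf (\<mu> i j) (x i j))"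
        by (simp add: prod.cartesian_product case_prod_unfold)
      also have "\<dots> = pmf (Pi_pmf {..<n} zvec row_law) x"
        using True by (simp add: e e' not_less)
      finally show ?thesis
        using m by simp
    next
      case False
      then have "{A. rows_of A = x} = {}"
        by (auto simp: rows_of_def zvec_def)
      moreover have "pmf (Pi_pmf {..<n} zvec row_law) x = 0"
      proof (cases "\<forall>i\<ge>n. x i = zvec")
        case True
        then obtain i j where ij: "i < n" "j \<ge> n" "x i j \<noteq> \<zero>"
          using False by auto
        then have "pmf (row_law i) (x i) = 0"
          by (auto simp: e')
        then show ?thesis
          using ij(1) by (auto simp: e prod_zero_iff)
      qed (auto simp: e)
      ultimately show ?thesis
        using m by simp
    qed
  qed
  then have "indep_prob n = measure_pmf.prob (map_pmf rows_of M) {Z. indep {..<n} Z}"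
    by (simp add: indep_prob_def)
  also have "\<dots> = measure_pmf.prob M {A. indep {..<n} (rows_of A)}"
    by (simp add: vimage_def)
  also have "\<dots> = measure_pmf.prob M {A. nonsingular F n A}"
  proof -
    have iff: "nonsingular F n A \<longleftrightarrow> indep {..<n} (rows_of A)" if A: "A \<in> set_pmf M" for A
    proof (rule nonsingular_iff_indep)
      fix i j assume ij: "i < n" "j < n"
      then have "A i j \<in> set_pmf (\<mu> i j)"
        using A law[of i j, symmetric] by auto
      then show "A i j \<in> carrier F"
        using set_mu[OF ij] by auto
    qed
    have "measure_pmf.prob M ({A. indep {..<n} (rows_of A)} \<inter> set_pmf M) =
        measure_pmf.prob M ({A. nonsingular F n A} \<inter> set_pmf M)"
      by (rule arg_cong[where f = "measure_pmf.prob M"]) (use iff in auto)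
    then show ?thesis
      by (simp add: measure_Int_set_pmf)
  qed
  finally show ?thesis ..
qed

end

text \<open>From \<open>n\<close> to \<open>n + N\<close> factors the product decreases by at most
  the geometric sum \<open>(1/2) ^ n - (1/2) ^ (n + N)\<close>, whatever \<open>q\<close> is; then
  \<open>N\<close> tends to infinity.\<close>

lemma prodinf_approx:
  fixes q :: nat
  assumes q: "2 \<le> q"
  defines "f \<equiv> \<lambda>i. 1 - 1 / real q ^ Suc i"
  shows "\<bar>(\<Prod>i<n. f i) - prodinf f\<bar> \<le> (1/2) ^ n" "0 \<le> prodinf f" "prodinf f \<le> 1"
proof -
  have e: "0 \<le> 1 / real q ^ Suc i" "1 / real q ^ Suc i \<le> (1/2) ^ Suc i" for i
  proof -
    have "1 / real q ^ Suc i \<le> 1 / 2 ^ Suc i"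
      using q by (intro frac_le power_mono) auto
    then show "1 / real q ^ Suc i \<le> (1/2) ^ Suc i"
      by (simp only: power_one_over[of 2])
  qed simp
  have half: "(1/2 :: real) ^ Suc i \<le> 1" for i
    by (intro power_le_one) auto
  have f: "0 \<le> f i" "f i \<le> 1" for i
    using e[of i] half[of i] unfolding f_def by linarith+
  have P: "0 \<le> (\<Prod>i<N. f i)" "(\<Prod>i<N. f i) \<le> 1" for N
    using f by (auto intro: prod_nonneg prod_le_1)
  have dec: "(\<Prod>i<n + N. f i) \<le> (\<Prod>i<n. f i)" for N
  proof (induction N)
    case (Suc N)
    have "(\<Prod>i<n + N. f i) * f (n + N) \<le> (\<Prod>i<n + N. f i) * 1"
      using f P by (intro mult_left_mono) auto
    then show ?case
      using Suc by simp
  qed simp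
  have inc: "(\<Prod>i<n. f i) - (\<Prod>i<n + N. f i) \<le> (1/2) ^ n - (1/2) ^ (n + N)" for N
  proof (induction N)
    case (Suc N)
    have "(\<Prod>i<n + N. f i) - (\<Prod>i<n + N. f i) * f (n + N) = (\<Prod>i<n + N. f i) * (1 / real q ^ Suc (n + N))"
      by (simp add: f_def algebra_simps)
    also have "\<dots> \<le> 1 * (1/2) ^ Suc (n + N)"
      using P e by (intro mult_mono) auto
    finally have "(\<Prod>i<n + N. f i) - (\<Prod>i<n + N. f i) * f (n + N) \<le> (1/2) ^ (n + N) - (1/2) ^ Suc (n + N)"
      by simp
    then show ?case
      using Suc by simp
  qed simp
  have close: "\<bar>(\<Prod>i<n. f i) - (\<Prod>i<n + N. f i)\<bar> \<le> (1/2) ^ n" for N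
  proof -
    have "0 \<le> (1/2 :: real) ^ (n + N)"
      by simp
    then show ?thesis
      using dec[of N] inc[of N] by linarith
  qed
  have "summable (\<lambda>i. norm (f i - 1))"
  proof (rule summable_comparison_test')
    show "summable (\<lambda>i. (1/2 :: real) ^ Suc i)"
      by (subst summable_Suc_iff) (simp add: summable_geometric)
    show "norm (norm (f i - 1)) \<le> (1/2) ^ Suc i" if "i \<ge> 0" for i
      using e[of i] by (simp add: f_def)
  qed
  then have "convergent_prod f"
    by (intro abs_convergent_prod_imp_convergent_prod summable_imp_abs_convergent_prod)
  then have "(\<lambda>N. \<Prod>i\<le>N. f i) \<longlonglongrightarrow> prodinf f"
    by (rule convergent_prod_LIMSEQ)
  then have "(\<lambda>N. \<Prod>i<Suc N. f i) \<longlonglongrightarrow> prodinf f"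
    by (simp add: lessThan_Suc_atMost)
  then have lim: "(\<lambda>N. \<Prod>i<N. f i) \<longlonglongrightarrow> prodinf f"
    by (rule LIMSEQ_imp_Suc)
  show "0 \<le> prodinf f" "prodinf f \<le> 1"
    by (rule LIMSEQ_le_const[OF lim], use P in blast) (rule LIMSEQ_le_const2[OF lim], use P in blast)
  have "(\<lambda>N. \<Prod>i<N + n. f i) \<longlonglongrightarrow> prodinf f"
    using lim by (rule LIMSEQ_ignore_initial_segment)
  then have "(\<lambda>N. \<bar>(\<Prod>i<n. f i) - (\<Prod>i<N + n. f i)\<bar>) \<longlonglongrightarrow> \<bar>(\<Prod>i<n. f i) - prodinf f\<bar>"
    by (intro tendsto_intros)
  then show "\<bar>(\<Prod>i<n. f i) - prodinf f\<bar> \<le> (1/2) ^ n"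
    by (rule LIMSEQ_le_const2) (use close in \<open>auto simp: add.commute\<close>)
qed

section \<open>Dependence of the constants on \<alpha>\<close>

lemma square_le_exp:
  fixes y :: real
  assumes "0 \<le> y"
  shows "y\<^sup>2 \<le> 2 * exp y"
  using exp_lower_Taylor_quadratic[OF assms] assms by simp

text \<open>\<open>D\<close> grows linearly in \<open>n\<close> with a slope depending on \<alpha>:
  small enough to keep the number of supports below \<open>D\<close> in check, yet a large multiple
  of \<open>1 / \<alpha>\<close> once \<open>n\<close> is large. The threshold \<open>n0\<close> is
  one source of the dependence of \<open>K\<close> on \<alpha>.\<close>

lemma exists_sparsity_threshold:
  fixes \<alpha> :: real
  assumes "0 < \<alpha>" "\<alpha> < 1"
  shows "\<exists>n0. \<forall>n\<ge>n0. 64 \<le> n \<and> real n \<le> exp (\<alpha> * real n / (16 * 22 ^ 9)) \<and>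
    (\<exists>D. 0 < D \<and> D \<le> n div 64 \<and> exp (- (\<alpha> * real D) / (2 * 22 ^ 4)) \<le> 1 / 40 \<and>
      2 * (real D * ln (16 / \<alpha>)) \<le> \<alpha> * real n / 8)"
proof -
  let ?L = "ln (16 / \<alpha>)"
  \<comment> \<open>The bound \<open>1 / 64\<close> ensures \<open>D \<le> n div 64\<close>; the
    other one makes \<open>D * ln (16 / \<alpha>)\<close> at most
    \<open>\<alpha> * n / 16\<close>.\<close>
  define \<delta> where "\<delta> = min (1 / 64) (\<alpha> / (16 * ?L))"
  define b where "b = \<alpha> / (16 * 22 ^ 9)"
  have L: "?L > 0"
    using assms by (intro ln_gt_zero) (simp add: field_simps)
  have \<delta>: "0 < \<delta>" "\<delta> \<le> 1 / 64" "\<delta> * (16 * ?L) \<le> \<alpha>"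
  proof -
    show "0 < \<delta>"
      using assms L by (simp add: \<delta>_def)
    show "\<delta> \<le> 1 / 64"
      by (simp add: \<delta>_def)
    have "\<delta> \<le> \<alpha> / (16 * ?L)"
      by (simp add: \<delta>_def)
    then show "\<delta> * (16 * ?L) \<le> \<alpha>"
      using L by (simp add: field_simps)
  qed
  have b: "0 < b"
    using assms by (simp add: b_def)
  \<comment> \<open>The second entry makes \<open>n\<close> smaller than the exponential, since a
    square is at most twice an exponential. The third makes \<open>\<alpha> * D\<close> at least
    \<open>10 * 22 ^ 4\<close>, and \<open>exp (- 5) \<le> 1 / 40\<close>; its extra
    \<open>2\<close> allows for rounding down and for \<open>0 < D\<close>.\<close>
  define c where "c = max 64 (max (2 / b\<^sup>2) ((2 + 10 * 22 ^ 4 / \<alpha>) / \<delta>))"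
  show ?thesis
  proof (intro exI[of _ "nat \<lceil>c\<rceil>"] allI impI)
    fix n assume "nat \<lceil>c\<rceil> \<le> n"
    then have c: "c \<le> real n"
      by linarith
    then have n: "64 \<le> real n" "2 / b\<^sup>2 \<le> real n" "(2 + 10 * 22 ^ 4 / \<alpha>) / \<delta> \<le> real n"
      unfolding c_def by simp_all
    have "real n \<le> exp (\<alpha> * real n / (16 * 22 ^ 9))"
    proof -
      have "2 \<le> real n * b\<^sup>2"
        using n(2) b by (simp add: divide_le_eq)
      then have "2 * real n \<le> (real n * b\<^sup>2) * real n"
        by (rule mult_right_mono) simp
      also have "\<dots> = (b * real n)\<^sup>2"
        by (simp add: power2_eq_square)
      also have "\<dots> \<le> 2 * exp (b * real n)"
        using b by (intro square_le_exp) simp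
      finally show ?thesis
        by (simp add: b_def)
    qed
    moreover have "\<exists>D. 0 < D \<and> D \<le> n div 64 \<and> exp (- (\<alpha> * real D) / (2 * 22 ^ 4)) \<le> 1 / 40 \<and>
      2 * (real D * ?L) \<le> \<alpha> * real n / 8"
    proof (intro exI[of _ "nat \<lfloor>\<delta> * real n\<rfloor>"] conjI)
      let ?D = "nat \<lfloor>\<delta> * real n\<rfloor>"
      have dn: "2 + 10 * 22 ^ 4 / \<alpha> \<le> \<delta> * real n"
        using n(3) \<delta>(1) by (simp add: divide_le_eq mult.commute)
      have pos: "0 \<le> 10 * 22 ^ 4 / \<alpha>"
        using assms by simp
      have D: "real ?D \<le> \<delta> * real n" "1 + 10 * 22 ^ 4 / \<alpha> \<le> real ?D"
        using dn pos by linarith+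
      show "0 < ?D"
        using D(2) pos by linarith
      have "\<delta> * real n \<le> 1 / 64 * real n"
        using \<delta>(2) by (intro mult_right_mono) auto
      then have "64 * real ?D \<le> real n"
        using D(1) by linarith
      then have "64 * ?D \<le> n"
        by linarith
      then show "?D \<le> n div 64"
        by linarith
      have "10 * 22 ^ 4 / \<alpha> \<le> real ?D"
        using D(2) by linarith
      then have "10 * 22 ^ 4 \<le> \<alpha> * real ?D"
        using assms by (simp add: divide_le_eq mult.commute)
      then have "exp (- (\<alpha> * real ?D) / (2 * 22 ^ 4)) \<le> exp (- 5)"
        by simp
      also have "exp (- 5) \<le> (1 / 40 :: real)"
      proof -
        have "(5/2 :: real) \<le> exp 1"
          using exp_lower_Taylor_quadratic[of 1] by simp
        then have "(5/2 :: real) ^ 5 \<le> exp 1 ^ 5"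
          by (intro power_mono) auto
        then have "40 \<le> exp (5 :: real)"
          by (simp add: power_divide flip: exp_of_nat_mult)
        then show ?thesis
          by (simp add: exp_minus field_simps)
      qed
      finally show "exp (- (\<alpha> * real ?D) / (2 * 22 ^ 4)) \<le> 1 / 40" .
      have "real ?D * ?L \<le> \<delta> * real n * ?L"
        using D(1) L by (intro mult_right_mono) auto
      also have "\<dots> = (\<delta> * (16 * ?L)) * real n / 16"
        by simp
      also have "\<dots> \<le> \<alpha> * real n / 16"
        using \<delta>(3) by (intro divide_right_mono mult_right_mono) auto
      finally show "2 * (real ?D * ?L) \<le> \<alpha> * real n / 8"
        by simp
    qed
    ultimately show "64 \<le> n \<and> real n \<le> exp (\<alpha> * real n / (16 * 22 ^ 9)) \<and>
      (\<exists>D. 0 < D \<and> D \<le> n div 64 \<and> exp (- (\<alpha> * real D) / (2 * 22 ^ 4)) \<le> 1 / 40 \<and>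
        2 * (real D * ?L) \<le> \<alpha> * real n / 8)"
      using n(1) by simp
  qed
qed

lemma (in field) exists_additive_character:
  assumes "finite (carrier R)"
  shows "\<exists>\<psi> :: 'a \<Rightarrow> complex. (\<forall>a\<in>carrier R. \<forall>b\<in>carrier R. \<psi> (a \<oplus> b) = \<psi> a * \<psi> b) \<and>
    \<psi> \<zero> = 1 \<and> (\<exists>a\<in>carrier R. \<psi> a \<noteq> 1)"
proof -
  have "\<one> \<in> carrier R - {\<zero>}"
    by simp
  then have "carrier R \<noteq> {\<zero>}"
    by blast
  then show ?thesis
    using add.exists_nontrivial_character assms by simp
qed

theorem theorem1p4:
  "\<exists>c::real. c > 0 \<and> (\<forall>\<alpha>::real. \<alpha> > 0 \<longrightarrow> (\<exists>K::real.
     \<forall>(n::nat) (q::nat) (F :: nat ring) (\<mu> :: nat \<Rightarrow> nat \<Rightarrow> nat pmf) (M :: (nat \<Rightarrow> nat \<Rightarrow> nat) pmf).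
       n \<ge> 1 \<longrightarrow>
       field F \<longrightarrow> finite (carrier F) \<longrightarrow> order F = q \<longrightarrow>
       (\<forall>i<n. \<forall>j<n. set_pmf (\<mu> i j) \<subseteq> carrier F \<and> balanced F \<alpha> (\<mu> i j)) \<longrightarrow>
       prob_space.indep_vars (measure_pmf M) (\<lambda>_. count_space UNIV)
         (\<lambda>(i, j) A. A i j) ({..<n} \<times> {..<n}) \<longrightarrow>
       (\<forall>i<n. \<forall>j<n. map_pmf (\<lambda>A. A i j) M = \<mu> i j) \<longrightarrow>
       \<bar>measure_pmf.prob M {A. nonsingular F n A} - prodinf (\<lambda>i. 1 - 1 / real q ^ Suc i)\<bar>
         \<le> K * exp (- c * \<alpha> * real n)))"
proof (rule exI[of _ "1 / 4 ^ 37 :: real"], intro conjI allI impI)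
  fix \<alpha> :: real
  assume \<alpha>: "\<alpha> > 0"
  let ?c = "1 / 4 ^ 37 :: real"
  \<comment> \<open>The gap between the exponent of \<open>rate\<close> and that of the conclusion;
    \<open>exp (a * n)\<close> absorbs the factor \<open>n ^ 2\<close>.\<close>
  define a where "a = \<alpha> * (1 / 4 ^ 36 - 1 / 4 ^ 37)"
  have a: "a > 0"
    using \<alpha> by (simp add: a_def)
  \<comment> \<open>Balanced laws exist only for \<open>\<alpha> < 1\<close>, so the threshold is
    requested under this condition.\<close>
  obtain n0 where n0: "\<And>n. \<alpha> < 1 \<Longrightarrow> n \<ge> n0 \<Longrightarrow> 64 \<le> n \<and> real n \<le> exp (\<alpha> * real n / (16 * 22 ^ 9)) \<and>
    (\<exists>D. 0 < D \<and> D \<le> n div 64 \<and> exp (- (\<alpha> * real D) / (2 * 22 ^ 4)) \<le> 1 / 40 \<and>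
      2 * (real D * ln (16 / \<alpha>)) \<le> \<alpha> * real n / 8)"
    using exists_sparsity_threshold[OF \<alpha>] by blast
  \<comment> \<open>The first summand serves \<open>n \<ge> n0\<close>, with \<open>51\<close> made
    of \<open>50\<close> for the finite product and \<open>1\<close> for truncating the infinite
    one. The second makes the bound at least \<open>1\<close> for smaller \<open>n\<close>, where it
    suffices that both quantities lie between \<open>0\<close> and \<open>1\<close>.\<close>
  define K where "K = 51 * (2 / a\<^sup>2) + exp (?c * \<alpha> * real n0)"
  show "\<exists>K::real.
     \<forall>(n::nat) (q::nat) (F :: nat ring) (\<mu> :: nat \<Rightarrow> nat \<Rightarrow> nat pmf) (M :: (nat \<Rightarrow> nat \<Rightarrow> nat) pmf).
       n \<ge> 1 \<longrightarrow>
       field F \<longrightarrow> finite (carrier F) \<longrightarrow> order F = q \<longrightarrow>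
       (\<forall>i<n. \<forall>j<n. set_pmf (\<mu> i j) \<subseteq> carrier F \<and> balanced F \<alpha> (\<mu> i j)) \<longrightarrow>
       prob_space.indep_vars (measure_pmf M) (\<lambda>_. count_space UNIV)
         (\<lambda>(i, j) A. A i j) ({..<n} \<times> {..<n}) \<longrightarrow>
       (\<forall>i<n. \<forall>j<n. map_pmf (\<lambda>A. A i j) M = \<mu> i j) \<longrightarrow>
       \<bar>measure_pmf.prob M {A. nonsingular F n A} - prodinf (\<lambda>i. 1 - 1 / real q ^ Suc i)\<bar>
         \<le> K * exp (- ?c * \<alpha> * real n)"
  proof (rule exI[of _ K], intro allI impI)
    fix n q :: nat and F :: "nat ring" and \<mu> :: "nat \<Rightarrow> nat \<Rightarrow> nat pmf" and M :: "(nat \<Rightarrow> nat \<Rightarrow> nat) pmf"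
    assume n: "n \<ge> 1" and F: "field F" "finite (carrier F)" and q: "order F = q"
      and bal: "\<forall>i<n. \<forall>j<n. set_pmf (\<mu> i j) \<subseteq> carrier F \<and> balanced F \<alpha> (\<mu> i j)"
      and indep: "prob_space.indep_vars (measure_pmf M) (\<lambda>_. count_space UNIV)
         (\<lambda>(i, j) A. A i j) ({..<n} \<times> {..<n})"
      and law: "\<forall>i<n. \<forall>j<n. map_pmf (\<lambda>A. A i j) M = \<mu> i j"
    interpret F: field F
      by (rule F(1))
    obtain \<psi> :: "nat \<Rightarrow> complex" where \<psi>:
      "\<And>a b. a \<in> carrier F \<Longrightarrow> b \<in> carrier F \<Longrightarrow> \<psi> (a \<oplus>\<^bsub>F\<^esub> b) = \<psi> a * \<psi> b"
      "\<psi> \<zero>\<^bsub>F\<^esub> = 1" "\<exists>a\<in>carrier F. \<psi> a \<noteq> 1"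
      using F.exists_additive_character[OF F(2)] by blast
    interpret C: finite_field_character F n \<psi>
      by unfold_locales (use F(2) \<psi> in auto)
    interpret B: balanced_matrix F n \<psi> \<mu> \<alpha>
      by unfold_locales (use bal \<alpha> n in \<open>auto simp: C.balanced_on_def balanced_def\<close>)
    let ?P = "measure_pmf.prob M {A. nonsingular F n A}" and ?f = "\<lambda>i. 1 - 1 / real q ^ Suc i"
    have q2: "2 \<le> q"
      using C.q_ge_2 q by (simp add: order_def)
    have P: "?P = B.indep_prob n"
      by (rule B.prob_nonsingular_eq[OF indep]) (use law in auto)
    have K: "exp (?c * \<alpha> * real n0) \<le> K" "51 * (2 / a\<^sup>2) \<le> K"
      using a by (auto simp: K_def)
    show "\<bar>?P - prodinf ?f\<bar> \<le> K * exp (- ?c * \<alpha> * real n)"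
    proof (cases "n0 \<le> n")
      case False
      have "\<bar>?P - prodinf ?f\<bar> \<le> 1"
        using prodinf_approx(2,3)[OF q2] measure_nonneg[of M "{A. nonsingular F n A}"]
          measure_pmf.prob_le_1[of M "{A. nonsingular F n A}"] by linarith
      also have "1 \<le> exp (?c * \<alpha> * real n0) * exp (- ?c * \<alpha> * real n)"
        using False \<alpha> by (simp flip: exp_add)
      also have "\<dots> \<le> K * exp (- ?c * \<alpha> * real n)"
        using K(1) by (intro mult_right_mono) auto
      finally show ?thesis .
    next
      case True
      obtain D where D: "64 \<le> n" "real n \<le> exp (\<alpha> * real n / (16 * 22 ^ 9))"
        "0 < D" "D \<le> n div 64" "exp (- (\<alpha> * real D) / (2 * 22 ^ 4)) \<le> 1 / 40"
        "2 * (real D * ln (16 / \<alpha>)) \<le> \<alpha> * real n / 8"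
        using n0[OF B.alpha_less_1 True] by blast
      have "\<bar>?P - (\<Prod>i<n. ?f i)\<bar> \<le> 50 * (real n)\<^sup>2 * B.rate"
        using B.indep_prob_close[OF D(1,3,4,5,6,2)] P q by (simp add: order_def)
      moreover have "\<bar>(\<Prod>i<n. ?f i) - prodinf ?f\<bar> \<le> B.rate"
      proof -
        have "(1/2 :: real) ^ n \<le> (1/2) ^ (n div 4)"
          by (intro power_decreasing) auto
        also have "\<dots> \<le> exp (- (real n / 10))"
          by (rule B.half_power_le[OF D(1)])
        also have "\<dots> \<le> B.rate"
          using B.alpha_n_le B.alpha_n_nonneg by (simp add: B.rate_def)
        finally show ?thesis
          using prodinf_approx(1)[OF q2, of n] by linarith
      qed
      moreover have "B.rate \<le> (real n)\<^sup>2 * B.rate"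
        using n by (simp add: B.rate_def)
      ultimately have "\<bar>?P - prodinf ?f\<bar> \<le> 51 * ((real n)\<^sup>2 * B.rate)"
        by linarith
      also have "(real n)\<^sup>2 * B.rate \<le> 2 / a\<^sup>2 * exp (- ?c * \<alpha> * real n)"
      proof -
        have "(a * real n)\<^sup>2 \<le> 2 * exp (a * real n)"
          using a by (intro square_le_exp) simp
        then have "(real n)\<^sup>2 \<le> 2 / a\<^sup>2 * exp (a * real n)"
          using a by (simp add: power_mult_distrib field_simps)
        then have "(real n)\<^sup>2 * B.rate \<le> 2 / a\<^sup>2 * exp (a * real n) * B.rate"
          by (rule mult_right_mono) (simp add: B.rate_def)
        also have "\<dots> = 2 / a\<^sup>2 * exp (a * real n + - (\<alpha> * real n / 4 ^ 36))"
          by (simp only: B.rate_def exp_add mult.assoc)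
        also have "a * real n + - (\<alpha> * real n / 4 ^ 36) = - ?c * \<alpha> * real n"
          by (simp add: a_def algebra_simps)
        finally show ?thesis .
      qed
      finally have "\<bar>?P - prodinf ?f\<bar> \<le> 51 * (2 / a\<^sup>2) * exp (- ?c * \<alpha> * real n)"
        by simp
      also have "\<dots> \<le> K * exp (- ?c * \<alpha> * real n)"
        using K(2) by (intro mult_right_mono) auto
      finally show ?thesis .
    qed
  qed
qed simp

end
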